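(* The semiregular (Archimedean) polyhedra other than the regular ones consist of exactly thirteen polyhedra together with two infinite groups, the prisms and the antiprisms, where polyhedra are distinguished by their vertex symbols. Precisely, a finite cyclic sequence of integers that are at least $3$, of length at least $3$ and with entries not all equal, considered up to rotation and reflection, is the vertex symbol of some Archimedean polyhedron if and only if it is one of the following: (a) one of the thirteen symbols - $3.4.3.4$ (cuboctahedron), - $4.6.10$ (great rhombicosidodecahedron), - $4.6.8$ (great rhombicuboctahedron), - $3.5.3.5$ (icosidodecahedron), - $3.4.5.4$ (small rhombicosidodecahedron), - $3.4.4.4$ (small rhombicuboctahedron), - $3.3.3.3.4$ (snub cube), - $3.3.3.3.5$ (snub dodecahedron), - $3.8.8$ (truncated cube), - $3.10.10$ (truncated dodecahedron), - $5.6.6$ (truncated icosahedron), - $4.6.6$ (truncated octahedron), - $3.6.6$ (truncated tetrahedron); (b) $4.4.m$ with $m\geqslant 3$, $m\neq 4$ (prisms); (c) $3.3.3.m$ with $m\geqslant 4$ (antiprisms).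
   Context: A polyhedron means a map on the sphere: a finite connected graph embedded in the $2$-sphere whose faces are the components of the complement, so that Euler's formula $V-E+F=2$ holds for the numbers $V$, $E$, $F$ of vertices, edges and faces. Every edge joins exactly two vertices and is a common side of two faces. Every vertex has degree at least $3$ and every face has at least $3$ sides. The degree of a face is its number of sides (the length of its boundary walk); a face of degree $p$ is called a $p$-gon. Going once around a vertex with $r$ incident edges, one meets $r$ corners of faces; the degrees of these faces, listed in this order, form a cyclic sequence of length $r$. A polyhedron is called Archimedean (or semiregular) if the cyclic order of the degrees of the faces surrounding each vertex is the same for all vertices, up to rotation and reflection. This common cyclic sequence, up to rotation and reflection, is its vertex symbol, written $p_1.p_2.\cdots.p_r$. The regular polyhedra are those with constant vertex symbol $p.p.\cdots.p$; for example, $4.4.4$ is the cube and $3.3.3.3$ is the octahedron. The thirteen non-regular polyhedra and the two infinite groups are counted by vertex symbol, so polyhedra with the same vertex symbol are not distinguished. *)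

theory Defs
  imports "HOL-Analysis.Analysis"
begin

text \<open>
  A graph on the unit sphere is a set \<open>V\<close> of points together with a set \<open>E\<close> of edges, each edge
  being the point set of an arc. Parallel edges are possible (they are different point sets).
\<close>

abbreviation S2 :: "(real^3) set" where
  "S2 \<equiv> sphere 0 1"

definition graph_points :: "(real^3) set \<Rightarrow> (real^3) set set \<Rightarrow> (real^3) set" where
  "graph_points V E = V \<union> \<Union>E"

text \<open>In Isabelle an \<open>arc\<close> is injective on the closed unit interval, so the two ends are distinct.\<close>

definition embedded_graph :: "(real^3) set \<Rightarrow> (real^3) set set \<Rightarrow> bool" where
  "embedded_graph V E \<longleftrightarrow>
     finite V \<and> V \<noteq> {} \<and> V \<subseteq> S2 \<and> finite E \<and>
     (\<forall>e\<in>E. e \<subseteq> S2 \<and>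
        (\<exists>g. arc g \<and> path_image g = e \<and> e \<inter> V = {pathstart g, pathfinish g})) \<and>
     (\<forall>e\<in>E. \<forall>e'\<in>E. e \<noteq> e' \<longrightarrow> e \<inter> e' \<subseteq> V)"

definition faces :: "(real^3) set \<Rightarrow> (real^3) set set \<Rightarrow> (real^3) set set" where
  "faces V E = components (S2 - graph_points V E)"

definition vertex_degree :: "(real^3) set set \<Rightarrow> real^3 \<Rightarrow> nat" where
  "vertex_degree E v = card {e \<in> E. v \<in> e}"

text \<open>
  An edge is a side of a face if it lies in the boundary of the face; as edges are disjoint from
  faces, this means that it lies in the closure. Below, every edge is required to be a side of two
  different faces. Hence the boundary walk of a face runs through each of its sides exactly once
  and its length is the number of these edges.
\<close>

definition face_sides :: "(real^3) set set \<Rightarrow> (real^3) set \<Rightarrow> (real^3) set set" where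
  "face_sides E f = {e \<in> E. e \<subseteq> closure f}"

definition face_degree :: "(real^3) set set \<Rightarrow> (real^3) set \<Rightarrow> nat" where
  "face_degree E f = card (face_sides E f)"

text \<open>Euler's formula is not a requirement; it is a consequence of these conditions.\<close>

definition polyhedral_map :: "(real^3) set \<Rightarrow> (real^3) set set \<Rightarrow> bool" where
  "polyhedral_map V E \<longleftrightarrow>
     embedded_graph V E \<and>
     connected (graph_points V E) \<and>
     (\<forall>e\<in>E. card {f \<in> faces V E. e \<in> face_sides E f} = 2) \<and>
     (\<forall>v\<in>V. vertex_degree E v \<ge> 3) \<and>
     (\<forall>f\<in>faces V E. face_degree E f \<ge> 3)"

text \<open>
  Going once around \<open>v\<close> one meets the edges \<open>es ! 0, es ! 1, \<dots>\<close>, and the corner between \<open>es ! i\<close>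
  and the next edge belongs to the face \<open>fs ! i\<close> (a face may occur at several corners).
  This is read off in a chart \<open>h\<close> of the sphere around \<open>v\<close>, onto the open unit disc, in which the
  edges at \<open>v\<close> become radii at the angles \<open>\<theta> 0 < \<theta> 1 < \<dots> < \<theta> r = \<theta> 0 + 2\<pi>\<close> and the open sectors
  between consecutive radii lie in faces. Such a chart exists at every vertex, by the Schoenflies
  theorem. The choice of the chart and of the numbering changes the two sequences only by a rotation
  or a reflection.
\<close>

definition radius_at :: "real \<Rightarrow> complex set" where
  "radius_at a = {of_real s * cis a | s. 0 \<le> s \<and> s < 1}"

definition sector_between :: "real \<Rightarrow> real \<Rightarrow> complex set" where
  "sector_between a b = {of_real s * cis x | s x. 0 < s \<and> s < 1 \<and> a < x \<and> x < b}"

definition going_around ::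
  "(real^3) set \<Rightarrow> (real^3) set set \<Rightarrow> real^3 \<Rightarrow> (real^3) set list \<Rightarrow> (real^3) set list \<Rightarrow> bool" where
  "going_around V E v es fs \<longleftrightarrow>
     distinct es \<and> set es = {e \<in> E. v \<in> e} \<and>
     length fs = length es \<and> set fs \<subseteq> faces V E \<and>
     (\<exists>U h k \<theta>.
        openin (top_of_set S2) U \<and> v \<in> U \<and>
        homeomorphism U (ball (0::complex) 1) h k \<and> h v = 0 \<and>
        (\<forall>i<length es. \<theta> i < \<theta> (Suc i)) \<and> \<theta> (length es) = \<theta> 0 + 2 * pi \<and>
        (\<forall>i<length es. h ` (U \<inter> es ! i) = radius_at (\<theta> i) \<and>
                       sector_between (\<theta> i) (\<theta> (Suc i)) \<subseteq> h ` (U \<inter> fs ! i)))"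

definition degrees_around ::
  "(real^3) set \<Rightarrow> (real^3) set set \<Rightarrow> real^3 \<Rightarrow> nat list \<Rightarrow> bool" where
  "degrees_around V E v ps \<longleftrightarrow>
     (\<exists>es fs. going_around V E v es fs \<and> ps = map (face_degree E) fs)"

definition same_cyclic :: "'a list \<Rightarrow> 'a list \<Rightarrow> bool" where
  "same_cyclic ps qs \<longleftrightarrow> (\<exists>n. qs = rotate n ps \<or> qs = rotate n (rev ps))"

definition vertex_symbol :: "(real^3) set \<Rightarrow> (real^3) set set \<Rightarrow> nat list \<Rightarrow> bool" where
  "vertex_symbol V E ps \<longleftrightarrow> (\<forall>v\<in>V. \<exists>qs. degrees_around V E v qs \<and> same_cyclic ps qs)"

definition archimedean :: "(real^3) set \<Rightarrow> (real^3) set set \<Rightarrow> bool" where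
  "archimedean V E \<longleftrightarrow> polyhedral_map V E \<and> (\<exists>ps. vertex_symbol V E ps)"

definition thirteen_symbols :: "nat list set" where
  "thirteen_symbols =
    {[3,4,3,4],    \<comment> \<open>cuboctahedron\<close>
     [4,6,10],     \<comment> \<open>great rhombicosidodecahedron\<close>
     [4,6,8],      \<comment> \<open>great rhombicuboctahedron\<close>
     [3,5,3,5],    \<comment> \<open>icosidodecahedron\<close>
     [3,4,5,4],    \<comment> \<open>small rhombicosidodecahedron\<close>
     [3,4,4,4],    \<comment> \<open>small rhombicuboctahedron\<close>
     [3,3,3,3,4],  \<comment> \<open>snub cube\<close>
     [3,3,3,3,5],  \<comment> \<open>snub dodecahedron\<close>
     [3,8,8],      \<comment> \<open>truncated cube\<close>
     [3,10,10],    \<comment> \<open>truncated dodecahedron\<close>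
     [5,6,6],      \<comment> \<open>truncated icosahedron\<close>
     [4,6,6],      \<comment> \<open>truncated octahedron\<close>
     [3,6,6]}      \<comment> \<open>truncated tetrahedron\<close>"

definition prism_symbols :: "nat list set" where
  "prism_symbols = {[4,4,m] | m. m \<ge> 3 \<and> m \<noteq> 4}"

definition antiprism_symbols :: "nat list set" where
  "antiprism_symbols = {[3,3,3,m] | m. m \<ge> 4}"

end

theory Submission
  imports Defs
begin

text \<open>
  A vertex symbol is restricted by two facts about any map on the sphere whose vertices all look
  alike. Let \<open>r\<close> be the length of the symbol. Distributing each face equally over its
  corners, one finds that the number of faces is the number \<open>V\<close> of vertices times the
  sum of the inverse entries, and there are \<open>r V / 2\<close> edges. Euler's formula in the
  form \<open>E + 1 \<le> V + F\<close> then says that the sum of the inverse entries exceeds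
  \<open>r / 2 - 1\<close>. Secondly, if at every corner of a face exactly one of the two adjacent
  faces is of a certain kind, then the faces of this kind alternate along its boundary and its
  degree is even. Hence this does not occur for odd entries. These two conditions
  (\<open>symbol_admissible\<close>) leave \<open>r \<le> 5\<close> and, by a short case
  distinction, exactly the listed symbols and the regular ones (\<open>admissible_listed\<close>).

  The topological part is in two lemmas. By \<open>faces_at_edge\<close>, the faces at two
  consecutive corners of a vertex are the two faces at the edge between them, which makes all
  counting of corners and sides possible. By \<open>edge_splits_face\<close>, an edge that closes a
  circuit splits a face, by the Jordan curve theorem. Starting from a spanning tree, this gives the
  inequality \<open>euler_inequality\<close>.

  Conversely, each listed symbol belongs to the radial projection of a convex polytope around the
  origin. If \<open>m\<close> runs over the linear forms that are 1 on a facet, then the faces of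
  the projected map are the sets where one form is strictly the largest one. So they are projections
  of convex cones, and they are the components of the complement of the edges
  (\<open>faces_eq\<close>). Central projection to the tangent plane at a vertex makes the edges
  straight and gives the required chart (\<open>going_around_vertex\<close>). All global properties
  of the polytope follow from finitely many incidences and orientations at its vertices
  (\<open>corner_fan\<close>), by the optimality criterion of the simplex algorithm.

  Therefore a solid is given by a table of integers. The thirteen solids are realised with small
  integer coordinates and with the symmetry of the rotation group of the tetrahedron, so that one
  vertex of each orbit is enough (\<open>certificate_realises\<close>). Prisms and antiprisms are
  realised over regular polygons, where all incidences come from the fact that \<open>cos (d \<pi> /
  m)\<close> is at most \<open>cos (\<pi> / m)\<close> for odd \<open>d\<close>.
\<close>

section \<open>Polytopes around the origin\<close>

lemma cramer_expansion:
  fixes v x y z :: "real^3"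
  shows "(v \<bullet> cross3 x y) *\<^sub>R z
    = (z \<bullet> cross3 x y) *\<^sub>R v + (v \<bullet> cross3 z y) *\<^sub>R x + (v \<bullet> cross3 x z) *\<^sub>R y"
  by (simp add: cross3_simps forall_3)

lemma obtain_coordinates:
  fixes v x y z :: "real^3"
  assumes "v \<bullet> cross3 x y > 0"
  obtains a b c where "z = a *\<^sub>R v + b *\<^sub>R x + c *\<^sub>R y"
proof -
  define d where "d = v \<bullet> cross3 x y"
  have "z = (1 / d) *\<^sub>R (d *\<^sub>R z)" using assms by (simp add: d_def)
  also have "d *\<^sub>R z = (z \<bullet> cross3 x y) *\<^sub>R v + (v \<bullet> cross3 z y) *\<^sub>R x + (v \<bullet> cross3 x z) *\<^sub>R y"
    unfolding d_def by (rule cramer_expansion)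
  finally show ?thesis using that by (simp add: scaleR_add_right)
qed

text \<open>
  The facets at the vertex \<open>v\<close>, in the order in which one meets them going around it:
  \<open>ws ! i\<close> is the neighbour on the edge between the facets \<open>ms ! (i - 1)\<close>
  and \<open>ms ! i\<close>. The incidences say that only consecutive facets share an edge at
  \<open>v\<close>, and the sign of the determinants gives the direction of the walk and bounds each
  angle by \<open>\<pi>\<close>. That the walk goes around only once follows from the incidences.
\<close>

definition corner_fan ::
  "(real^3) set \<Rightarrow> (real^3) set \<Rightarrow> real^3 \<Rightarrow> (real^3) list \<Rightarrow> (real^3) list \<Rightarrow> bool" where
  "corner_fan P N v ws ms \<longleftrightarrow>
     3 \<le> length ws \<and> length ms = length ws \<and> set ws \<subseteq> P \<and> set ms = {m \<in> N. m \<bullet> v = 1} \<and>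
     (\<forall>i<length ws. \<forall>j<length ws. ms ! i \<bullet> ws ! j = 1 \<longleftrightarrow> j = i \<or> j = Suc i mod length ws) \<and>
     (\<forall>i<length ws. 0 < v \<bullet> cross3 (ws ! i) (ws ! (Suc i mod length ws)))"

definition cone2 :: "real^3 \<Rightarrow> real^3 \<Rightarrow> (real^3) set" where
  "cone2 v w = {a *\<^sub>R v + b *\<^sub>R w | a b. 0 \<le> a \<and> 0 \<le> b}"

definition great_arc :: "real^3 \<Rightarrow> real^3 \<Rightarrow> (real^3) set" where
  "great_arc v w = S2 \<inter> cone2 v w"

lemma cone2_commute: "cone2 v w = cone2 w v"
  unfolding cone2_def by (metis (no_types, opaque_lifting) add.commute)

lemma great_arc_commute: "great_arc v w = great_arc w v"
  unfolding great_arc_def by (simp add: cone2_commute)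

lemma pred_mod_exists:
  assumes "i < r" obtains p where "p < r" "Suc p mod r = i"
proof (cases i)
  case 0
  then show ?thesis using assms that[of "r - 1"] by simp
next
  case (Suc j)
  then show ?thesis using assms that[of j] by simp
qed

lemma Suc_mod_neq:
  assumes "3 \<le> r" "p < r"
  shows "Suc p mod r \<noteq> p" "Suc (Suc p mod r) mod r \<noteq> p" "Suc p mod r < r"
    "Suc (Suc p mod r) mod r \<noteq> Suc p mod r"
  using assms by (cases "Suc p = r"; cases "Suc (Suc p) = r"; force simp: mod_Suc)+

text \<open>
  A convex polytope with the origin in its interior, described by its vertices and by the linear
  forms that are equal to 1 on a facet and at most 1 on the polytope. Only finitely many incidences
  and signs at the single vertices are required. They already force the facets to close up, because
  a vertex at which no edge improves a linear form is optimal for that form, as in the simplex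
  algorithm.
\<close>

locale spherical_polytope =
  fixes P N :: "(real^3) set"
  assumes finite_P: "finite P" and finite_N: "finite N" and P_nonempty: "P \<noteq> {}"
    and le_one: "\<And>v m. v \<in> P \<Longrightarrow> m \<in> N \<Longrightarrow> m \<bullet> v \<le> 1"
    and facet_nonempty: "\<And>m. m \<in> N \<Longrightarrow> \<exists>v\<in>P. m \<bullet> v = 1"
    and fan_exists: "\<And>v. v \<in> P \<Longrightarrow> \<exists>ws ms. corner_fan P N v ws ms"
begin

text \<open>
  Edges are recovered from the facets: two vertices span an edge when they lie on two common facets.
\<close>

definition adj :: "real^3 \<Rightarrow> real^3 \<Rightarrow> bool" where
  "adj v w \<longleftrightarrow> v \<in> P \<and> w \<in> P \<and> v \<noteq> w \<and>
     (\<exists>f\<in>N. \<exists>g\<in>N. f \<noteq> g \<and> f \<bullet> v = 1 \<and> g \<bullet> v = 1 \<and> f \<bullet> w = 1 \<and> g \<bullet> w = 1)"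

lemma adj_sym: "adj v w \<Longrightarrow> adj w v"
  unfolding adj_def by blast

lemma lt_one: "v \<in> P \<Longrightarrow> m \<in> N \<Longrightarrow> m \<bullet> v \<noteq> 1 \<Longrightarrow> m \<bullet> v < 1"
  using le_one[of v m] by linarith

lemma fanD:
  assumes "corner_fan P N v ws ms"
  shows "3 \<le> length ws" "length ms = length ws" "set ws \<subseteq> P" "set ms = {m \<in> N. m \<bullet> v = 1}"
    "\<And>i j. i < length ws \<Longrightarrow> j < length ws \<Longrightarrow>
        ms ! i \<bullet> ws ! j = 1 \<longleftrightarrow> j = i \<or> j = Suc i mod length ws"
    "\<And>i. i < length ws \<Longrightarrow> 0 < v \<bullet> cross3 (ws ! i) (ws ! (Suc i mod length ws))"
    "\<And>i. i < length ws \<Longrightarrow> ms ! i \<in> N \<and> ms ! i \<bullet> v = 1 \<and> ws ! i \<in> P"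
proof -
  show "\<And>i. i < length ws \<Longrightarrow> ms ! i \<in> N \<and> ms ! i \<bullet> v = 1 \<and> ws ! i \<in> P"
    using assms nth_mem[of _ ms] nth_mem[of _ ws] unfolding corner_fan_def by auto
qed (use assms in \<open>auto simp: corner_fan_def\<close>)

lemma fan_distinct:
  assumes "corner_fan P N v ws ms"
  shows "distinct ms" "distinct ws"
proof -
  let ?r = "length ws"
  note F = fanD[OF assms]
  show "distinct ms" unfolding distinct_conv_nth
  proof (intro allI impI notI)
    fix i j assume ij: "i < length ms" "j < length ms" "i \<noteq> j" "ms ! i = ms ! j"
    have "i = Suc j mod ?r" using F(5)[of j i] F(5)[of i i] ij F(2) by auto
    moreover have "j = Suc i mod ?r" using F(5)[of i j] F(5)[of j j] ij F(2) by auto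
    ultimately show False using Suc_mod_neq(2)[of ?r j] F(1,2) ij by auto
  qed
  show "distinct ws" unfolding distinct_conv_nth
  proof (intro allI impI notI)
    fix i j assume ij: "i < ?r" "j < ?r" "i \<noteq> j" "ws ! i = ws ! j"
    have "i = Suc j mod ?r" using F(5)[of j i] F(5)[of j j] ij by auto
    moreover have "j = Suc i mod ?r" using F(5)[of i j] F(5)[of i i] ij by auto
    ultimately show False using Suc_mod_neq(2)[of ?r j] F(1) ij by auto
  qed
qed

text \<open>
  The facet \<open>f\<close> has a corner at \<open>v\<close> with sides towards \<open>w1\<close>
  and \<open>w2\<close>, and across these sides lie the facets \<open>g1\<close> and
  \<open>g2\<close>. This is the content of a fan at one index, free of index arithmetic.
\<close>

definition corner :: "real^3 \<Rightarrow> real^3 \<Rightarrow> real^3 \<Rightarrow> real^3 \<Rightarrow> real^3 \<Rightarrow> real^3 \<Rightarrow> bool" where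
  "corner v f w1 w2 g1 g2 \<longleftrightarrow>
    f \<in> N \<and> g1 \<in> N \<and> g2 \<in> N \<and> g1 \<noteq> f \<and> g2 \<noteq> f \<and> w1 \<in> P \<and> w2 \<in> P \<and>
    w1 \<noteq> v \<and> w2 \<noteq> v \<and> w1 \<noteq> w2 \<and>
    f \<bullet> v = 1 \<and> f \<bullet> w1 = 1 \<and> f \<bullet> w2 = 1 \<and>
    g1 \<bullet> v = 1 \<and> g1 \<bullet> w1 = 1 \<and> g1 \<bullet> w2 < 1 \<and>
    g2 \<bullet> v = 1 \<and> g2 \<bullet> w2 = 1 \<and> g2 \<bullet> w1 < 1 \<and>
    0 < v \<bullet> cross3 w1 w2 \<and>
    (\<forall>g\<in>N. g \<bullet> v = 1 \<longrightarrow> g \<bullet> w1 = 1 \<longrightarrow> g = f \<or> g = g1) \<and>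
    (\<forall>g\<in>N. g \<bullet> v = 1 \<longrightarrow> g \<bullet> w2 = 1 \<longrightarrow> g = f \<or> g = g2)"

lemma fan_corner:
  assumes fan: "corner_fan P N v ws ms" and i: "i < length ws"
  obtains g1 g2 where "corner v (ms ! i) (ws ! i) (ws ! (Suc i mod length ws)) g1 g2"
proof -
  define f w1 w2 where "f = ms ! i" and "w1 = ws ! i" and "w2 = ws ! (Suc i mod length ws)"
  let ?r = "length ws"
  note F = fanD[OF fan]
  obtain p where p: "p < ?r" "Suc p mod ?r = i" using pred_mod_exists[OF i] .
  define n where "n = Suc i mod ?r"
  have n: "n < ?r" using F(1) i unfolding n_def by (cases ?r) auto
  have ne: "n \<noteq> i" "n \<noteq> p" "Suc n mod ?r \<noteq> i" "p \<noteq> i"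
    using Suc_mod_neq[OF F(1) i] Suc_mod_neq[OF F(1) p(1)] p(2) unfolding n_def by auto
  have a: "ms ! p \<bullet> w1 = 1" "ms ! p \<bullet> w2 \<noteq> 1" "ms ! n \<bullet> w2 = 1" "ms ! n \<bullet> w1 \<noteq> 1"
    "f \<bullet> w1 = 1" "f \<bullet> w2 = 1"
    using F(5)[OF p(1) i] F(5)[OF p(1) n] F(5)[OF n n] F(5)[OF n i] F(5)[OF i i] F(5)[OF i n] p ne
    unfolding w1_def w2_def f_def n_def[symmetric] by auto
  note mem = F(7)[OF i] F(7)[OF n] F(7)[OF p(1)]
  have ex: "\<exists>k<?r. ms ! k = g" if "g \<in> N" "g \<bullet> v = 1" for g
  proof -
    have "g \<in> set ms" using F(4) that by simp
    then show ?thesis using F(2) by (auto simp: in_set_conv_nth)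
  qed
  have u1: "g = f \<or> g = ms ! p" if g: "g \<in> N" "g \<bullet> v = 1" "g \<bullet> w1 = 1" for g
  proof -
    obtain k where k: "k < ?r" "ms ! k = g" using ex g by blast
    have "i = k \<or> i = Suc k mod ?r" using F(5)[OF k(1) i] g k unfolding w1_def by simp
    then show ?thesis
    proof
      assume "i = Suc k mod ?r"
      then have "k = p" using p k(1) by (auto simp: mod_Suc split: if_splits)
      then show ?thesis using k by simp
    qed (use k f_def in simp)
  qed
  have u2: "g = f \<or> g = ms ! n" if g: "g \<in> N" "g \<bullet> v = 1" "g \<bullet> w2 = 1" for g
  proof -
    obtain k where k: "k < ?r" "ms ! k = g" using ex g by blast
    have "n = k \<or> n = Suc k mod ?r" using F(5)[OF k(1) n] g k unfolding w2_def n_def by simp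
    then show ?thesis
    proof
      assume "n = Suc k mod ?r"
      then have "k = i" using i n_def k(1) by (auto simp: mod_Suc split: if_splits)
      then show ?thesis using k f_def by simp
    qed (use k n_def in simp)
  qed
  have dw: "0 < v \<bullet> cross3 w1 w2" using F(6)[OF i] unfolding w1_def w2_def .
  have "w1 \<noteq> v" "w2 \<noteq> v" using mem a F(1) by auto
  moreover have "w1 \<noteq> w2" using dw by auto
  moreover have "ms ! p \<noteq> f" "ms ! n \<noteq> f" using a by auto
  moreover have "ms ! p \<bullet> w2 < 1" "ms ! n \<bullet> w1 < 1"
    using a mem lt_one unfolding w1_def w2_def n_def[symmetric] by auto
  ultimately show ?thesis
    using that[of "ms ! p" "ms ! n"] a mem dw u1 u2
    unfolding corner_def f_def[symmetric] w1_def[symmetric] w2_def[symmetric] n_def[symmetric]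
    by (auto simp: f_def w1_def w2_def n_def)
qed

lemma facet_in_fan:
  assumes "corner_fan P N v ws ms" "f \<in> N" "f \<bullet> v = 1"
  obtains i where "i < length ws" "ms ! i = f"
proof -
  have "f \<in> set ms" using fanD(4)[OF assms(1)] assms by simp
  then show ?thesis using that fanD(2)[OF assms(1)] by (auto simp: in_set_conv_nth)
qed

text \<open>
  In the basis \<open>v\<close>, \<open>w1\<close>, \<open>w2\<close> of a corner, the forms of the
  two adjacent facets see only one coordinate each besides the total, so that their inequalities are
  signs of the coordinates.
\<close>

lemma facet_coordinates:
  assumes fan: "corner_fan P N v ws ms" and i: "i < length ws"
    and y: "ms ! i \<bullet> y = 1" "\<And>m. m \<in> N \<Longrightarrow> m \<bullet> y \<le> 1"
  obtains a b c where "y = a *\<^sub>R v + b *\<^sub>R (ws ! i) + c *\<^sub>R (ws ! (Suc i mod length ws))"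
    "a + b + c = 1" "0 \<le> b" "0 \<le> c"
proof -
  obtain g1 g2 where "corner v (ms ! i) (ws ! i) (ws ! (Suc i mod length ws)) g1 g2"
    using fan_corner[OF fan i] .
  note g = this[unfolded corner_def]
  obtain a b c where abc: "y = a *\<^sub>R v + b *\<^sub>R (ws ! i) + c *\<^sub>R (ws ! (Suc i mod length ws))"
    using obtain_coordinates[of v "ws ! i" "ws ! (Suc i mod length ws)" y] g by blast
  have s: "a + b + c = 1" using y(1) g abc by (simp add: inner_add_right)
  have "a + b + c * (g1 \<bullet> ws ! (Suc i mod length ws)) \<le> a + b + c"
    using y(2)[of g1] g s abc by (simp add: inner_add_right)
  then have "0 \<le> c * (1 - g1 \<bullet> ws ! (Suc i mod length ws))" by (simp add: algebra_simps)
  then have "0 \<le> c" using g by (simp add: zero_le_mult_iff)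
  have "a + b * (g2 \<bullet> ws ! i) + c \<le> a + b + c"
    using y(2)[of g2] g s abc by (simp add: inner_add_right)
  then have "0 \<le> b * (1 - g2 \<bullet> ws ! i)" by (simp add: algebra_simps)
  then have "0 \<le> b" using g by (simp add: zero_le_mult_iff)
  show ?thesis using that abc s \<open>0 \<le> b\<close> \<open>0 \<le> c\<close> .
qed

text \<open>
  Three consecutive facets at a vertex are linearly independent, so a point on all facets of
  \<open>u\<close> is \<open>u\<close>.
\<close>

lemma extreme:
  assumes "u \<in> P" "\<And>m. m \<in> N \<Longrightarrow> m \<bullet> u = 1 \<Longrightarrow> m \<bullet> y = 1"
  shows "y = u"
proof -
  obtain ws ms where fan: "corner_fan P N u ws ms" using fan_exists assms by blast
  have i: "0 < length ws" using fanD(1)[OF fan] by linarith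
  obtain g1 g2 where "corner u (ms ! 0) (ws ! 0) (ws ! (Suc 0 mod length ws)) g1 g2"
    using fan_corner[OF fan i] .
  note g = this[unfolded corner_def]
  obtain a b c where abc: "y = a *\<^sub>R u + b *\<^sub>R (ws ! 0) + c *\<^sub>R (ws ! (Suc 0 mod length ws))"
    using obtain_coordinates[of u "ws ! 0" "ws ! (Suc 0 mod length ws)" y] g by blast
  have y: "ms ! 0 \<bullet> y = 1" "g1 \<bullet> y = 1" "g2 \<bullet> y = 1" using assms(2) g by blast+
  have s: "a + b + c = 1" using y(1) g abc by (simp add: inner_add_right)
  have "a + b + c * (g1 \<bullet> ws ! (Suc 0 mod length ws)) = a + b + c"
    using y(2) g s abc by (simp add: inner_add_right)
  then have "c = 0" using g by simp
  have "a + b * (g2 \<bullet> ws ! 0) + c = a + b + c"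
    using y(3) g s abc by (simp add: inner_add_right)
  then have "b = 0" using g by simp
  show ?thesis using abc s \<open>b = 0\<close> \<open>c = 0\<close> by simp
qed

lemma convex_tight:
  assumes "v \<in> P" "w \<in> P" "m \<in> N" "m \<bullet> ((1 - t) *\<^sub>R v + t *\<^sub>R w) = 1" "0 < t" "t < 1"
  shows "m \<bullet> v = 1" "m \<bullet> w = 1"
proof -
  have 1: "(1 - t) * (1 - m \<bullet> v) + t * (1 - m \<bullet> w) = 0"
    using assms(4) by (simp add: inner_add_right algebra_simps)
  have 2: "0 \<le> (1 - t) * (1 - m \<bullet> v)" "0 \<le> t * (1 - m \<bullet> w)"
    using le_one[OF assms(1,3)] le_one[OF assms(2,3)] assms by simp_all
  then have "(1 - t) * (1 - m \<bullet> v) = 0" "t * (1 - m \<bullet> w) = 0" using 1 by linarith+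
  then show "m \<bullet> v = 1" "m \<bullet> w = 1" using assms by simp_all
qed

text \<open>
  A facet through an interior point of a segment contains both ends, since its form is at most 1
  there; hence vertices are extreme points.
\<close>

lemma not_between:
  assumes "u \<in> P" "v \<in> P" "w \<in> P" "u = (1 - t) *\<^sub>R v + t *\<^sub>R w" "0 < t" "t < 1"
  shows "v = u" "w = u"
  using extreme[OF assms(1)] convex_tight[OF assms(2,3) _ _ assms(5,6)] assms(4) by blast+

text \<open>
  A point of the facet \<open>ms ! i\<close> that also lies on \<open>g\<close> is a combination of
  \<open>v\<close> and its two neighbours on \<open>ms ! i\<close>. As \<open>g\<close> is at most 1
  at each of them, the weights sit only on neighbours where \<open>g\<close> is equal to 1, and
  there is at most one such neighbour. A facet at this neighbour that avoids \<open>v\<close> shows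
  that the point does not lie beyond it.
\<close>

lemma fan_edge_point:
  assumes vP: "v \<in> P" and fan: "corner_fan P N v ws ms" and i: "i < length ws" and g: "g \<in> N" "g \<noteq> ms ! i"
    and gv: "g \<bullet> v = 1"
    and y: "ms ! i \<bullet> y = 1" "g \<bullet> y = 1" "\<And>m. m \<in> N \<Longrightarrow> m \<bullet> y \<le> 1" and yv: "y \<noteq> v"
  obtains j t where "j < length ws" "ms ! i \<bullet> ws ! j = 1" "g \<bullet> ws ! j = 1" "0 < t" "t \<le> 1"
     "y = (1 - t) *\<^sub>R v + t *\<^sub>R ws ! j" 
     "\<And>m. m \<in> N \<Longrightarrow> m \<bullet> v = 1 \<Longrightarrow> m \<bullet> ws ! j = 1 \<Longrightarrow> m = ms ! i \<or> m = g"
     "j = (if g \<bullet> ws ! i = 1 then i else Suc i mod length ws)"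
proof -
  let ?n = "Suc i mod length ws"
  have n: "?n < length ws" using i by (cases "length ws") auto
  obtain g1 g2 where "corner v (ms ! i) (ws ! i) (ws ! ?n) g1 g2"
    using fan_corner[OF fan i] .
  note c = this[unfolded corner_def]
  obtain a b d where abc: "y = a *\<^sub>R v + b *\<^sub>R (ws ! i) + d *\<^sub>R (ws ! ?n)"
    "a + b + d = 1" "0 \<le> b" "0 \<le> d" using facet_coordinates[OF fan i y(1,3)] by blast
  have le: "g \<bullet> ws ! i \<le> 1" "g \<bullet> ws ! ?n \<le> 1" using le_one c g by blast+
  have z: "b * (1 - g \<bullet> ws ! i) + d * (1 - g \<bullet> ws ! ?n) = 0"
  proof -
    have "a + b * (g \<bullet> ws ! i) + d * (g \<bullet> ws ! ?n) = 1"
      using y(2) gv abc(1) by (simp add: inner_add_right)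
    then show ?thesis using abc(2) by (simp add: algebra_simps)
  qed
  have "0 \<le> b * (1 - g \<bullet> ws ! i)" "0 \<le> d * (1 - g \<bullet> ws ! ?n)" using abc le by simp_all
  then have z: "b * (1 - g \<bullet> ws ! i) = 0" "d * (1 - g \<bullet> ws ! ?n) = 0" using z by linarith+
  have le1: "t \<le> 1" if w: "w \<in> P" "w \<noteq> v" "y = (1 - t) *\<^sub>R v + t *\<^sub>R w" for w t
  proof -
    obtain h where h: "h \<in> N" "h \<bullet> w = 1" "h \<bullet> v \<noteq> 1" using extreme[of w v] w(1,2) by blast
    have "h \<bullet> v < 1" using lt_one[OF vP] h by blast
    moreover have "(1 - t) * (h \<bullet> v) + t \<le> 1" using y(3)[OF h(1)] h w(3) by (simp add: inner_add_right)
    then have "(1 - t) * (1 - h \<bullet> v) \<ge> 0" by (simp add: algebra_simps)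
    ultimately show ?thesis by (simp add: zero_le_mult_iff)
  qed
  show ?thesis
  proof (cases "g \<bullet> ws ! i = 1")
    case True
    then have "g = g1" using c g gv by blast
    then have "d = 0" using z(2) c by simp
    have "a = 1 - b" using abc(2) \<open>d = 0\<close> by simp
    then have e: "y = (1 - b) *\<^sub>R v + b *\<^sub>R ws ! i" using abc(1) \<open>d = 0\<close> by simp
    then have "b \<noteq> 0" using yv by auto
    then show ?thesis using that[of i b] i True c e abc(3) le1[OF _ _ e] \<open>g = g1\<close> by auto
  next
    case False
    then have "b = 0" using z(1) by simp
    have "a = 1 - d" using abc(2) \<open>b = 0\<close> by simp
    then have e: "y = (1 - d) *\<^sub>R v + d *\<^sub>R ws ! ?n" using abc(1) \<open>b = 0\<close> by simp
    then have "d \<noteq> 0" using yv by auto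
    then have g2: "g \<bullet> ws ! ?n = 1" using z(2) by simp
    then have "g = g2" using c g gv by blast
    then show ?thesis using that[of ?n d] n False g2 c e abc(4) \<open>d \<noteq> 0\<close> le1[OF _ _ e] by auto
  qed
qed

lemma N_nonempty: "N \<noteq> {}"
proof -
  obtain v where "v \<in> P" using P_nonempty by blast
  then obtain ws ms where "corner_fan P N v ws ms" using fan_exists by blast
  from fanD(1,7)[OF this] show ?thesis by force
qed

lemma corner_exists:
  assumes "v \<in> P" "f \<in> N" "f \<bullet> v = 1"
  obtains w1 w2 g1 g2 where "corner v f w1 w2 g1 g2"
proof -
  obtain ws ms where fan: "corner_fan P N v ws ms" using fan_exists assms by blast
  obtain i where i: "i < length ws" "ms ! i = f" using facet_in_fan[OF fan assms(2,3)] .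
  show ?thesis using fan_corner[OF fan i(1)] i(2) that by metis
qed

lemma facet_max_exists:
  assumes "f \<in> N"
  shows "\<exists>v\<in>P. f \<bullet> v = 1 \<and> (\<forall>u\<in>P. f \<bullet> u = 1 \<longrightarrow> c \<bullet> u \<le> c \<bullet> v)"
proof -
  let ?A = "{u \<in> P. f \<bullet> u = 1}"
  have "finite ?A" "?A \<noteq> {}" using finite_P facet_nonempty[OF assms] by auto
  then obtain v where "v \<in> ?A" "\<forall>u\<in>?A. c \<bullet> u \<le> c \<bullet> v"
    using Max_in[of "(\<bullet>) c ` ?A"] Max_ge[of "(\<bullet>) c ` ?A"] by fastforce
  then show ?thesis by blast
qed

text \<open>
  The optimality criterion of the simplex algorithm inside one facet: each point of the facet is
  \<open>v\<close> plus a nonnegative combination of the two sides at \<open>v\<close>.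
\<close>

lemma facet_maximum:
  assumes f: "f \<in> N" and y: "f \<bullet> y = 1" "\<And>m. m \<in> N \<Longrightarrow> m \<bullet> y \<le> 1"
    and v: "v \<in> P" "f \<bullet> v = 1" "\<forall>u\<in>P. f \<bullet> u = 1 \<longrightarrow> c \<bullet> u \<le> c \<bullet> v"
  shows "c \<bullet> y \<le> c \<bullet> v"
proof -
  obtain ws ms where fan: "corner_fan P N v ws ms" using fan_exists v by blast
  obtain i where i: "i < length ws" "ms ! i = f" using facet_in_fan[OF fan f v(2)] .
  let ?x = "ws ! i" and ?z = "ws ! (Suc i mod length ws)"
  obtain g1 g2 where "corner v f ?x ?z g1 g2"
    using fan_corner[OF fan i(1)] i by metis
  then have "c \<bullet> ?x \<le> c \<bullet> v" "c \<bullet> ?z \<le> c \<bullet> v" using v(3) unfolding corner_def by auto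
  obtain a b d where abd: "y = a *\<^sub>R v + b *\<^sub>R ?x + d *\<^sub>R ?z" "a + b + d = 1" "0 \<le> b" "0 \<le> d"
    using facet_coordinates[OF fan i(1)] y i by blast
  have "c \<bullet> y = a * (c \<bullet> v) + b * (c \<bullet> ?x) + d * (c \<bullet> ?z)"
    using abd by (simp add: inner_add_right)
  also have "\<dots> \<le> a * (c \<bullet> v) + b * (c \<bullet> v) + d * (c \<bullet> v)"
    by (intro add_mono mult_left_mono order_refl) fact+
  also have "\<dots> = c \<bullet> v" using abd(2) by (metis distrib_right mult_1)
  finally show ?thesis .
qed

text \<open>
  Two facets that meet in a point share an edge through it. Start at a vertex of \<open>f\<close>
  where \<open>g\<close> is maximal on \<open>f\<close>: by the optimality criterion
  \<open>g\<close> is equal to 1 there, so this vertex lies on both facets and one of its edges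
  leads to the point.
\<close>

lemma edge_point:
  assumes fg: "f \<in> N" "g \<in> N" "f \<noteq> g" 
    and y: "f \<bullet> y = 1" "g \<bullet> y = 1" "\<And>m. m \<in> N \<Longrightarrow> m \<bullet> y \<le> 1"
  obtains v w t where "adj v w" "0 \<le> t" "t \<le> 1" "y = (1 - t) *\<^sub>R v + t *\<^sub>R w"
proof -
  obtain v where v: "v \<in> P" "f \<bullet> v = 1" "\<forall>u\<in>P. f \<bullet> u = 1 \<longrightarrow> g \<bullet> u \<le> g \<bullet> v"
    using facet_max_exists[OF fg(1), of g] by blast
  have "1 \<le> g \<bullet> v" using facet_maximum[OF fg(1) y(1,3) v] y(2) by simp
  then have gv: "g \<bullet> v = 1" using le_one[OF v(1) fg(2)] by simp
  obtain ws ms where fan: "corner_fan P N v ws ms" using fan_exists v by blast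
  obtain i where i: "i < length ws" "ms ! i = f" using facet_in_fan[OF fan fg(1) v(2)] .
  show ?thesis
  proof (cases "y = v")
    case True
    obtain w1 w2 g1 g2 where "corner v f w1 w2 g1 g2" using corner_exists[OF v(1) fg(1) v(2)] .
    then have "adj v w1" using v unfolding adj_def corner_def by metis
    then show ?thesis using that[of v w1 0] True by simp
  next
    case False
    obtain j t where j: "j < length ws" "ms ! i \<bullet> ws ! j = 1" "g \<bullet> ws ! j = 1" "0 < t" "t \<le> 1"
      "y = (1 - t) *\<^sub>R v + t *\<^sub>R ws ! j"
      using fan_edge_point[OF v(1) fan i(1) fg(2) _ gv _ y(2,3) False] i(2) fg(3) y(1) by blast
    have "ws ! j \<noteq> v" using False j by auto
    then have "adj v (ws ! j)" using fanD(7)[OF fan j(1)] v j i gv fg unfolding adj_def by metis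
    then show ?thesis using that[of v "ws ! j" t] j by simp
  qed
qed

lemma common_neighbour:
  assumes vw: "v \<in> P" "w \<in> P" "v \<noteq> w" and fg: "f \<in> N" "g \<in> N" "f \<noteq> g"
    and on: "f \<bullet> v = 1" "g \<bullet> v = 1" "f \<bullet> w = 1" "g \<bullet> w = 1"
    and fan: "corner_fan P N v ws ms" and i: "i < length ws" "ms ! i = f"
  shows "w = (if g \<bullet> ws ! i = 1 then ws ! i else ws ! (Suc i mod length ws))"
    "w \<in> set ws" "{m \<in> N. m \<bullet> v = 1 \<and> m \<bullet> w = 1} = {f, g}"
proof -
  obtain j t where j: "j < length ws" "ms ! i \<bullet> ws ! j = 1" "g \<bullet> ws ! j = 1" "0 < t" "t \<le> 1"
    "w = (1 - t) *\<^sub>R v + t *\<^sub>R ws ! j"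
    "\<And>m. m \<in> N \<Longrightarrow> m \<bullet> v = 1 \<Longrightarrow> m \<bullet> ws ! j = 1 \<Longrightarrow> m = ms ! i \<or> m = g"
    "j = (if g \<bullet> ws ! i = 1 then i else Suc i mod length ws)"
    using fan_edge_point[OF vw(1) fan i(1) fg(2) _ on(2) _ on(4), of thesis] i(2) fg(3) on(3) vw le_one[OF vw(2)]
    by blast
  have "ws ! j \<in> P" using fanD(7)[OF fan j(1)] by simp
  then have "t = 1" using not_between(1)[OF vw(2,1) _ j(6,4)] j(5) vw(3) by fastforce
  then have w: "w = ws ! j" using j(6) by simp
  show "w = (if g \<bullet> ws ! i = 1 then ws ! i else ws ! (Suc i mod length ws))"
    using w j(8) by simp
  show "w \<in> set ws" using w j(1) by simp
  show "{m \<in> N. m \<bullet> v = 1 \<and> m \<bullet> w = 1} = {f, g}"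
    using j(7) fg on w i(2) by auto
qed

lemma edge_line_unique:
  assumes "v \<in> P" "w \<in> P" "u \<in> P" "f \<in> N" "g \<in> N" "f \<noteq> g"
    "f \<bullet> v = 1" "g \<bullet> v = 1" "f \<bullet> w = 1" "g \<bullet> w = 1" "f \<bullet> u = 1" "g \<bullet> u = 1" "v \<noteq> w" "v \<noteq> u"
  shows "u = w"
proof -
  obtain ws ms where fan: "corner_fan P N v ws ms" using fan_exists assms by blast
  obtain i where i: "i < length ws" "ms ! i = f" using facet_in_fan[OF fan assms(4,7)] .
  show ?thesis
    using common_neighbour(1)[OF assms(1,2,13,4,5,6,7-10) fan i] 
      common_neighbour(1)[OF assms(1,3,14,4,5,6,7,8,11,12) fan i] by simp
qed

lemma adj_facets:
  assumes "adj v w" "f \<in> N" "g \<in> N" "f \<noteq> g" "f \<bullet> v = 1" "g \<bullet> v = 1" "f \<bullet> w = 1" "g \<bullet> w = 1"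
  shows "{m \<in> N. m \<bullet> v = 1 \<and> m \<bullet> w = 1} = {f, g}"
proof -
  have vw: "v \<in> P" "w \<in> P" "v \<noteq> w" using assms(1) unfolding adj_def by auto
  obtain ws ms where fan: "corner_fan P N v ws ms" using fan_exists vw by blast
  obtain i where i: "i < length ws" "ms ! i = f" using facet_in_fan[OF fan assms(2,5)] .
  show ?thesis using common_neighbour(3)[OF vw assms(2-8) fan i] .
qed

lemma adj_card_facets:
  assumes "adj v w" shows "card {m \<in> N. m \<bullet> v = 1 \<and> m \<bullet> w = 1} = 2"
proof -
  obtain f g where "f \<in> N" "g \<in> N" "f \<noteq> g" "f \<bullet> v = 1" "g \<bullet> v = 1" "f \<bullet> w = 1" "g \<bullet> w = 1"
    using assms unfolding adj_def by blast
  from adj_facets[OF assms this] this(3) show ?thesis by simp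
qed

lemma neighbours_in_fan:
  assumes "v \<in> P" "corner_fan P N v ws ms"
  shows "set ws = {w. adj v w}"
proof (intro set_eqI iffI)
  fix w assume "w \<in> {w. adj v w}"
  then obtain f g where fg: "f \<in> N" "g \<in> N" "f \<noteq> g" "f \<bullet> v = 1" "g \<bullet> v = 1" "f \<bullet> w = 1" "g \<bullet> w = 1"
    and "w \<in> P" "v \<noteq> w" unfolding adj_def by blast
  obtain i where i: "i < length ws" "ms ! i = f" using facet_in_fan[OF assms(2) fg(1,4)] .
  show "w \<in> set ws"
    using common_neighbour(2)[OF assms(1) \<open>w \<in> P\<close> \<open>v \<noteq> w\<close> fg assms(2) i] .
next
  fix w assume "w \<in> set ws"
  then obtain i where i: "i < length ws" "ws ! i = w" by (auto simp: in_set_conv_nth)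
  obtain g1 g2 where "corner v (ms ! i) w (ws ! (Suc i mod length ws)) g1 g2"
    using fan_corner[OF assms(2) i(1)] i(2) by metis
  then show "w \<in> {w. adj v w}" using assms(1) unfolding corner_def adj_def by auto
qed

lemma facet_neighbours:
  assumes "v \<in> P" "f \<in> N" "f \<bullet> v = 1"
  shows "card {w. adj v w \<and> f \<bullet> w = 1} = 2"
proof -
  obtain ws ms where fan: "corner_fan P N v ws ms" using fan_exists assms by blast
  obtain i where i: "i < length ws" "ms ! i = f" using facet_in_fan[OF fan assms(2,3)] .
  let ?n = "Suc i mod length ws"
  have n: "?n < length ws" using i by (cases "length ws") auto
  obtain g1 g2 where c: "corner v f (ws ! i) (ws ! ?n) g1 g2"
    using fan_corner[OF fan i(1)] i(2) by metis
  have "{w. adj v w \<and> f \<bullet> w = 1} = {w \<in> set ws. f \<bullet> w = 1}"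
    using neighbours_in_fan[OF assms(1) fan] by auto
  also have "\<dots> = {ws ! i, ws ! ?n}"
    using fanD(5)[OF fan i(1)] i n by (auto simp: in_set_conv_nth)
  finally show ?thesis using c unfolding corner_def by simp
qed

text \<open>
  The origin is an interior point. Otherwise no form is positive on some direction \<open>x\<close>;
  then one can move from a vertex \<open>v\<close> of the facet \<open>f\<close> that is largest on
  \<open>x\<close> along \<open>x\<close> and project back to the plane of \<open>f\<close> without
  leaving \<open>f\<close>. But \<open>f\<close> is bounded, since every linear form is bounded on
  it by its values at the vertices. If \<open>f\<close> vanishes on \<open>x\<close>, this is a
  contradiction at once. If it is negative, the projected point runs away unless \<open>v\<close> is
  the multiple of \<open>- x\<close> at which \<open>f\<close> is 1; but \<open>f\<close> has more
  than one vertex.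
\<close>

lemma positive_facet:
  assumes "x \<noteq> 0" obtains m where "m \<in> N" "0 < m \<bullet> x"
proof (rule ccontr)
  assume no: "\<not> thesis"
  obtain f where f: "f \<in> N" "\<And>m. m \<in> N \<Longrightarrow> m \<bullet> x \<le> f \<bullet> x"
    using Max_in[of "(\<lambda>m. m \<bullet> x) ` N"] Max_ge[of "(\<lambda>m. m \<bullet> x) ` N"] finite_N N_nonempty
    by fastforce
  \<comment> \<open>The speed at which \<open>f\<close> decreases along \<open>x\<close>: the form stays positive at \<open>v + s x\<close> until \<open>s = 1 / \<mu>\<close>.\<close>
  define \<mu> where "\<mu> = - (f \<bullet> x)"
  have "0 \<le> \<mu>" using no that f(1) unfolding \<mu>_def by force
  have bound: "\<exists>B. \<forall>s\<ge>0. 0 < 1 - s * \<mu> \<longrightarrow> c \<bullet> v + s * (c \<bullet> x) \<le> (1 - s * \<mu>) * B"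
    if v: "v \<in> P" "f \<bullet> v = 1" for v c
  proof -
    obtain u where u: "u \<in> P" "f \<bullet> u = 1" "\<forall>u'\<in>P. f \<bullet> u' = 1 \<longrightarrow> c \<bullet> u' \<le> c \<bullet> u"
      using facet_max_exists[OF f(1), of c] by blast
    have "c \<bullet> v + s * (c \<bullet> x) \<le> (1 - s * \<mu>) * (c \<bullet> u)" if s: "0 \<le> s" "0 < 1 - s * \<mu>" for s
    proof -
      define y where "y = (1 / (1 - s * \<mu>)) *\<^sub>R (v + s *\<^sub>R x)"
      have m: "m \<bullet> y = (m \<bullet> v + s * (m \<bullet> x)) / (1 - s * \<mu>)" for m
        unfolding y_def by (simp add: inner_add_right)
      have "f \<bullet> y = 1" using s v m[of f] unfolding \<mu>_def by simp
      moreover have "m \<bullet> y \<le> 1" if "m \<in> N" for m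
      proof -
        have "m \<bullet> v + s * (m \<bullet> x) \<le> 1 + s * (f \<bullet> x)"
          using le_one[OF v(1) that] f(2)[OF that] s(1) by (intro add_mono mult_left_mono)
        then show ?thesis using s m[of m] unfolding \<mu>_def by simp
      qed
      ultimately have "c \<bullet> y \<le> c \<bullet> u" using facet_maximum[OF f(1) _ _ u] by blast
      then show ?thesis using s(2) m[of c] by (simp add: divide_le_eq mult.commute)
    qed
    then show ?thesis by blast
  qed
  obtain v where v: "v \<in> P" "f \<bullet> v = 1" using facet_nonempty[OF f(1)] by blast
  show False
  proof (cases "\<mu> = 0")
    case True
    then obtain B where B: "\<forall>s\<ge>0. x \<bullet> v + s * (x \<bullet> x) \<le> B" using bound[OF v, of x] by auto
    have p: "0 < x \<bullet> x" using assms by simp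
    define s where "s = (\<bar>B\<bar> + \<bar>x \<bullet> v\<bar> + 1) / (x \<bullet> x)"
    have "0 \<le> s" "s * (x \<bullet> x) = \<bar>B\<bar> + \<bar>x \<bullet> v\<bar> + 1" using p unfolding s_def by auto
    then show False using B[rule_format, of s] by linarith
  next
    case False
    then have mu: "0 < \<mu>" using \<open>0 \<le> \<mu>\<close> by simp
    have eq: "u = - (1 / \<mu>) *\<^sub>R x" if u: "u \<in> P" "f \<bullet> u = 1" for u
    proof -
      define c where "c = u + (1 / \<mu>) *\<^sub>R x"
      obtain B where B: "\<forall>s\<ge>0. 0 < 1 - s * \<mu> \<longrightarrow> c \<bullet> u + s * (c \<bullet> x) \<le> (1 - s * \<mu>) * B"
        using bound[OF u] by blast
      let ?F = "\<lambda>s. (1 - s * \<mu>) * B - (c \<bullet> u + s * (c \<bullet> x))"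
      have "(?F \<longlongrightarrow> ?F (1 / \<mu>)) (at_left (1 / \<mu>))" by (intro tendsto_intros)
      moreover have "eventually (\<lambda>s. 0 \<le> ?F s) (at_left (1 / \<mu>))"
      proof -
        have "eventually (\<lambda>s. s \<in> {0<..<1/\<mu>}) (at_left (1 / \<mu>))"
          using mu by (intro eventually_at_leftI[of 0]) auto
        then show ?thesis
          by eventually_elim (use B mu in \<open>auto simp: field_simps\<close>)
      qed
      ultimately have "0 \<le> ?F (1 / \<mu>)" by (rule tendsto_lowerbound) simp
      then have "c \<bullet> c \<le> 0" using mu unfolding c_def by (simp add: inner_add_right)
      then have "c = 0" by (metis inner_eq_zero_iff inner_ge_zero order_antisym)
      then show ?thesis unfolding c_def by (simp add: eq_neg_iff_add_eq_0)
    qed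
    obtain w1 w2 g1 g2 where "corner v f w1 w2 g1 g2" using corner_exists[OF v(1) f(1) v(2)] .
    then have "w1 \<in> P" "f \<bullet> w1 = 1" "w1 \<noteq> v" unfolding corner_def by auto
    then show False using eq[OF v] eq[of w1] by simp
  qed
qed

end

section \<open>The map on the sphere obtained by radial projection\<close>

lemma sgn_eq_level:
  fixes f p q :: "'a::real_inner"
  assumes "sgn p = sgn q" "f \<bullet> p = 1" "f \<bullet> q = 1"
  shows "p = q"
proof -
  have "p \<noteq> 0" "q \<noteq> 0" using assms by auto
  have "f \<bullet> sgn p = 1 / norm p" "f \<bullet> sgn q = 1 / norm q"
    using assms(2,3) by (simp_all add: sgn_div_norm divide_inverse)
  then have "norm p = norm q" using assms(1) by simp
  then show ?thesis using assms(1) \<open>p \<noteq> 0\<close> \<open>q \<noteq> 0\<close> by (simp add: sgn_div_norm)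
qed

lemma sgn_scale_pos: "0 < c \<Longrightarrow> sgn (c *\<^sub>R x) = sgn x" for x :: "'a::real_normed_vector"
  by (simp add: sgn_scaleR)

lemma sgn_unit: "norm x = 1 \<Longrightarrow> sgn x = x" for x :: "'a::real_normed_vector"
  by (simp add: sgn_div_norm)

lemma scale_sgn: "norm x *\<^sub>R sgn x = x" for x :: "'a::real_normed_vector"
  by (cases "x = 0") (simp_all add: sgn_div_norm)

lemma sgn_in_S2: "x \<noteq> 0 \<Longrightarrow> sgn x \<in> S2"
  by (simp add: norm_sgn)

lemma cone2_scale: 
  assumes "0 < c" shows "c *\<^sub>R x \<in> cone2 v w \<longleftrightarrow> x \<in> cone2 v w"
proof -
  have *: "c *\<^sub>R x \<in> cone2 v w" if c: "0 < c" "x \<in> cone2 v w" for c x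
  proof -
    obtain a b where "x = a *\<^sub>R v + b *\<^sub>R w" "0 \<le> a" "0 \<le> b" using c(2) unfolding cone2_def by blast
    then have "c *\<^sub>R x = (c * a) *\<^sub>R v + (c * b) *\<^sub>R w" "0 \<le> c * a" "0 \<le> c * b"
      using c(1) by (simp_all add: scaleR_add_right)
    then show ?thesis unfolding cone2_def by blast
  qed
  show ?thesis using *[of c x] *[of "1 / c" "c *\<^sub>R x"] assms by auto
qed

lemma sgn_cone2: "x \<noteq> 0 \<Longrightarrow> sgn x \<in> cone2 v w \<longleftrightarrow> x \<in> cone2 v w"
  using cone2_scale[of "norm x" "sgn x" v w] by (simp add: scale_sgn)

lemma connected_subset_clopen:
  assumes "connected K" "K \<subseteq> W" "openin (top_of_set W) T" "closedin (top_of_set W) T" "K \<inter> T \<noteq> {}"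
  shows "K \<subseteq> T"
proof -
  obtain U where "open U" "T = W \<inter> U" using assms(3) by (metis openin_open)
  moreover obtain C where "closed C" "T = W \<inter> C" using assms(4) by (metis closedin_closed)
  ultimately have "openin (top_of_set K) (K \<inter> T)" "closedin (top_of_set K) (K \<inter> T)"
    using assms(2) by (auto simp: openin_open closedin_closed)
  then show ?thesis using assms(1,5) unfolding connected_clopen by blast
qed

lemma clopen_connected_is_component:
  assumes "connected T" "T \<noteq> {}" "openin (top_of_set W) T" "closedin (top_of_set W) T"
  shows "T \<in> components W"
  unfolding in_components_maximal
proof (intro conjI allI impI)
  show "T \<subseteq> W" using assms(3) openin_imp_subset by blast
  fix D assume "D \<noteq> {} \<and> T \<subseteq> D \<and> D \<subseteq> W \<and> connected D"
  then show "D = T" using connected_subset_clopen[OF _ _ assms(3,4), of D] assms(2) by blast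
qed (use assms in auto)

context spherical_polytope begin

text \<open>
  The open cone over the interior of a facet: there its form is the strictly largest one. This
  inequality describes the faces of the map on the sphere without reference to their boundaries.
\<close>

definition cell :: "real^3 \<Rightarrow> (real^3) set" where
  "cell f = {x. \<forall>g\<in>N. g \<noteq> f \<longrightarrow> g \<bullet> x < f \<bullet> x}"

definition region :: "real^3 \<Rightarrow> (real^3) set" where
  "region f = S2 \<inter> cell f"

definition vset :: "(real^3) set" where "vset = sgn ` P"

definition eset :: "(real^3) set set" where "eset = {great_arc v w | v w. adj v w}"

lemma P_facet:
  assumes "v \<in> P" obtains f where "f \<in> N" "f \<bullet> v = 1"
proof -
  obtain ws ms where "corner_fan P N v ws ms" using fan_exists assms by blast
  from fanD(1,7)[OF this] show ?thesis using that[of "ms ! 0"] by force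
qed

lemma P_nonzero: "v \<in> P \<Longrightarrow> v \<noteq> 0"
  using P_facet by (metis inner_zero_right zero_neq_one)

lemma cone2_facet_max:
  assumes "adj v w" "f \<in> N" "f \<bullet> v = 1" "f \<bullet> w = 1" "x \<in> cone2 v w" "m \<in> N"
  shows "m \<bullet> x \<le> f \<bullet> x"
proof -
  obtain a b where x: "x = a *\<^sub>R v + b *\<^sub>R w" "0 \<le> a" "0 \<le> b" using assms(5) unfolding cone2_def by auto
  have "m \<bullet> v \<le> 1" "m \<bullet> w \<le> 1" using assms le_one unfolding adj_def by auto
  then have "a * (m \<bullet> v) + b * (m \<bullet> w) \<le> a * 1 + b * 1" using x by (intro add_mono mult_left_mono)
  then show ?thesis using x assms by (simp add: inner_add_right)
qed

lemma vertex_in_cone2: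
  assumes "adj v w" "u \<in> P" "u \<in> cone2 v w" shows "u = v \<or> u = w"
proof -
  obtain f where f: "f \<in> N" "f \<bullet> v = 1" "f \<bullet> w = 1" using assms(1) unfolding adj_def by blast
  have vw: "v \<in> P" "w \<in> P" using assms(1) unfolding adj_def by blast+
  obtain a b where u: "u = a *\<^sub>R v + b *\<^sub>R w" "0 \<le> a" "0 \<le> b" using assms(3) unfolding cone2_def by auto
  obtain m where m: "m \<in> N" "m \<bullet> u = 1" using P_facet[OF assms(2)] .
  have "f \<bullet> u = 1" using cone2_facet_max[OF assms(1) f assms(3) m(1)] m(2) le_one[OF assms(2) f(1)] by simp
  then have "a = 1 - b" using u f by (simp add: inner_add_right)
  then have *: "u = (1 - b) *\<^sub>R v + b *\<^sub>R w" "b \<le> 1" using u by auto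
  show ?thesis
  proof (cases "b = 0 \<or> b = 1")
    case True then show ?thesis using * by auto
  next
    case False then show ?thesis using not_between(1)[OF assms(2) vw *(1)] * u(3) by auto
  qed
qed

lemma great_arc_vertices:
  assumes "adj v w" "u \<in> P" shows "sgn u \<in> great_arc v w \<longleftrightarrow> u = v \<or> u = w"
proof
  assume "sgn u \<in> great_arc v w"
  then show "u = v \<or> u = w"
    using vertex_in_cone2[OF assms] sgn_cone2[OF P_nonzero[OF assms(2)]] unfolding great_arc_def by auto
next
  have "v \<in> cone2 v w" "w \<in> cone2 v w" unfolding cone2_def
    by (rule CollectI, rule exI[of _ 1], rule exI[of _ 0], simp)
       (rule CollectI, rule exI[of _ 0], rule exI[of _ 1], simp)
  moreover assume "u = v \<or> u = w"
  ultimately show "sgn u \<in> great_arc v w"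
    using sgn_cone2[OF P_nonzero[OF assms(2)]] sgn_in_S2[OF P_nonzero[OF assms(2)]]
    unfolding great_arc_def by auto
qed

lemma great_arc_is_arc:
  assumes "adj v w"
  obtains g where "arc g" "path_image g = great_arc v w" "pathstart g = sgn v" "pathfinish g = sgn w"
proof -
  obtain f where f: "f \<in> N" "f \<bullet> v = 1" "f \<bullet> w = 1" and vw: "v \<noteq> w"
    using assms unfolding adj_def by blast
  define q where "q t = (1 - t) *\<^sub>R v + t *\<^sub>R w" for t :: real
  have fq: "f \<bullet> q t = 1" for t unfolding q_def using f by (simp add: inner_add_right)
  then have q0: "q t \<noteq> 0" for t by (metis inner_zero_right zero_neq_one)
  define g where "g t = sgn (q t)" for t
  have "continuous_on {0..1} g"
  proof -
    have "continuous_on {0..1} (\<lambda>t. q t /\<^sub>R norm (q t))"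
      unfolding q_def by (intro continuous_intros) (use q0 q_def in auto)
    then show ?thesis unfolding g_def sgn_div_norm .
  qed
  moreover have "inj_on g {0..1}"
  proof (rule inj_onI)
    fix s t assume "g s = g t"
    then have "q s = q t" using sgn_eq_level fq unfolding g_def by blast
    then have "(s - t) *\<^sub>R (w - v) = 0" unfolding q_def by (simp add: algebra_simps)
    then show "s = t" using vw by simp
  qed
  ultimately have "arc g" unfolding arc_def path_def by simp
  moreover have "path_image g = great_arc v w"
  proof (intro set_eqI iffI)
    fix x assume "x \<in> path_image g"
    then obtain t where t: "0 \<le> t" "t \<le> 1" "x = sgn (q t)" unfolding path_image_def g_def by auto
    have "q t \<in> cone2 v w" unfolding q_def cone2_def using t by force
    then show "x \<in> great_arc v w" using t q0 sgn_cone2 sgn_in_S2 unfolding great_arc_def by simp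
  next
    fix x assume "x \<in> great_arc v w"
    then obtain a b where x: "x = a *\<^sub>R v + b *\<^sub>R w" "0 \<le> a" "0 \<le> b" "norm x = 1"
      unfolding great_arc_def cone2_def by auto
    have "a + b \<noteq> 0"
    proof
      assume "a + b = 0"
      then have "a = 0" "b = 0" using x(2,3) by linarith+
      then show False using x by simp
    qed
    then have s: "0 < a + b" using x by simp
    define t where "t = b / (a + b)"
    have "1 - t = a / (a + b)" unfolding t_def using s by (simp add: field_simps)
    then have "(a + b) *\<^sub>R q t = x" unfolding q_def x(1) using s
      by (simp add: scaleR_add_right t_def)
    then have "g t = x" using sgn_scale_pos[OF s, of "q t"] x(4) unfolding g_def by (simp add: sgn_unit)
    moreover have "0 \<le> t" "t \<le> 1" using x s unfolding t_def by auto
    ultimately show "x \<in> path_image g" unfolding path_image_def by auto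
  qed
  moreover have "pathstart g = sgn v" "pathfinish g = sgn w"
    unfolding pathstart_def pathfinish_def g_def q_def by simp_all
  ultimately show ?thesis using that by blast
qed

text \<open>
  The forms that are largest at a point of an edge, other than a vertex, are exactly those of the
  two facets at that edge, and two facets share at most one edge.
\<close>

lemma great_arcs_meet:
  assumes "adj v w" "adj v' w'" "x \<in> great_arc v w" "x \<in> great_arc v' w'" "x \<notin> vset"
  shows "{v, w} = {v', w'}"
proof -
  obtain f g where fg: "f \<in> N" "g \<in> N" "f \<noteq> g" "f \<bullet> v = 1" "g \<bullet> v = 1" "f \<bullet> w = 1" "g \<bullet> w = 1"
    and vw: "v \<in> P" "w \<in> P" "v \<noteq> w"
    using assms(1) unfolding adj_def by blast
  obtain f' where f': "f' \<in> N" "f' \<bullet> v' = 1" "f' \<bullet> w' = 1" and vw': "v' \<in> P" "w' \<in> P" "v' \<noteq> w'"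
    using assms(2) unfolding adj_def by blast
  have x: "x \<in> cone2 v w" "x \<in> cone2 v' w'" "norm x = 1" using assms(3,4) unfolding great_arc_def by auto
  have mx: "f \<bullet> x = f' \<bullet> x" "g \<bullet> x = f' \<bullet> x"
    using cone2_facet_max[OF assms(1) fg(1,4,6) x(1)] cone2_facet_max[OF assms(1) fg(2,5,7) x(1)]
      cone2_facet_max[OF assms(2) f' x(2)] f' fg by (meson order_antisym)+
  obtain a b where ab: "x = a *\<^sub>R v' + b *\<^sub>R w'" "0 \<le> a" "0 \<le> b" using x(2) unfolding cone2_def by auto
  have "a \<noteq> 0" "b \<noteq> 0"
  proof -
    have "x \<in> vset" if "x = c *\<^sub>R u" "0 \<le> c" "u \<in> P" for c u
    proof -
      have "0 < c" using that(1,2) x(3) by (cases "c = 0") auto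
      then have "sgn u = x" using that(1) x(3) sgn_scale_pos[of c u] sgn_unit[of x] by simp
      then show ?thesis using that(3) unfolding vset_def by blast
    qed
    then show "a \<noteq> 0" "b \<noteq> 0" using ab vw' assms(5) by auto
  qed
  then have pos: "0 < a" "0 < b" using ab by auto
  have tight: "m \<bullet> v' = 1 \<and> m \<bullet> w' = 1" if "m \<in> N" "m \<bullet> x = f' \<bullet> x" for m
  proof -
    have "a * (1 - m \<bullet> v') + b * (1 - m \<bullet> w') = 0"
      using that ab f' by (simp add: inner_add_right algebra_simps)
    moreover have "0 \<le> a * (1 - m \<bullet> v')" "0 \<le> b * (1 - m \<bullet> w')"
      using le_one vw' that(1) pos by simp_all
    ultimately have "a * (1 - m \<bullet> v') = 0" "b * (1 - m \<bullet> w') = 0" by linarith+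
    then show ?thesis using pos by simp
  qed
  have t: "f \<bullet> v' = 1" "f \<bullet> w' = 1" "g \<bullet> v' = 1" "g \<bullet> w' = 1" using tight fg mx by blast+
  have "v' = v \<or> v' = w"
    using edge_line_unique[OF vw(1,2) vw'(1) fg(1-3) fg(4-7) t(1,3)] vw(3) by blast
  moreover have "w' = v \<or> w' = w"
    using edge_line_unique[OF vw(1,2) vw'(2) fg(1-3) fg(4-7) t(2,4)] vw(3) by blast
  ultimately show ?thesis using vw'(3) by auto
qed

lemma finite_eset: "finite eset"
proof -
  have "eset \<subseteq> (\<lambda>(v, w). great_arc v w) ` (P \<times> P)" unfolding eset_def adj_def by auto
  then show ?thesis using finite_P finite_subset by blast
qed

lemma embedded: "embedded_graph vset eset"
  unfolding embedded_graph_def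
proof (intro conjI ballI impI)
  show "finite vset" "vset \<noteq> {}" unfolding vset_def using finite_P P_nonempty by auto
  show "vset \<subseteq> S2" unfolding vset_def using sgn_in_S2 P_nonzero by auto
  show "finite eset" by (rule finite_eset)
next
  fix e assume "e \<in> eset"
  then obtain v w where e: "e = great_arc v w" "adj v w" unfolding eset_def by auto
  show "e \<subseteq> S2" unfolding e great_arc_def by auto
  have vw: "v \<in> P" "w \<in> P" using e(2) unfolding adj_def by auto
  obtain g where "arc g" "path_image g = e" "pathstart g = sgn v" "pathfinish g = sgn w"
    using great_arc_is_arc[OF e(2)] e(1) by blast
  moreover have "e \<inter> vset = {sgn v, sgn w}"
    using great_arc_vertices[OF e(2)] vw unfolding e(1) vset_def by auto
  ultimately show "\<exists>g. arc g \<and> path_image g = e \<and> e \<inter> vset = {pathstart g, pathfinish g}" by auto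
next
  fix e e' assume e: "e \<in> eset" "e' \<in> eset" "e \<noteq> e'"
  obtain v w where vw: "e = great_arc v w" "adj v w" using e(1) unfolding eset_def by auto
  obtain v' w' where vw': "e' = great_arc v' w'" "adj v' w'" using e(2) unfolding eset_def by auto
  show "e \<inter> e' \<subseteq> vset"
  proof (rule ccontr)
    assume "\<not> e \<inter> e' \<subseteq> vset"
    then obtain x where "x \<in> great_arc v w" "x \<in> great_arc v' w'" "x \<notin> vset" using vw vw' by auto
    then have "{v, w} = {v', w'}" using great_arcs_meet vw vw' by blast
    then have "e = e'" using vw(1) vw'(1) great_arc_commute by (metis doubleton_eq_iff)
    then show False using e(3) by simp
  qed
qed

lemma isolated_vertex: "v \<in> P \<Longrightarrow> \<exists>w. adj v w"
proof -
  assume v: "v \<in> P"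
  obtain ws ms where fan: "corner_fan P N v ws ms" using fan_exists v by blast
  have "ws \<noteq> []" using fanD(1)[OF fan] by auto
  then show ?thesis using neighbours_in_fan[OF v fan] by (metis list.set_intros(1) mem_Collect_eq neq_Nil_conv)
qed

lemma graph_points_eq: "graph_points vset eset = \<Union>eset"
proof -
  have "vset \<subseteq> \<Union>eset"
  proof
    fix x assume "x \<in> vset"
    then obtain v where v: "v \<in> P" "x = sgn v" unfolding vset_def by auto
    obtain w where "adj v w" using isolated_vertex[OF v(1)] by blast
    then show "x \<in> \<Union>eset" using great_arc_vertices[OF \<open>adj v w\<close> v(1)] v(2) unfolding eset_def by blast
  qed
  then show ?thesis unfolding graph_points_def by auto
qed

text \<open>
  A point at which two forms are largest lies over an edge, by the lemma on two facets that meet;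
  all other points have a unique largest form.
\<close>

lemma complement_regions: "S2 - graph_points vset eset = \<Union>(region ` N)"
proof (intro set_eqI iffI)
  fix x assume x: "x \<in> S2 - graph_points vset eset"
  then have x0: "x \<noteq> 0" by auto
  obtain f where f: "f \<in> N" "\<And>m. m \<in> N \<Longrightarrow> m \<bullet> x \<le> f \<bullet> x"
    using Max_in[of "(\<lambda>m. m \<bullet> x) ` N"] Max_ge[of "(\<lambda>m. m \<bullet> x) ` N"] finite_N N_nonempty
    by fastforce
  obtain m where "m \<in> N" "0 < m \<bullet> x" using positive_facet[OF x0] .
  then have pos: "0 < f \<bullet> x" using f(2)[of m] by simp
  have "g \<bullet> x < f \<bullet> x" if g: "g \<in> N" "g \<noteq> f" for g
  proof (rule ccontr)
    assume "\<not> ?thesis"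
    then have gx: "g \<bullet> x = f \<bullet> x" using f(2)[OF g(1)] by simp
    define y where "y = (1 / (f \<bullet> x)) *\<^sub>R x"
    have y: "f \<bullet> y = 1" "g \<bullet> y = 1" "\<And>m. m \<in> N \<Longrightarrow> m \<bullet> y \<le> 1"
      using gx pos f(2) unfolding y_def by auto
    obtain v w t where e: "adj v w" "0 \<le> t" "t \<le> 1" "y = (1 - t) *\<^sub>R v + t *\<^sub>R w"
      using edge_point[OF f(1) g(1) _ y] g(2) by metis
    have "y \<in> cone2 v w" unfolding cone2_def using e by force
    then have "x \<in> cone2 v w" using cone2_scale[of "1 / (f \<bullet> x)" x] pos unfolding y_def by simp
    then have "x \<in> great_arc v w" using x unfolding great_arc_def by simp
    moreover have "great_arc v w \<in> eset" using e(1) unfolding eset_def by blast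
    ultimately have "x \<in> graph_points vset eset" unfolding graph_points_eq by blast
    then show False using x by simp
  qed
  then show "x \<in> \<Union>(region ` N)" using f(1) x unfolding region_def cell_def by auto
next
  fix x assume "x \<in> \<Union>(region ` N)"
  then obtain h where h: "h \<in> N" "x \<in> S2" "\<And>g. g \<in> N \<Longrightarrow> g \<noteq> h \<Longrightarrow> g \<bullet> x < h \<bullet> x"
    unfolding region_def cell_def by auto
  have "x \<notin> great_arc v w" if vw: "adj v w" for v w
  proof
    assume "x \<in> great_arc v w"
    then have x: "x \<in> cone2 v w" unfolding great_arc_def by simp
    obtain f g where fg: "f \<in> N" "g \<in> N" "f \<noteq> g" "f \<bullet> v = 1" "g \<bullet> v = 1" "f \<bullet> w = 1" "g \<bullet> w = 1"
      using vw unfolding adj_def by blast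
    show False
      using cone2_facet_max[OF vw fg(1,4,6) x h(1)] cone2_facet_max[OF vw fg(2,5,7) x h(1)] h(3)[OF fg(1)]
        h(3)[OF fg(2)] fg(3) by force
  qed
  then have "x \<notin> \<Union>eset" unfolding eset_def by auto
  then show "x \<in> S2 - graph_points vset eset" using h(2) graph_points_eq by simp
qed

lemma facet_interior_point:
  assumes "f \<in> N" obtains y where "y \<in> cell f"
proof -
  obtain v where v: "v \<in> P" "f \<bullet> v = 1" using facet_nonempty[OF assms] by blast
  obtain w1 w2 g1 g2 where c: "corner v f w1 w2 g1 g2" using corner_exists[OF v(1) assms v(2)] .
  have "g \<bullet> (v + w1 + w2) < f \<bullet> (v + w1 + w2)" if g: "g \<in> N" "g \<noteq> f" for g
  proof -
    have le: "g \<bullet> v \<le> 1" "g \<bullet> w1 \<le> 1" "g \<bullet> w2 \<le> 1" using le_one g c v unfolding corner_def by auto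
    have "\<not> (g \<bullet> v = 1 \<and> g \<bullet> w1 = 1 \<and> g \<bullet> w2 = 1)"
      using c g unfolding corner_def by (metis less_irrefl)
    then have "g \<bullet> v + g \<bullet> w1 + g \<bullet> w2 < 3" using le by linarith
    then show ?thesis using c unfolding corner_def by (simp add: inner_add_right)
  qed
  then show ?thesis using that unfolding cell_def by blast
qed

lemma convex_cell: "convex (cell f)"
proof -
  have "cell f = (\<Inter>g\<in>{g\<in>N. g \<noteq> f}. {x. (g - f) \<bullet> x < 0})"
    unfolding cell_def by (auto simp: inner_diff_left)
  then show ?thesis by (simp add: convex_INT convex_halfspace_lt)
qed

lemma open_cell: "open (cell f)"
proof -
  have "cell f = (\<Inter>g\<in>{g\<in>N. g \<noteq> f}. {x. (g - f) \<bullet> x < 0})"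
    unfolding cell_def by (auto simp: inner_diff_left)
  then show ?thesis using finite_N by (simp add: open_INT open_halfspace_lt)
qed

lemma other_facet: "f \<in> N \<Longrightarrow> \<exists>g\<in>N. g \<noteq> f"
  using facet_nonempty corner_exists unfolding corner_def by metis

lemma zero_notin_cell: "f \<in> N \<Longrightarrow> 0 \<notin> cell f"
  using other_facet[of f] unfolding cell_def by auto

lemma region_image: "f \<in> N \<Longrightarrow> region f = sgn ` cell f"
proof -
  assume f: "f \<in> N"
  have s: "sgn x \<in> cell f" if "x \<in> cell f" for x
  proof -
    have "0 < inverse (norm x)" using that zero_notin_cell[OF f] by auto
    then show ?thesis using that unfolding cell_def sgn_div_norm by (simp add: mult_strict_left_mono)
  qed
  show ?thesis
  proof (intro set_eqI iffI)
    fix x assume "x \<in> region f"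
    then have "x = sgn x" "x \<in> cell f" unfolding region_def by (simp_all add: sgn_unit)
    then show "x \<in> sgn ` cell f" by blast
  next
    fix x assume "x \<in> sgn ` cell f"
    then obtain y where y: "y \<in> cell f" "x = sgn y" by auto
    then have "y \<noteq> 0" using zero_notin_cell[OF f] by auto
    then show "x \<in> region f" using y s sgn_in_S2 unfolding region_def by simp
  qed
qed

lemma connected_region: "f \<in> N \<Longrightarrow> connected (region f)"
proof -
  assume f: "f \<in> N"
  have "continuous_on (cell f) (\<lambda>x. x /\<^sub>R norm x)"
    by (intro continuous_intros) (use zero_notin_cell[OF f] in auto)
  then have "continuous_on (cell f) sgn" unfolding sgn_div_norm[abs_def] .
  then show ?thesis unfolding region_image[OF f]
    using connected_continuous_image convex_connected convex_cell by blast
qed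

lemma region_nonempty: "f \<in> N \<Longrightarrow> region f \<noteq> {}"
  using facet_interior_point region_image by (metis empty_iff image_is_empty)

lemma region_disjoint: "f \<in> N \<Longrightarrow> g \<in> N \<Longrightarrow> f \<noteq> g \<Longrightarrow> region f \<inter> region g = {}"
  unfolding region_def cell_def by force

lemma inj_region: "inj_on region N"
  using region_disjoint region_nonempty by (metis inf.idem inj_onI)

text \<open>
  The regions are connected, being radial projections of convex cones, and they are disjoint and
  relatively open; hence each of them is also relatively closed in their union.
\<close>

lemma faces_eq: "faces vset eset = region ` N"
proof -
  let ?W = "\<Union>(region ` N)"
  have op: "openin (top_of_set ?W) (region f)" if "f \<in> N" for f
  proof -
    have "region f = ?W \<inter> cell f"
    proof (intro set_eqI iffI)
      fix x assume "x \<in> ?W \<inter> cell f"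
      then show "x \<in> region f" unfolding region_def by auto
    qed (use that region_def in auto)
    then show ?thesis using open_cell by (metis openin_open)
  qed
  have comp: "region f \<in> components ?W" if f: "f \<in> N" for f
  proof -
    have "?W - region f = \<Union>(region ` (N - {f}))" using region_disjoint[OF f] by blast
    moreover have "openin (top_of_set ?W) (\<Union>(region ` (N - {f})))" using op by blast
    ultimately have "closedin (top_of_set ?W) (region f)" using op[OF f]
      by (simp add: closedin_def openin_imp_subset)
    then show ?thesis
      using clopen_connected_is_component connected_region region_nonempty op f by blast
  qed
  have "components ?W = region ` N"
  proof
    show "region ` N \<subseteq> components ?W" using comp by auto
    show "components ?W \<subseteq> region ` N"
    proof
      fix K assume K: "K \<in> components ?W"
      then obtain x f where "x \<in> K" "f \<in> N" "x \<in> region f"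
        using in_components_nonempty in_components_subset by blast
      then have "K = region f" using comp[of f] K components_nonoverlap by blast
      then show "K \<in> region ` N" using \<open>f \<in> N\<close> by blast
    qed
  qed
  then show ?thesis unfolding faces_def complement_regions .
qed

text \<open>
  From a point of a side of \<open>f\<close>, moving in the direction of any point of the cell of
  \<open>f\<close> leads into the cell. Conversely, the form \<open>f\<close> is still (weakly) the
  largest one on the closure of its cell.
\<close>

lemma great_arc_in_closure:
  assumes f: "f \<in> N" and vw: "adj v w"
  shows "great_arc v w \<subseteq> closure (region f) \<longleftrightarrow> f \<bullet> v = 1 \<and> f \<bullet> w = 1"
proof
  assume sub: "great_arc v w \<subseteq> closure (region f)"
  let ?C = "\<Inter>m\<in>N. {x. (m - f) \<bullet> x \<le> 0}"
  have "closed ?C" by (intro closed_INT ballI closed_halfspace_le)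
  moreover have "region f \<subseteq> ?C" unfolding region_def cell_def by (force simp: inner_diff_left)
  ultimately have C: "closure (region f) \<subseteq> ?C" by (simp add: closure_minimal)
  have "f \<bullet> u = 1" if u: "u = v \<or> u = w" for u
  proof -
    have uP: "u \<in> P" using u vw unfolding adj_def by auto
    have "sgn u \<in> ?C" using great_arc_vertices[OF vw uP] u sub C by blast
    then have "\<And>m. m \<in> N \<Longrightarrow> (m - f) \<bullet> u / norm u \<le> 0"
      by (auto simp: sgn_div_norm divide_inverse mult.commute)
    moreover have "0 < norm u" using P_nonzero[OF uP] by simp
    ultimately have "\<And>m. m \<in> N \<Longrightarrow> m \<bullet> u \<le> f \<bullet> u"
      by (simp add: divide_le_0_iff inner_diff_left)
    moreover obtain m where "m \<in> N" "m \<bullet> u = 1" using P_facet[OF uP] .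
    ultimately show ?thesis using le_one[OF uP f] by force
  qed
  then show "f \<bullet> v = 1 \<and> f \<bullet> w = 1" by blast
next
  assume fvw: "f \<bullet> v = 1 \<and> f \<bullet> w = 1"
  show "great_arc v w \<subseteq> closure (region f)"
  proof
    fix x assume "x \<in> great_arc v w"
    then have x: "x \<in> cone2 v w" "norm x = 1" unfolding great_arc_def by auto
    obtain y where y: "y \<in> cell f" using facet_interior_point[OF f] .
    have in_cell: "x + t *\<^sub>R y \<in> cell f" if "0 < t" for t
      unfolding cell_def
    proof (intro CollectI ballI impI)
      fix g assume g: "g \<in> N" "g \<noteq> f"
      have "g \<bullet> x \<le> f \<bullet> x" using cone2_facet_max[OF vw f] fvw x(1) g(1) by blast
      moreover have "t * (g \<bullet> y) < t * (f \<bullet> y)" using y g that unfolding cell_def by auto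
      ultimately show "g \<bullet> (x + t *\<^sub>R y) < f \<bullet> (x + t *\<^sub>R y)" by (simp add: inner_add_right)
    qed
    have "((\<lambda>t. sgn (x + t *\<^sub>R y)) \<longlongrightarrow> sgn (x + 0 *\<^sub>R y)) (at_right 0)"
      by (intro tendsto_intros) (use x in auto)
    then have "((\<lambda>t. sgn (x + t *\<^sub>R y)) \<longlongrightarrow> x) (at_right 0)" using x(2) by (simp add: sgn_unit)
    moreover have "eventually (\<lambda>t. sgn (x + t *\<^sub>R y) \<in> closure (region f)) (at_right 0)"
    proof -
      have "eventually (\<lambda>t. t > 0) (at_right (0::real))" by (rule eventually_at_right_less)
      then show ?thesis
        by eventually_elim (use in_cell region_image[OF f] closure_subset in blast)
    qed
    ultimately show "x \<in> closure (region f)"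
      by (intro Lim_in_closed_set[OF closed_closure _ trivial_limit_at_right_real])
  qed
qed

lemma great_arc_inj: "adj v w \<Longrightarrow> adj v w' \<Longrightarrow> great_arc v w = great_arc v w' \<Longrightarrow> w = w'"
  using great_arc_vertices unfolding adj_def by metis

lemma edges_at_vertex:
  assumes "v \<in> P" shows "{e \<in> eset. sgn v \<in> e} = great_arc v ` {w. adj v w}"
proof (intro set_eqI iffI)
  fix e assume "e \<in> {e \<in> eset. sgn v \<in> e}"
  then obtain x y where e: "e = great_arc x y" "adj x y" "sgn v \<in> great_arc x y" unfolding eset_def by auto
  then have "v = x \<or> v = y" using great_arc_vertices assms by blast
  then show "e \<in> great_arc v ` {w. adj v w}" using e great_arc_commute adj_sym by blast
next
  fix e assume "e \<in> great_arc v ` {w. adj v w}"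
  then show "e \<in> {e \<in> eset. sgn v \<in> e}" using great_arc_vertices assms unfolding eset_def by auto
qed

lemma fan_edges:
  assumes "v \<in> P" "corner_fan P N v ws ms"
  shows "distinct (map (great_arc v) ws)" "set (map (great_arc v) ws) = {e \<in> eset. sgn v \<in> e}"
proof -
  have "inj_on (great_arc v) (set ws)"
    using great_arc_inj neighbours_in_fan[OF assms] by (auto intro!: inj_onI)
  then show "distinct (map (great_arc v) ws)" using fan_distinct(2)[OF assms(2)] by (simp add: distinct_map)
  show "set (map (great_arc v) ws) = {e \<in> eset. sgn v \<in> e}"
    using edges_at_vertex[OF assms(1)] neighbours_in_fan[OF assms] by simp
qed

lemma vertex_degree_ge: assumes "v \<in> P" shows "3 \<le> vertex_degree eset (sgn v)"
proof -
  obtain ws ms where fan: "corner_fan P N v ws ms" using fan_exists assms by blast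
  have "vertex_degree eset (sgn v) = length ws"
    unfolding vertex_degree_def fan_edges(2)[OF assms fan, symmetric]
    using distinct_card[OF fan_edges(1)[OF assms fan]] by simp
  then show ?thesis using fanD(1)[OF fan] by simp
qed

lemma sides_of_region:
  assumes "f \<in> N"
  shows "face_sides eset (region f) = {great_arc v w | v w. adj v w \<and> f \<bullet> v = 1 \<and> f \<bullet> w = 1}"
  unfolding face_sides_def eset_def using great_arc_in_closure[OF assms] by blast

text \<open>
  Each side of a face has two ends, and each vertex of a facet is on two of its sides; so a face has
  as many sides as the facet has vertices.
\<close>

lemma face_degree_region:
  assumes f: "f \<in> N" shows "face_degree eset (region f) = card {v \<in> P. f \<bullet> v = 1}"
proof -
  let ?S = "face_sides eset (region f)" and ?A = "{v \<in> P. f \<bullet> v = 1}"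
  have fin: "finite ?S" "finite ?A" using finite_eset finite_P unfolding face_sides_def by auto
  have 1: "card {v \<in> ?A. sgn v \<in> e} = 2" if "e \<in> ?S" for e
  proof -
    obtain v w where e: "e = great_arc v w" "adj v w" "f \<bullet> v = 1" "f \<bullet> w = 1"
      using \<open>e \<in> ?S\<close> unfolding sides_of_region[OF f] by blast
    then have "{u \<in> ?A. sgn u \<in> e} = {v, w}" using great_arc_vertices[OF e(2)] unfolding adj_def by auto
    then show ?thesis using e(2) unfolding adj_def by simp
  qed
  have 2: "card {e \<in> ?S. sgn v \<in> e} = 2" if v: "v \<in> ?A" for v
  proof -
    have "{e \<in> ?S. sgn v \<in> e} = great_arc v ` {w. adj v w \<and> f \<bullet> w = 1}"
    proof (intro set_eqI iffI)
      fix e assume "e \<in> {e \<in> ?S. sgn v \<in> e}"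
      then obtain x y where e: "e = great_arc x y" "adj x y" "sgn v \<in> great_arc x y" "f \<bullet> x = 1" "f \<bullet> y = 1"
        unfolding sides_of_region[OF f] by blast
      then have "v = x \<or> v = y" using great_arc_vertices v by blast
      then show "e \<in> great_arc v ` {w. adj v w \<and> f \<bullet> w = 1}"
        using e great_arc_commute adj_sym by blast
    next
      fix e assume "e \<in> great_arc v ` {w. adj v w \<and> f \<bullet> w = 1}"
      then show "e \<in> {e \<in> ?S. sgn v \<in> e}"
        using great_arc_vertices v unfolding sides_of_region[OF f] by auto
    qed
    moreover have "inj_on (great_arc v) {w. adj v w \<and> f \<bullet> w = 1}"
      using great_arc_inj by (auto intro!: inj_onI)
    ultimately show ?thesis using facet_neighbours[of v f] v f by (simp add: card_image)
  qed
  have "(\<Sum>e\<in>?S. card {v \<in> ?A. sgn v \<in> e}) = 2 * card ?A"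
    using sum_multicount[OF fin, of "\<lambda>e v. sgn v \<in> e" 2] 2 by blast
  then have "2 * card ?S = 2 * card ?A" using 1 by simp
  then show ?thesis unfolding face_degree_def by simp
qed

lemma face_degree_ge: assumes f: "f \<in> N" shows "3 \<le> face_degree eset (region f)"
proof -
  obtain v where v: "v \<in> P" "f \<bullet> v = 1" using facet_nonempty[OF f] by blast
  obtain w1 w2 g1 g2 where "corner v f w1 w2 g1 g2" using corner_exists[OF v(1) f v(2)] .
  then have "{v, w1, w2} \<subseteq> {v \<in> P. f \<bullet> v = 1}" "card {v, w1, w2} = 3"
    using v unfolding corner_def by auto
  then show ?thesis unfolding face_degree_region[OF f]
    using card_mono[of "{v \<in> P. f \<bullet> v = 1}" "{v, w1, w2}"] finite_P by simp
qed

lemma two_faces: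
  assumes "e \<in> eset" shows "card {F \<in> faces vset eset. e \<in> face_sides eset F} = 2"
proof -
  obtain v w where e: "e = great_arc v w" "adj v w" using assms unfolding eset_def by auto
  have "{F \<in> faces vset eset. e \<in> face_sides eset F} = region ` {m \<in> N. m \<bullet> v = 1 \<and> m \<bullet> w = 1}"
    unfolding faces_eq using great_arc_in_closure[OF _ e(2)] assms
    unfolding face_sides_def e(1) by auto
  moreover have "inj_on region {m \<in> N. m \<bullet> v = 1 \<and> m \<bullet> w = 1}"
    using inj_region by (rule inj_on_subset) auto
  ultimately show ?thesis using adj_card_facets[OF e(2)] by (simp add: card_image)
qed

end

section \<open>Charts at the vertices\<close>

lemma cis_between:
  assumes "0 < \<delta>" "\<delta> < pi"
  shows "cis \<psi> = of_real (sin (\<delta> - \<psi>) / sin \<delta>) + of_real (sin \<psi> / sin \<delta>) * cis \<delta>"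
proof -
  have "sin \<delta> \<noteq> 0" using sin_gt_zero assms by force
  then show ?thesis by (simp add: complex_eq_iff sin_diff field_simps)
qed

lemma first_angle_beyond:
  fixes \<theta> :: "nat \<Rightarrow> real"
  assumes "\<theta> 0 \<le> x" "x < \<theta> r"
  obtains j where "j < r" "\<theta> j \<le> x" "x < \<theta> (Suc j)"
proof -
  define j where "j = (LEAST n. x < \<theta> n)"
  have j: "x < \<theta> j" unfolding j_def using assms(2) by (rule LeastI)
  have "j \<le> r" unfolding j_def using assms(2) by (rule Least_le)
  moreover have "j \<noteq> 0" using j assms(1) by (metis not_le)
  moreover have "\<theta> (j - 1) \<le> x" using not_less_Least[of "j - 1" "\<lambda>n. x < \<theta> n"] \<open>j \<noteq> 0\<close>
    unfolding j_def[symmetric] by force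
  ultimately show ?thesis using that[of "j - 1"] j by auto
qed

text \<open>
  Angles of vectors in the plane, each to the left of the one before, that go once around the
  origin.
\<close>

definition angular_fan :: "nat \<Rightarrow> (nat \<Rightarrow> complex) \<Rightarrow> (nat \<Rightarrow> real) \<Rightarrow> bool" where
  "angular_fan r \<omega> \<theta> \<longleftrightarrow> (\<forall>i\<le>r. \<omega> (i mod r) = of_real (norm (\<omega> (i mod r))) * cis (\<theta> i)) \<and>
     (\<forall>i<r. \<omega> i \<noteq> 0 \<and> \<theta> i < \<theta> (Suc i) \<and> \<theta> (Suc i) < \<theta> i + pi) \<and> \<theta> r = \<theta> 0 + 2 * pi"

lemma sector_coordinates:
  assumes \<omega>: "\<omega>1 = of_real (norm \<omega>1) * cis \<alpha>" "\<omega>2 = of_real (norm \<omega>2) * cis \<beta>" "\<omega>1 \<noteq> 0" "\<omega>2 \<noteq> 0"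
    and ab: "\<alpha> < \<beta>" "\<beta> < \<alpha> + pi" 
  shows "of_real s * cis x = of_real (s * sin (\<beta> - x) / sin (\<beta> - \<alpha>) / norm \<omega>1) * \<omega>1
     + of_real (s * sin (x - \<alpha>) / sin (\<beta> - \<alpha>) / norm \<omega>2) * \<omega>2"
proof -
  have 1: "cis \<alpha> = \<omega>1 / of_real (norm \<omega>1)" 
    using \<omega>(1,3) by (metis nonzero_mult_div_cancel_left norm_eq_zero of_real_eq_0_iff)
  have 2: "cis \<beta> = \<omega>2 / of_real (norm \<omega>2)" 
    using \<omega>(2,4) by (metis nonzero_mult_div_cancel_left norm_eq_zero of_real_eq_0_iff)
  have "cis x = cis \<alpha> * cis (x - \<alpha>)" by (simp add: cis_mult)
  also have "\<dots> = cis \<alpha> * (of_real (sin (\<beta> - x) / sin (\<beta> - \<alpha>)) + of_real (sin (x - \<alpha>) / sin (\<beta> - \<alpha>)) * cis (\<beta> - \<alpha>))"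
    using cis_between[of "\<beta> - \<alpha>" "x - \<alpha>"] ab by simp
  also have "\<dots> = of_real (sin (\<beta> - x) / sin (\<beta> - \<alpha>)) * cis \<alpha> + of_real (sin (x - \<alpha>) / sin (\<beta> - \<alpha>)) * cis \<beta>"
    using cis_mult[of \<alpha> "\<beta> - \<alpha>"] by (simp add: algebra_simps)
  finally have "cis x = \<dots>" .
  then show ?thesis unfolding 1 2 by (simp add: algebra_simps)
qed

text \<open>
  Adding up the angles from each vector to the next gives a positive multiple of \<open>2
  \<pi>\<close>. If it were more than one full turn, then the first vector would be met again inside
  a later sector.
\<close>

lemma angular_fan_exists:
  assumes r: "2 \<le> r" and left: "\<And>i. i < r \<Longrightarrow> 0 < Im (cnj (\<omega> i) * \<omega> (Suc i mod r))"
    and once: "\<And>j a b. 1 \<le> j \<Longrightarrow> j < r \<Longrightarrow> 0 < a \<Longrightarrow> 0 \<le> b \<Longrightarrow>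
       \<omega> 0 \<noteq> of_real a * \<omega> j + of_real b * \<omega> (Suc j mod r)"
  obtains \<theta> where "angular_fan r \<omega> \<theta>"
proof -
  define \<delta> where "\<delta> i = Arg (\<omega> (Suc i mod r) / \<omega> i)" for i
  define \<theta> where "\<theta> n = Arg (\<omega> 0) + (\<Sum>j<n. \<delta> j)" for n
  have nz: "\<omega> i \<noteq> 0" if "i < r" for i using left[OF that] by auto
  have \<delta>: "0 < \<delta> i" "\<delta> i < pi" if "i < r" for i
  proof -
    have "Im (\<omega> (Suc i mod r) / \<omega> i) = Im (cnj (\<omega> i) * \<omega> (Suc i mod r)) / (norm (\<omega> i))\<^sup>2"
      by (simp add: complex_div_cnj[of _ "\<omega> i"] mult.commute flip: of_real_power)
    also have "\<dots> > 0" using left[OF that] nz[OF that] by simp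
    finally show "0 < \<delta> i" "\<delta> i < pi" unfolding \<delta>_def using Arg_lt_pi by blast+
  qed
  have rep: "\<omega> (n mod r) = of_real (norm (\<omega> (n mod r))) * cis (\<theta> n)" if "n \<le> r" for n
    using that
  proof (induction n)
    case 0
    then show ?case using r rcis_cmod_Arg[of "\<omega> 0"] unfolding \<theta>_def rcis_def by simp
  next
    case (Suc n)
    then have n: "n < r" "n mod r = n" by simp_all
    let ?q = "\<omega> (Suc n mod r) / \<omega> n"
    have "\<omega> (Suc n mod r) = ?q * \<omega> n" using nz[OF n(1)] by simp
    also have "\<dots> = (of_real (norm ?q) * cis (\<delta> n)) * (of_real (norm (\<omega> n)) * cis (\<theta> n))"
      using Suc n rcis_cmod_Arg[of ?q] unfolding \<delta>_def rcis_def by simp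
    also have "\<dots> = of_real (norm ?q * norm (\<omega> n)) * cis (\<theta> n + \<delta> n)"
      by (simp add: cis_mult[symmetric] algebra_simps)
    also have "norm ?q * norm (\<omega> n) = norm (\<omega> (Suc n mod r))"
      using nz[OF n(1)] by (simp add: norm_divide)
    finally show ?case unfolding \<theta>_def by (simp add: add.assoc)
  qed
  have step: "\<theta> (Suc i) = \<theta> i + \<delta> i" for i unfolding \<theta>_def by simp
  have inc: "\<theta> i < \<theta> (Suc i)" "\<theta> (Suc i) < \<theta> i + pi" if "i < r" for i using \<delta>[OF that] step[of i] by auto
  have lt: "\<theta> 0 < \<theta> r"
  proof -
    have "0 < (\<Sum>j<r. \<delta> j)" using \<delta> r by (intro sum_pos) (auto simp: lessThan_empty_iff)
    then show ?thesis unfolding \<theta>_def by simp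
  qed
  have rep1: "\<omega> i = of_real (norm (\<omega> i)) * cis (\<theta> i)" if "i < r" for i
    using rep[of i] that by (metis less_imp_le mod_less)
  have rep2: "\<omega> (Suc i mod r) = of_real (norm (\<omega> (Suc i mod r))) * cis (\<theta> (Suc i))" if "i < r" for i
    using rep[of "Suc i"] that by (metis Suc_leI)
  have r0: "0 < r" using r by simp
  have "of_real (norm (\<omega> 0)) * cis (\<theta> r) = of_real (norm (\<omega> 0)) * cis (\<theta> 0)"
    using rep[of r] rep1[OF r0] by (metis mod_self order_refl)
  then have "cis (\<theta> r) = cis (\<theta> 0)" using nz[OF r0] by simp
  then have "cos (\<theta> r - \<theta> 0) = 1" 
    by (metis cis.sel(1) cis_divide cis_neq_zero divide_self one_complex.sel(1))
  then obtain k :: int where k: "\<theta> r - \<theta> 0 = of_int k * 2 * pi" using cos_one_2pi_int by blast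
  have "0 < of_int k * pi" using lt k by simp
  then have "0 < k" by (simp add: zero_less_mult_iff)
  have "k = 1"
  proof (rule ccontr)
    assume "k \<noteq> 1"
    then have "2 \<le> k" using \<open>0 < k\<close> by simp
    then have "2 * pi \<le> of_int k * pi" by simp
    then have "\<theta> 0 + 2 * pi < \<theta> r" using k pi_gt_zero by (simp add: algebra_simps)
    then obtain j where j: "j < r" "\<theta> j \<le> \<theta> 0 + 2 * pi" "\<theta> 0 + 2 * pi < \<theta> (Suc j)"
      using first_angle_beyond[of \<theta> "\<theta> 0 + 2 * pi" r] pi_gt_zero by auto
    have "j \<noteq> 0" using j(3) inc(2)[of 0] r pi_gt_zero by (cases j) auto
    let ?x = "\<theta> 0 + 2 * pi"
    have n: "Suc j mod r < r" using r by simp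
    have "cis ?x = cis (\<theta> 0)" by (simp flip: cis_mult)
    then have "\<omega> 0 = of_real (norm (\<omega> 0)) * cis ?x" using rep1[OF r0] by metis
    also have "\<dots> = of_real (norm (\<omega> 0) * sin (\<theta> (Suc j) - ?x) / sin (\<theta> (Suc j) - \<theta> j) / norm (\<omega> j)) * \<omega> j
     + of_real (norm (\<omega> 0) * sin (?x - \<theta> j) / sin (\<theta> (Suc j) - \<theta> j) / norm (\<omega> (Suc j mod r))) * \<omega> (Suc j mod r)"
      by (rule sector_coordinates[OF rep1[OF j(1)] rep2[OF j(1)] nz[OF j(1)] nz[OF n] inc[OF j(1)]])
    finally have e: "\<omega> 0 = \<dots>" .
    have sn: "0 < sin (\<theta> (Suc j) - \<theta> j)" "0 < sin (\<theta> (Suc j) - ?x)" "0 \<le> sin (?x - \<theta> j)"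
      using j inc[OF j(1)] by (auto intro!: sin_gt_zero sin_ge_zero)
    have "0 < norm (\<omega> 0) * sin (\<theta> (Suc j) - ?x) / sin (\<theta> (Suc j) - \<theta> j) / norm (\<omega> j)"
      using sn nz[OF j(1)] nz[OF r0] by simp
    moreover have "0 \<le> norm (\<omega> 0) * sin (?x - \<theta> j) / sin (\<theta> (Suc j) - \<theta> j) / norm (\<omega> (Suc j mod r))"
      using sn by simp
    moreover have "1 \<le> j" using \<open>j \<noteq> 0\<close> by simp
    ultimately show False using once j(1) e by blast
  qed
  then have "\<theta> r = \<theta> 0 + 2 * pi" using k by simp
  then show ?thesis using that[of \<theta>] rep nz inc unfolding angular_fan_def by blast
qed

lemma angular_fan_cover:
  assumes "angular_fan r \<omega> \<theta>"
  obtains i a b where "i < r" "0 \<le> a" "0 \<le> b" "z = of_real a * \<omega> i + of_real b * \<omega> (Suc i mod r)"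
proof -
  have F: "\<And>i. i \<le> r \<Longrightarrow> \<omega> (i mod r) = of_real (norm (\<omega> (i mod r))) * cis (\<theta> i)"
    "\<And>i. i < r \<Longrightarrow> \<omega> i \<noteq> 0" "\<And>i. i < r \<Longrightarrow> \<theta> i < \<theta> (Suc i)" "\<And>i. i < r \<Longrightarrow> \<theta> (Suc i) < \<theta> i + pi"
    "\<theta> r = \<theta> 0 + 2 * pi"
    using assms unfolding angular_fan_def by blast+
  define x where "x = \<theta> 0 + Arg2pi (z / cis (\<theta> 0))"
  let ?q = "z / cis (\<theta> 0)"
  have "?q = of_real (norm z) * cis (Arg2pi ?q)"
    using Arg2pi_eq[of ?q] by (simp add: norm_divide cis_conv_exp)
  then have "cis (\<theta> 0) * ?q = of_real (norm z) * (cis (\<theta> 0) * cis (Arg2pi ?q))"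
    by (metis mult.left_commute)
  then have z: "z = of_real (norm z) * cis x" unfolding x_def by (simp add: cis_mult)
  have "\<theta> 0 \<le> x" "x < \<theta> r" unfolding x_def F(5) using Arg2pi_ge_0 Arg2pi_lt_2pi by auto
  then obtain j where j: "j < r" "\<theta> j \<le> x" "x < \<theta> (Suc j)" by (rule first_angle_beyond)
  have n: "Suc j mod r < r" using j(1) by simp
  have rep1: "\<omega> j = of_real (norm (\<omega> j)) * cis (\<theta> j)"
    using F(1)[of j] j(1) by (metis less_imp_le mod_less)
  have rep2: "\<omega> (Suc j mod r) = of_real (norm (\<omega> (Suc j mod r))) * cis (\<theta> (Suc j))"
    using F(1)[of "Suc j"] j(1) by (metis Suc_leI)
  let ?a = "norm z * sin (\<theta> (Suc j) - x) / sin (\<theta> (Suc j) - \<theta> j) / norm (\<omega> j)"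
  let ?b = "norm z * sin (x - \<theta> j) / sin (\<theta> (Suc j) - \<theta> j) / norm (\<omega> (Suc j mod r))"
  have e: "z = of_real ?a * \<omega> j + of_real ?b * \<omega> (Suc j mod r)"
  proof -
    note z
    also have "of_real (norm z) * cis x = of_real ?a * \<omega> j + of_real ?b * \<omega> (Suc j mod r)"
      by (rule sector_coordinates[OF rep1 rep2 F(2)[OF j(1)] F(2)[OF n] F(3,4)[OF j(1)]])
    finally show ?thesis .
  qed
  have "0 < sin (\<theta> (Suc j) - \<theta> j)" "0 < sin (\<theta> (Suc j) - x)" "0 \<le> sin (x - \<theta> j)"
    using j F(3,4)[OF j(1)] by (auto intro!: sin_gt_zero sin_ge_zero)
  then have nn: "0 \<le> ?a" "0 \<le> ?b" by simp_all
  show ?thesis using that[OF j(1) nn e] .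
qed

text \<open>
  An orthonormal basis, positively oriented: the last conjunct expresses the third component of a
  cross product, so that angles in the tangent plane measured by \<open>a\<close> and
  \<open>b\<close> go the same way as the determinants of a fan.
\<close>

definition frame :: "real^3 \<Rightarrow> real^3 \<Rightarrow> real^3 \<Rightarrow> bool" where
  "frame u a b \<longleftrightarrow> u \<bullet> u = 1 \<and> a \<bullet> a = 1 \<and> b \<bullet> b = 1 \<and> u \<bullet> a = 0 \<and> u \<bullet> b = 0 \<and> a \<bullet> b = 0 \<and>
     (\<forall>x. x = (u \<bullet> x) *\<^sub>R u + (a \<bullet> x) *\<^sub>R a + (b \<bullet> x) *\<^sub>R b) \<and>
     (\<forall>x y. (a \<bullet> x) * (b \<bullet> y) - (b \<bullet> x) * (a \<bullet> y) = u \<bullet> cross3 x y)"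

lemma frame_exists:
  assumes "norm u = 1" obtains a b where "frame u a b"
proof -
  obtain y where y: "y \<noteq> 0" "orthogonal u y"
    using orthogonal_to_vector_exists[of u] by auto
  define a where "a = sgn y"
  define b where "b = cross3 u a"
  have uu: "u \<bullet> u = 1" using assms by (simp add: norm_eq_1)
  have aa: "a \<bullet> a = 1" using y(1) norm_eq_1[of a] unfolding a_def by (simp add: norm_sgn)
  have ua: "u \<bullet> a = 0" using y(2) unfolding a_def orthogonal_def sgn_div_norm by simp
  have bb: "b \<bullet> b = 1" using uu aa ua unfolding b_def by (simp add: dot_cross)
  have ub: "u \<bullet> b = 0" "a \<bullet> b = 0" unfolding b_def by (simp_all add: dot_cross_self)
  have ab: "cross3 a b = u"
    unfolding b_def using aa ua by (simp add: Lagrange inner_commute)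
  have bu: "cross3 b u = a"
    unfolding b_def using uu ua Lagrange[of u u a] cross_skew[of "cross3 u a" u] by (simp add: inner_commute)
  have "x = (u \<bullet> x) *\<^sub>R u + (a \<bullet> x) *\<^sub>R a + (b \<bullet> x) *\<^sub>R b" for x
  proof -
    have "u \<bullet> cross3 x b = a \<bullet> x" 
      using cross_triple[of x b u] bu by (simp add: inner_commute)
    moreover have "u \<bullet> cross3 a x = b \<bullet> x"
      using cross_triple[of u a x] unfolding b_def by (simp add: inner_commute)
    ultimately show ?thesis using cramer_expansion[of u a b x] uu ab by (simp add: inner_commute)
  qed
  moreover have "(a \<bullet> x) * (b \<bullet> y) - (b \<bullet> x) * (a \<bullet> y) = u \<bullet> cross3 x y" for x y
    using dot_cross[of a b x y] ab by (simp add: algebra_simps)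
  ultimately show ?thesis using that uu aa bb ua ub unfolding frame_def by blast
qed

definition tangent :: "real^3 \<Rightarrow> real^3 \<Rightarrow> real^3 \<Rightarrow> complex" where
  "tangent a b x = Complex (a \<bullet> x) (b \<bullet> x)"

lemma tangent_linear:
  "tangent a b (x + y) = tangent a b x + tangent a b y"
  "tangent a b (c *\<^sub>R x) = of_real c * tangent a b x"
  by (simp_all add: tangent_def complex_eq_iff inner_add_right)

lemma tangent_eq_lift:
  assumes fr: "frame (sgn v) a b" and v: "v \<noteq> 0"
    and eq: "tangent a b x = of_real \<alpha> * tangent a b y + of_real \<beta> * tangent a b z"
  obtains \<gamma> where "x = \<gamma> *\<^sub>R v + \<alpha> *\<^sub>R y + \<beta> *\<^sub>R z"
proof -
  define d where "d = x - \<alpha> *\<^sub>R y - \<beta> *\<^sub>R z"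
  have "a \<bullet> d = 0" "b \<bullet> d = 0" using eq unfolding d_def tangent_def
    by (simp_all add: complex_eq_iff inner_diff_right)
  moreover have "d = (sgn v \<bullet> d) *\<^sub>R sgn v + (a \<bullet> d) *\<^sub>R a + (b \<bullet> d) *\<^sub>R b"
    using fr unfolding frame_def by blast
  ultimately have "d = (sgn v \<bullet> d) *\<^sub>R sgn v" by simp
  also have "\<dots> = ((sgn v \<bullet> d) / norm v) *\<^sub>R v" by (simp add: sgn_div_norm divide_inverse)
  finally show ?thesis using that[of "(sgn v \<bullet> d) / norm v"] unfolding d_def by (simp add: algebra_simps)
qed

lemma cross3_coplanar:
  fixes v y :: "real^3"
  shows "v \<bullet> cross3 (- (\<gamma> *\<^sub>R v) - \<beta> *\<^sub>R y) y = 0" "v \<bullet> cross3 y (- (\<gamma> *\<^sub>R v) - \<beta> *\<^sub>R y) = 0"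
  by (simp_all add: cross3_simps)

context spherical_polytope begin

text \<open>
  The walk around a vertex goes around only once: if the first edge pointed into the sector of a
  later facet, then its end would have to lie on that facet, which the incidences exclude.
\<close>

lemma tangent_fan_exists:
  assumes v: "v \<in> P" and fan: "corner_fan P N v ws ms" and fr: "frame (sgn v) a b"
  obtains \<theta> where "angular_fan (length ws) (\<lambda>i. tangent a b (ws ! i)) \<theta>"
proof -
  let ?r = "length ws"
  note F = fanD[OF fan]
  have v0: "v \<noteq> 0" using P_nonzero[OF v] .
  have left: "0 < Im (cnj (tangent a b (ws ! i)) * tangent a b (ws ! (Suc i mod ?r)))" if "i < ?r" for i
  proof -
    have "Im (cnj (tangent a b (ws ! i)) * tangent a b (ws ! (Suc i mod ?r)))
      = sgn v \<bullet> cross3 (ws ! i) (ws ! (Suc i mod ?r))"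
      using fr unfolding frame_def tangent_def by (simp add: algebra_simps)
    also have "\<dots> > 0" using F(6)[OF that] v0 by (simp add: sgn_div_norm)
    finally show ?thesis .
  qed
  have once: "tangent a b (ws ! 0) \<noteq>
      of_real \<alpha> * tangent a b (ws ! j) + of_real \<beta> * tangent a b (ws ! (Suc j mod ?r))"
    if j: "1 \<le> j" "j < ?r" "0 < \<alpha>" "0 \<le> \<beta>" for j \<alpha> \<beta>
  proof
    assume "tangent a b (ws ! 0) = 
      of_real \<alpha> * tangent a b (ws ! j) + of_real \<beta> * tangent a b (ws ! (Suc j mod ?r))"
    then obtain \<gamma> where w0: "ws ! 0 = \<gamma> *\<^sub>R v + \<alpha> *\<^sub>R (ws ! j) + \<beta> *\<^sub>R (ws ! (Suc j mod ?r))"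
      using tangent_eq_lift[OF fr v0] by blast
    let ?n = "Suc j mod ?r"
    have r0: "0 < ?r" using j(2) by linarith
    then have n: "?n < ?r" by simp
    have mj: "ms ! j \<bullet> ws ! j = 1" "ms ! j \<bullet> ws ! ?n = 1" using F(5)[OF j(2,2)] F(5)[OF j(2) n] by auto
    have m0: "ms ! 0 \<bullet> ws ! 0 = 1" using F(5)[OF r0 r0] by auto
    have le: "ms ! j \<bullet> ws ! 0 \<le> 1" "ms ! 0 \<bullet> ws ! j \<le> 1" "ms ! 0 \<bullet> ws ! ?n \<le> 1"
      using F(7) r0 n j le_one by blast+
    have s1: "ms ! j \<bullet> ws ! 0 = \<gamma> + \<alpha> + \<beta>" using w0 mj F(7)[OF j(2)] by (simp add: inner_add_right)
    have s0: "1 = \<gamma> + \<alpha> * (ms ! 0 \<bullet> ws ! j) + \<beta> * (ms ! 0 \<bullet> ws ! ?n)"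
      using w0 m0 F(7)[OF r0] by (simp add: inner_add_right)
    have b1: "\<alpha> * (ms ! 0 \<bullet> ws ! j) \<le> \<alpha>" using le(2) j by (simp add: mult_left_le)
    have b2: "\<beta> * (ms ! 0 \<bullet> ws ! ?n) \<le> \<beta>" using le(3) j by (simp add: mult_left_le)
    have "ms ! j \<bullet> ws ! 0 = 1" using s1 s0 b1 b2 le(1) by linarith
    then have "?n = 0" using F(5)[OF j(2) r0] j(1) by auto
    have "\<alpha> * (ms ! 0 \<bullet> ws ! j) = \<alpha>" using s1 s0 b1 b2 le(1) by linarith
    then have "ms ! 0 \<bullet> ws ! j = 1" using j by simp
    then have "j = Suc 0 mod ?r" using F(5)[OF r0 j(2)] j(1) by auto
    then show False using \<open>?n = 0\<close> F(1) by (auto simp: mod_Suc split: if_splits)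
  qed
  show ?thesis using angular_fan_exists[of ?r "\<lambda>i. tangent a b (ws ! i)"] F(1) left once that by fastforce
qed

lemma fan_cover:
  assumes v: "v \<in> P" and fan: "corner_fan P N v ws ms"
  shows "\<exists>i \<gamma> \<alpha> \<beta>. i < length ws \<and> 0 \<le> \<alpha> \<and> 0 \<le> \<beta> \<and>
    x = \<gamma> *\<^sub>R v + \<alpha> *\<^sub>R ws ! i + \<beta> *\<^sub>R ws ! (Suc i mod length ws)"
proof -
  have v0: "v \<noteq> 0" using P_nonzero[OF v] .
  obtain a b where fr: "frame (sgn v) a b" using frame_exists[of "sgn v"] v0 by (auto simp: norm_sgn)
  obtain \<theta> where "angular_fan (length ws) (\<lambda>i. tangent a b (ws ! i)) \<theta>"
    using tangent_fan_exists[OF v fan fr] .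
  from angular_fan_cover[OF this, of "tangent a b x"]
  obtain i \<alpha> \<beta> where i: "i < length ws" "0 \<le> \<alpha>" "0 \<le> \<beta>"
    "tangent a b x = of_real \<alpha> * tangent a b (ws ! i) + of_real \<beta> * tangent a b (ws ! (Suc i mod length ws))"
    by metis
  then show ?thesis using tangent_eq_lift[OF fr v0 i(4)] by metis
qed

text \<open>
  The optimality criterion for the whole polytope. Each point \<open>x\<close> of the polytope has
  the form \<open>\<gamma> v + \<alpha> w + \<beta> w'\<close> with neighbours \<open>w\<close>,
  \<open>w'\<close> and \<open>\<alpha>, \<beta> \<ge> 0\<close>, and the facet that contains
  \<open>v\<close>, \<open>w\<close>, \<open>w'\<close> bounds \<open>\<gamma> + \<alpha> +
  \<beta>\<close> by 1. This gives the claim as soon as \<open>c \<bullet> v\<close> is nonnegative.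
\<close>

lemma local_maximum_global:
  assumes v: "v \<in> P" and loc: "\<And>w. adj v w \<Longrightarrow> c \<bullet> w \<le> c \<bullet> v" and x: "x \<in> P"
  shows "c \<bullet> x \<le> c \<bullet> v"
proof -
  obtain ws ms where fan: "corner_fan P N v ws ms" using fan_exists v by blast
  note F = fanD[OF fan]
  let ?r = "length ws"
  let ?n = "\<lambda>i. Suc i mod ?r"
  have n: "?n i < ?r" if "i < ?r" for i using that by (cases ?r) auto
  have cw: "c \<bullet> ws ! i \<le> c \<bullet> v" if "i < ?r" for i
    using loc neighbours_in_fan[OF v fan] that nth_mem by blast
  have sum: "ms ! i \<bullet> y = \<gamma> + \<alpha> + \<beta>" "c \<bullet> y \<le> (\<gamma> + \<alpha> + \<beta>) * (c \<bullet> v)"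
    if y: "y = \<gamma> *\<^sub>R v + \<alpha> *\<^sub>R ws ! i + \<beta> *\<^sub>R ws ! ?n i" and i: "i < ?r" "0 \<le> \<alpha>" "0 \<le> \<beta>" for i y \<gamma> \<alpha> \<beta>
  proof -
    have "ms ! i \<bullet> ws ! i = 1" "ms ! i \<bullet> ws ! ?n i = 1" using F(5)[OF i(1,1)] F(5)[OF i(1) n[OF i(1)]] by auto
    then show "ms ! i \<bullet> y = \<gamma> + \<alpha> + \<beta>" using y F(7)[OF i(1)] by (simp add: inner_add_right)
    have "\<alpha> * (c \<bullet> ws ! i) \<le> \<alpha> * (c \<bullet> v)" "\<beta> * (c \<bullet> ws ! ?n i) \<le> \<beta> * (c \<bullet> v)"
      using cw[OF i(1)] cw[OF n[OF i(1)]] i by (simp_all add: mult_left_mono)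
    then show "c \<bullet> y \<le> (\<gamma> + \<alpha> + \<beta>) * (c \<bullet> v)" unfolding y by (simp add: inner_add_right distrib_right)
  qed
  have r0: "0 < ?r" using F(1) by linarith
  \<comment> \<open>Some sector contains \<open>- ws ! 0\<close>, so \<open>- v\<close> is, up to a positive factor, a nonnegative
    combination of the differences \<open>w - v\<close> of neighbours; these do not increase \<open>c\<close>.\<close>
  have nonneg: "0 \<le> c \<bullet> v"
  proof -
    obtain i \<gamma> \<alpha> \<beta> where i: "i < ?r" "0 \<le> \<alpha>" "0 \<le> \<beta>"
      and e: "- (ws ! 0) = \<gamma> *\<^sub>R v + \<alpha> *\<^sub>R ws ! i + \<beta> *\<^sub>R ws ! ?n i"
      using fan_cover[OF v fan, of "- (ws ! 0)"] by blast
    note s = sum[OF e i]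
    have "- (c \<bullet> v) \<le> c \<bullet> (- (ws ! 0))" using cw[OF r0] by simp
    then have 1: "0 \<le> (1 + (\<gamma> + \<alpha> + \<beta>)) * (c \<bullet> v)" using s(2) by (simp add: algebra_simps)
    have "ms ! i \<bullet> ws ! 0 \<noteq> 1"
    proof
      assume "ms ! i \<bullet> ws ! 0 = 1"
      then have "i = 0 \<or> ?n i = 0" using F(5)[OF i(1) r0] by auto
      moreover have "v \<bullet> cross3 (ws ! 0) (ws ! ?n 0) = 0" if "i = 0"
      proof -
        have "(1 + \<alpha>) * (v \<bullet> cross3 (ws ! 0) (ws ! ?n 0)) = v \<bullet> cross3 ((1 + \<alpha>) *\<^sub>R ws ! 0) (ws ! ?n 0)"
          by (simp add: cross_mult_left)
        also have "(1 + \<alpha>) *\<^sub>R ws ! 0 = \<alpha> *\<^sub>R ws ! 0 - (- (ws ! 0))"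
          by (simp add: scaleR_left_distrib)
        also have "\<dots> = - (\<gamma> *\<^sub>R v) - \<beta> *\<^sub>R ws ! ?n 0"
          unfolding e that by simp
        also have "v \<bullet> cross3 (- (\<gamma> *\<^sub>R v) - \<beta> *\<^sub>R ws ! ?n 0) (ws ! ?n 0) = 0"
          by (rule cross3_coplanar(1))
        finally show ?thesis using i by simp
      qed
      moreover have "v \<bullet> cross3 (ws ! i) (ws ! ?n i) = 0" if "?n i = 0"
      proof -
        have "(1 + \<beta>) * (v \<bullet> cross3 (ws ! i) (ws ! ?n i)) = v \<bullet> cross3 (ws ! i) ((1 + \<beta>) *\<^sub>R ws ! 0)"
          using that by (simp add: cross_mult_right)
        also have "(1 + \<beta>) *\<^sub>R ws ! 0 = \<beta> *\<^sub>R ws ! 0 - (- (ws ! 0))"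
          by (simp add: scaleR_left_distrib)
        also have "\<dots> = - (\<gamma> *\<^sub>R v) - \<alpha> *\<^sub>R ws ! i"
          unfolding e that by simp
        also have "v \<bullet> cross3 (ws ! i) (- (\<gamma> *\<^sub>R v) - \<alpha> *\<^sub>R ws ! i) = 0"
          by (rule cross3_coplanar(2))
        finally show ?thesis using i by simp
      qed
      ultimately show False using F(6)[OF r0] F(6)[OF i(1)] by auto
    qed
    then have "ms ! i \<bullet> ws ! 0 < 1" using lt_one F(7)[OF r0] F(7)[OF i(1)] by blast
    then have "0 < 1 + (\<gamma> + \<alpha> + \<beta>)" using s(1) by simp
    then show ?thesis using 1 by (simp add: zero_le_mult_iff)
  qed
  obtain i \<gamma> \<alpha> \<beta> where i: "i < ?r" "0 \<le> \<alpha>" "0 \<le> \<beta>"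
    and e: "x = \<gamma> *\<^sub>R v + \<alpha> *\<^sub>R ws ! i + \<beta> *\<^sub>R ws ! ?n i"
    using fan_cover[OF v fan, of x] by blast
  note s = sum[OF e i]
  have "\<gamma> + \<alpha> + \<beta> \<le> 1" using s(1) le_one[OF x] F(7)[OF i(1)] by metis
  then have "(\<gamma> + \<alpha> + \<beta>) * (c \<bullet> v) \<le> c \<bullet> v" using nonneg mult_right_mono[of "\<gamma> + \<alpha> + \<beta>" 1 "c \<bullet> v"] by simp
  then show ?thesis using s(2) by simp
qed

text \<open>
  Walk to a neighbour with a larger value of a linear form that is maximal only at the target
  \<open>t\<close>: such a form is the sum of the facets at \<open>t\<close>, and the walk can only
  stop at \<open>t\<close>.
\<close>

lemma adj_connected:
  assumes "s \<in> P" "t \<in> P" shows "adj\<^sup>*\<^sup>* s t"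
proof (rule ccontr)
  assume no: "\<not> adj\<^sup>*\<^sup>* s t"
  let ?A = "{v \<in> P. adj\<^sup>*\<^sup>* s v}" and ?F = "{m \<in> N. m \<bullet> t = 1}"
  define c where "c = \<Sum> ?F"
  have "finite ?A" "?A \<noteq> {}" using finite_P assms(1) by auto
  then obtain v where v: "v \<in> ?A" "\<forall>u\<in>?A. c \<bullet> u \<le> c \<bullet> v"
    using Max_in[of "(\<bullet>) c ` ?A"] Max_ge[of "(\<bullet>) c ` ?A"] by fastforce
  have "c \<bullet> w \<le> c \<bullet> v" if "adj v w" for w
    using that v rtranclp.rtrancl_into_rtrancl[of adj s v w] unfolding adj_def by blast
  then have le: "c \<bullet> t \<le> c \<bullet> v" using local_maximum_global v(1) assms(2) by blast
  have finF: "finite ?F" using finite_N by simp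
  have "c \<bullet> x = (\<Sum>m\<in>?F. m \<bullet> x)" for x unfolding c_def by (simp add: inner_sum_left)
  then have "(\<Sum>m\<in>?F. 1 - m \<bullet> v) \<le> (\<Sum>m\<in>?F. 1 - m \<bullet> t)" using le by (simp add: sum_subtractf)
  also have "\<dots> = 0" by simp
  finally have "(\<Sum>m\<in>?F. 1 - m \<bullet> v) = 0"
    using sum_nonneg[of ?F "\<lambda>m. 1 - m \<bullet> v"] le_one v(1) by fastforce
  then have "\<forall>m\<in>?F. 1 - m \<bullet> v = 0"
    using sum_nonneg_eq_0_iff[OF finF, of "\<lambda>m. 1 - m \<bullet> v"] le_one v(1) by fastforce
  then have "v = t" using extreme[OF assms(2), of v] by simp
  then show False using no v(1) by simp
qed

lemma connected_graph: "connected (graph_points vset eset)"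
proof -
  let ?G = "graph_points vset eset"
  have edge: "connected_component ?G x y" if vw: "adj v w" "x \<in> great_arc v w" "y \<in> great_arc v w" for v w x y
  proof -
    obtain g where "arc g" "path_image g = great_arc v w" using great_arc_is_arc[OF vw(1)] by metis
    then have "connected (great_arc v w)" using connected_arc_image by metis
    moreover have "great_arc v w \<subseteq> ?G" unfolding graph_points_eq using vw(1) eset_def by blast
    ultimately show ?thesis using vw unfolding connected_component_def by blast
  qed
  have ends: "sgn v \<in> great_arc v w" "sgn w \<in> great_arc v w" if "adj v w" for v w
    using great_arc_vertices[OF that] that unfolding adj_def by auto
  obtain s where s: "s \<in> P" using P_nonempty by blast
  have vert: "adj\<^sup>*\<^sup>* s t \<Longrightarrow> connected_component ?G (sgn s) (sgn t)" for t
  proof (induction rule: rtranclp_induct)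
    case base
    show ?case using s unfolding graph_points_def vset_def by simp
  next
    case (step y z)
    then show ?case using edge ends connected_component_trans by blast
  qed
  have "connected_component ?G (sgn s) x" if x: "x \<in> ?G" for x
  proof -
    have "x \<in> \<Union>eset" using x graph_points_eq by simp
    then obtain v w where vw: "adj v w" "x \<in> great_arc v w" unfolding eset_def by auto
    then have "connected_component ?G (sgn v) x" using edge ends by blast
    moreover have "connected_component ?G (sgn s) (sgn v)"
      using vert adj_connected s vw(1) unfolding adj_def by blast
    ultimately show ?thesis using connected_component_trans by blast
  qed
  then show ?thesis
    unfolding connected_iff_connected_component
    by (meson connected_component_sym connected_component_trans)
qed

theorem polyhedral: "polyhedral_map vset eset"
  unfolding polyhedral_map_def
proof (intro conjI ballI)
  fix v assume "v \<in> vset"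
  then show "3 \<le> vertex_degree eset v" using vertex_degree_ge unfolding vset_def by auto
next
  fix F assume "F \<in> faces vset eset"
  then show "3 \<le> face_degree eset F" using face_degree_ge unfolding faces_eq by auto
qed (use embedded connected_graph two_faces in auto)

end

text \<open>
  Central projection from the centre of the sphere to the tangent plane at \<open>u\<close> takes
  great circles to lines, so it makes the edges at a vertex straight. A small disc in the tangent
  plane, scaled to radius 1, gives the chart.
\<close>

definition tangent_point :: "real^3 \<Rightarrow> real^3 \<Rightarrow> real^3 \<Rightarrow> complex \<Rightarrow> real^3" where
  "tangent_point u a b z = u + Re z *\<^sub>R a + Im z *\<^sub>R b"

lemma tangent_point_simps:
  assumes "frame u a b"
  shows "tangent a b (tangent_point u a b z) = z" "u \<bullet> tangent_point u a b z = 1" "tangent a b u = 0"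
  using assms unfolding frame_def tangent_def tangent_point_def
  by (simp_all add: inner_add_right inner_commute complex_eq_iff)

definition cap :: "real^3 \<Rightarrow> real^3 \<Rightarrow> real^3 \<Rightarrow> real \<Rightarrow> (real^3) set" where
  "cap u a b \<epsilon> = {x \<in> S2. 0 < u \<bullet> x \<and> norm (tangent a b x) < \<epsilon> * (u \<bullet> x)}"

definition cap_chart :: "real^3 \<Rightarrow> real^3 \<Rightarrow> real^3 \<Rightarrow> real \<Rightarrow> real^3 \<Rightarrow> complex" where
  "cap_chart u a b \<epsilon> x = tangent a b x / of_real (\<epsilon> * (u \<bullet> x))"

definition cap_point :: "real^3 \<Rightarrow> real^3 \<Rightarrow> real^3 \<Rightarrow> real \<Rightarrow> complex \<Rightarrow> real^3" where
  "cap_point u a b \<epsilon> z = sgn (tangent_point u a b (of_real \<epsilon> * z))"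

lemma continuous_on_tangent: "continuous_on S (tangent a b)"
proof -
  have "tangent a b = (\<lambda>x. of_real (a \<bullet> x) + \<i> * of_real (b \<bullet> x))"
    unfolding tangent_def by (simp add: fun_eq_iff complex_eq_iff)
  then show ?thesis by (simp add: continuous_intros)
qed

lemma continuous_on_tangent_point: "continuous_on S (tangent_point u a b)"
  unfolding tangent_point_def by (intro continuous_intros)

lemma tangent_point_nonzero: "frame u a b \<Longrightarrow> tangent_point u a b z \<noteq> 0"
  using tangent_point_simps(2) by (metis inner_zero_right zero_neq_one)

context
  fixes u a b :: "real^3" and \<epsilon> :: real
  assumes fr: "frame u a b" and \<epsilon>: "0 < \<epsilon>"
begin

lemma cap_open: "openin (top_of_set S2) (cap u a b \<epsilon>)"
proof -
  have "open ({x. 0 < u \<bullet> x} \<inter> {x. norm (tangent a b x) < \<epsilon> * (u \<bullet> x)})"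
    by (intro open_Int open_Collect_less continuous_intros continuous_on_tangent)
  moreover have "cap u a b \<epsilon> = S2 \<inter> ({x. 0 < u \<bullet> x} \<inter> {x. norm (tangent a b x) < \<epsilon> * (u \<bullet> x)})"
    unfolding cap_def by auto
  ultimately show ?thesis unfolding openin_open by blast
qed

lemma cap_point_in:
  assumes "norm z < 1" shows "cap_point u a b \<epsilon> z \<in> cap u a b \<epsilon>" "cap_chart u a b \<epsilon> (cap_point u a b \<epsilon> z) = z"
proof -
  let ?y = "tangent_point u a b (of_real \<epsilon> * z)"
  have y0: "?y \<noteq> 0" using tangent_point_nonzero[OF fr] .
  have x: "cap_point u a b \<epsilon> z = (1 / norm ?y) *\<^sub>R ?y"
    unfolding cap_point_def by (simp add: sgn_div_norm divide_inverse)
  have ux: "u \<bullet> cap_point u a b \<epsilon> z = 1 / norm ?y" unfolding x using tangent_point_simps(2)[OF fr] by simp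
  have tx: "tangent a b (cap_point u a b \<epsilon> z) = of_real (\<epsilon> / norm ?y) * z"
    unfolding x tangent_linear tangent_point_simps(1)[OF fr] by simp
  have "norm (tangent a b (cap_point u a b \<epsilon> z)) = \<epsilon> / norm ?y * norm z"
    unfolding tx using \<epsilon> by (simp add: norm_mult norm_divide)
  also have "\<dots> < \<epsilon> / norm ?y" using assms \<epsilon> y0 by (simp add: divide_strict_right_mono)
  finally show "cap_point u a b \<epsilon> z \<in> cap u a b \<epsilon>"
    unfolding cap_def using ux y0 sgn_in_S2[OF y0] by (simp add: cap_point_def)
  show "cap_chart u a b \<epsilon> (cap_point u a b \<epsilon> z) = z"
    unfolding cap_chart_def tx ux using \<epsilon> y0 by simp
qed

lemma cap_chart_in:
  assumes "x \<in> cap u a b \<epsilon>" shows "norm (cap_chart u a b \<epsilon> x) < 1" "cap_point u a b \<epsilon> (cap_chart u a b \<epsilon> x) = x"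
proof -
  have x: "0 < u \<bullet> x" "norm (tangent a b x) < \<epsilon> * (u \<bullet> x)" "norm x = 1" using assms unfolding cap_def by auto
  then have p: "0 < \<epsilon> * (u \<bullet> x)" using \<epsilon> by simp
  have "norm (cap_chart u a b \<epsilon> x) = norm (tangent a b x) / (\<epsilon> * (u \<bullet> x))"
    unfolding cap_chart_def norm_divide norm_of_real using p by simp
  then show "norm (cap_chart u a b \<epsilon> x) < 1" using x(2) p by simp
  have "of_real \<epsilon> * cap_chart u a b \<epsilon> x = of_real (1 / (u \<bullet> x)) * tangent a b x"
    unfolding cap_chart_def using \<epsilon> by simp
  then have "tangent_point u a b (of_real \<epsilon> * cap_chart u a b \<epsilon> x)
    = u + ((a \<bullet> x) / (u \<bullet> x)) *\<^sub>R a + ((b \<bullet> x) / (u \<bullet> x)) *\<^sub>R b"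
    unfolding tangent_point_def tangent_def by simp
  also have "\<dots> = (1 / (u \<bullet> x)) *\<^sub>R ((u \<bullet> x) *\<^sub>R u + (a \<bullet> x) *\<^sub>R a + (b \<bullet> x) *\<^sub>R b)"
    using x(1) by (simp add: scaleR_add_right)
  also have "(u \<bullet> x) *\<^sub>R u + (a \<bullet> x) *\<^sub>R a + (b \<bullet> x) *\<^sub>R b = x" using fr unfolding frame_def by metis
  finally show "cap_point u a b \<epsilon> (cap_chart u a b \<epsilon> x) = x"
    unfolding cap_point_def using x sgn_scale_pos[of "1 / (u \<bullet> x)" x] by (simp add: sgn_unit)
qed

lemma cap_homeomorphism:
  "homeomorphism (cap u a b \<epsilon>) (ball 0 1) (cap_chart u a b \<epsilon>) (cap_point u a b \<epsilon>)"
proof (rule homeomorphismI)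
  show "continuous_on (cap u a b \<epsilon>) (cap_chart u a b \<epsilon>)"
    unfolding cap_chart_def by (intro continuous_intros continuous_on_tangent) (use \<epsilon> cap_def in auto)
  have "continuous_on (ball 0 1) (\<lambda>z. tangent_point u a b (of_real \<epsilon> * z))"
    by (rule continuous_on_compose2[OF continuous_on_tangent_point[of UNIV]]) (auto intro!: continuous_intros)
  then show "continuous_on (ball 0 1) (cap_point u a b \<epsilon>)"
    unfolding cap_point_def sgn_div_norm
    by (intro continuous_intros) (use tangent_point_nonzero[OF fr] in auto)
qed (use cap_chart_in cap_point_in in auto)

lemma cap_centre: "u \<in> cap u a b \<epsilon>" "cap_chart u a b \<epsilon> u = 0"
proof -
  have "u \<bullet> u = 1" using fr unfolding frame_def by blast
  then show "u \<in> cap u a b \<epsilon>" "cap_chart u a b \<epsilon> u = 0"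
    unfolding cap_def cap_chart_def using tangent_point_simps(3)[OF fr] \<epsilon> by (simp_all add: norm_eq_1)
qed

end

context spherical_polytope begin

text \<open>
  The radius of the cap is chosen such that the facets away from \<open>v\<close> do not reach it
  and that each edge at \<open>v\<close> leaves it.
\<close>

lemma small_cap:
  assumes v: "v \<in> P" and fr: "frame (sgn v) a b" and ws: "\<And>i. i < r \<Longrightarrow> tangent a b (ws ! i) \<noteq> 0"
  obtains \<epsilon> where "0 < \<epsilon>"
    "\<And>\<xi> m m'. norm \<xi> < \<epsilon> \<Longrightarrow> m \<in> N \<Longrightarrow> m' \<in> N \<Longrightarrow> m \<bullet> v = 1 \<Longrightarrow> m' \<bullet> v < 1 \<Longrightarrow>
       m' \<bullet> tangent_point (sgn v) a b \<xi> < m \<bullet> tangent_point (sgn v) a b \<xi>"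
    "\<And>i. i < r \<Longrightarrow> \<epsilon> * \<bar>sgn v \<bullet> (ws ! i)\<bar> < norm (tangent a b (ws ! i))"
proof -
  let ?Y = "tangent_point (sgn v) a b"
  let ?Q = "{m' \<in> N. m' \<bullet> v < 1} \<times> {m \<in> N. m \<bullet> v = 1}"
  let ?W = "\<Inter>(m', m)\<in>?Q. {\<xi>. m' \<bullet> ?Y \<xi> < m \<bullet> ?Y \<xi>}"
  have "open ?W"
  proof (intro open_INT)
    show "finite ?Q" using finite_N by simp
    show "\<forall>p\<in>?Q. open (case p of (m', m) \<Rightarrow> {\<xi>. m' \<bullet> ?Y \<xi> < m \<bullet> ?Y \<xi>})"
      by (auto intro!: open_Collect_less continuous_intros continuous_on_tangent_point)
  qed
  moreover have "0 \<in> ?W"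
  proof -
    have "m' \<bullet> sgn v < m \<bullet> sgn v" if "m' \<bullet> v < 1" "m \<bullet> v = 1" for m m'
      using that P_nonzero[OF v] by (simp add: sgn_div_norm divide_strict_right_mono)
    then show ?thesis unfolding tangent_point_def by auto
  qed
  ultimately obtain e where e: "0 < e" "ball 0 e \<subseteq> ?W" by (meson open_contains_ball)
  have "eventually (\<lambda>t. t * \<bar>sgn v \<bullet> (ws ! i)\<bar> < norm (tangent a b (ws ! i))) (at_right 0)" if "i < r" for i
  proof -
    have "((\<lambda>t. t * \<bar>sgn v \<bullet> (ws ! i)\<bar>) \<longlongrightarrow> 0 * \<bar>sgn v \<bullet> (ws ! i)\<bar>) (at_right 0)"
      by (intro tendsto_intros)
    then show ?thesis using ws[OF that] by (intro order_tendstoD) auto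
  qed
  then have "eventually (\<lambda>t. \<forall>i\<in>{..<r}. t * \<bar>sgn v \<bullet> (ws ! i)\<bar> < norm (tangent a b (ws ! i))) (at_right 0)"
    by (intro eventually_ball_finite) auto
  moreover have "eventually (\<lambda>t. t \<in> {0<..<e}) (at_right 0)" using e(1) by (rule eventually_at_right_real)
  ultimately have "eventually (\<lambda>t. (\<forall>i\<in>{..<r}. t * \<bar>sgn v \<bullet> (ws ! i)\<bar> < norm (tangent a b (ws ! i))) \<and> t \<in> {0<..<e}) (at_right 0)"
    by (rule eventually_conj)
  then obtain \<epsilon> where \<epsilon>: "\<forall>i\<in>{..<r}. \<epsilon> * \<bar>sgn v \<bullet> (ws ! i)\<bar> < norm (tangent a b (ws ! i))" "\<epsilon> \<in> {0<..<e}"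
    using eventually_happens'[OF trivial_limit_at_right_real] by blast
  have "m' \<bullet> ?Y \<xi> < m \<bullet> ?Y \<xi>" if "norm \<xi> < \<epsilon>" "m \<in> N" "m' \<in> N" "m \<bullet> v = 1" "m' \<bullet> v < 1" for \<xi> m m'
  proof -
    have "\<xi> \<in> ball 0 e" using that(1) \<epsilon>(2) by simp
    then show ?thesis using e(2) that by blast
  qed
  then show ?thesis using that[of \<epsilon>] \<epsilon> by auto
qed

lemma going_around_vertex:
  assumes v: "v \<in> P" and fan: "corner_fan P N v ws ms"
  shows "going_around vset eset (sgn v) (map (great_arc v) ws) (map region ms)"
proof -
  let ?r = "length ws" and ?u = "sgn v"
  note F = fanD[OF fan]
  have v0: "v \<noteq> 0" using P_nonzero[OF v] .
  obtain a b where fr: "frame ?u a b" using frame_exists[of ?u] v0 by (auto simp: norm_sgn)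
  let ?\<omega> = "\<lambda>i. tangent a b (ws ! i)" and ?Y = "tangent_point ?u a b"
  obtain \<theta> where \<theta>: "angular_fan ?r ?\<omega> \<theta>" using tangent_fan_exists[OF v fan fr] .
  have \<omega>0: "?\<omega> i \<noteq> 0" and inc: "\<theta> i < \<theta> (Suc i)" "\<theta> (Suc i) < \<theta> i + pi" if "i < ?r" for i
    using \<theta> that unfolding angular_fan_def by blast+
  have full: "\<theta> ?r = \<theta> 0 + 2 * pi" using \<theta> unfolding angular_fan_def by blast
  have rep1: "?\<omega> i = of_real (norm (?\<omega> i)) * cis (\<theta> i)" if "i < ?r" for i
    using \<theta> that unfolding angular_fan_def by (metis less_imp_le mod_less)
  have rep2: "?\<omega> (Suc i mod ?r) = of_real (norm (?\<omega> (Suc i mod ?r))) * cis (\<theta> (Suc i))" if "i < ?r" for i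
    using \<theta> that unfolding angular_fan_def by (metis Suc_leI)
  obtain \<epsilon> where \<epsilon>: "0 < \<epsilon>"
    and near: "\<And>\<xi> m m'. norm \<xi> < \<epsilon> \<Longrightarrow> m \<in> N \<Longrightarrow> m' \<in> N \<Longrightarrow> m \<bullet> v = 1 \<Longrightarrow> m' \<bullet> v < 1 \<Longrightarrow>
       m' \<bullet> ?Y \<xi> < m \<bullet> ?Y \<xi>"
    and short: "\<And>i. i < ?r \<Longrightarrow> \<epsilon> * \<bar>?u \<bullet> (ws ! i)\<bar> < norm (?\<omega> i)"
    using small_cap[OF v fr \<omega>0] by metis
  define U where "U = cap ?u a b \<epsilon>"
  define h where "h = cap_chart ?u a b \<epsilon>"
  define k where "k = cap_point ?u a b \<epsilon>"
  have kU: "k z \<in> U" "h (k z) = z" if "norm z < 1" for z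
    using cap_point_in[OF fr \<epsilon> that] unfolding U_def h_def k_def by auto
  have hU: "norm (h x) < 1" if "x \<in> U" for x
    using cap_chart_in(1)[OF fr \<epsilon>] that unfolding U_def h_def by auto
  have Y0: "?Y z \<noteq> 0" for z using tangent_point_nonzero[OF fr] .
  have edge: "h ` (U \<inter> great_arc v (ws ! i)) = radius_at (\<theta> i)" if i: "i < ?r" for i
  proof (intro set_eqI iffI)
    fix z assume "z \<in> h ` (U \<inter> great_arc v (ws ! i))"
    then obtain x where x: "x \<in> U" "x \<in> great_arc v (ws ! i)" "z = h x" by auto
    then obtain c d where cd: "x = c *\<^sub>R v + d *\<^sub>R ws ! i" "0 \<le> c" "0 \<le> d"
      unfolding great_arc_def cone2_def by auto
    have "tangent a b v = 0" using tangent_point_simps(3)[OF fr] tangent_linear(2)[of a b "norm v" ?u]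
      by (simp add: scale_sgn)
    then have t: "tangent a b x = of_real d * ?\<omega> i" unfolding cd(1) tangent_linear by simp
    have ux: "0 < ?u \<bullet> x" using x(1) unfolding U_def cap_def by simp
    let ?s = "d * norm (?\<omega> i) / (\<epsilon> * (?u \<bullet> x))"
    have "z = of_real (d / (\<epsilon> * (?u \<bullet> x))) * ?\<omega> i" unfolding x(3) h_def cap_chart_def t by simp
    also have "\<dots> = of_real (d / (\<epsilon> * (?u \<bullet> x))) * (of_real (norm (?\<omega> i)) * cis (\<theta> i))"
      using rep1[OF i] by metis
    finally have z: "z = of_real ?s * cis (\<theta> i)" by simp
    have s0: "0 \<le> ?s" using cd(3) ux \<epsilon> by simp
    have "norm z = \<bar>?s\<bar>" unfolding z norm_mult norm_of_real by simp
    then have "norm z = ?s" using s0 by (metis abs_of_nonneg)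
    then have "?s < 1" using hU[OF x(1)] x(3) by simp
    then show "z \<in> radius_at (\<theta> i)" unfolding radius_at_def using z s0 by blast
  next
    fix z assume "z \<in> radius_at (\<theta> i)"
    then obtain s where s: "z = of_real s * cis (\<theta> i)" "0 \<le> s" "s < 1" unfolding radius_at_def by auto
    then have z: "norm z < 1" by (simp add: norm_mult)
    define y where "y = ?Y (of_real \<epsilon> * z)"
    define d where "d = s * \<epsilon> / norm (?\<omega> i)"
    have n0: "norm (?\<omega> i) \<noteq> 0" using \<omega>0[OF i] by simp
    have "of_real d * ?\<omega> i = of_real d * (of_real (norm (?\<omega> i)) * cis (\<theta> i))" using rep1[OF i] by metis
    also have "\<dots> = of_real (d * norm (?\<omega> i)) * cis (\<theta> i)" by simp
    also have "d * norm (?\<omega> i) = s * \<epsilon>" unfolding d_def using n0 by simp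
    finally have "tangent a b y = of_real d * ?\<omega> i + of_real 0 * ?\<omega> i"
      unfolding y_def tangent_point_simps(1)[OF fr] s(1) by (simp add: mult.commute mult.left_commute)
    then obtain c where y: "y = c *\<^sub>R v + d *\<^sub>R ws ! i + 0 *\<^sub>R ws ! i" using tangent_eq_lift[OF fr v0] by blast
    have "0 \<le> d" unfolding d_def using s \<epsilon> by simp
    have "1 = ?u \<bullet> y" unfolding y_def using tangent_point_simps(2)[OF fr] by simp
    also have "\<dots> = c * (?u \<bullet> v) + d * (?u \<bullet> ws ! i)" unfolding y by (simp add: inner_add_right)
    finally have c1: "c * (?u \<bullet> v) = 1 - d * (?u \<bullet> ws ! i)" by simp
    have "d * (?u \<bullet> ws ! i) \<le> d * \<bar>?u \<bullet> ws ! i\<bar>" using \<open>0 \<le> d\<close> by (simp add: mult_left_mono)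
    also have "\<dots> = s * (\<epsilon> * \<bar>?u \<bullet> ws ! i\<bar>) / norm (?\<omega> i)" unfolding d_def by simp
    also have "\<dots> \<le> s * norm (?\<omega> i) / norm (?\<omega> i)"
      using short[OF i] s by (intro divide_right_mono mult_left_mono) auto
    also have "\<dots> < 1" using s n0 by simp
    finally have "0 < c * (?u \<bullet> v)" using c1 by simp
    moreover have "0 < ?u \<bullet> v" using v0 by (simp add: sgn_div_norm)
    ultimately have "0 \<le> c" by (simp add: zero_less_mult_iff)
    then have "y \<in> cone2 v (ws ! i)" unfolding cone2_def using y \<open>0 \<le> d\<close> by auto
    then have "k z \<in> great_arc v (ws ! i)"
      unfolding k_def cap_point_def great_arc_def y_def[symmetric]
      using sgn_cone2 sgn_in_S2 Y0 y_def by auto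
    then show "z \<in> h ` (U \<inter> great_arc v (ws ! i))" using kU[OF z] by force
  qed
  have sector: "sector_between (\<theta> i) (\<theta> (Suc i)) \<subseteq> h ` (U \<inter> region (ms ! i))" if i: "i < ?r" for i
  proof
    fix z assume "z \<in> sector_between (\<theta> i) (\<theta> (Suc i))"
    then obtain s x where s: "z = of_real s * cis x" "0 < s" "s < 1" "\<theta> i < x" "x < \<theta> (Suc i)"
      unfolding sector_between_def by auto
    let ?n = "Suc i mod ?r"
    have n: "?n < ?r" using i by (cases ?r) auto
    have z: "norm z < 1" using s by (simp add: norm_mult)
    define y where "y = ?Y (of_real \<epsilon> * z)"
    define c where "c = (\<epsilon> * s) * sin (\<theta> (Suc i) - x) / sin (\<theta> (Suc i) - \<theta> i) / norm (?\<omega> i)"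
    define d where "d = (\<epsilon> * s) * sin (x - \<theta> i) / sin (\<theta> (Suc i) - \<theta> i) / norm (?\<omega> ?n)"
    have "0 < sin (\<theta> (Suc i) - \<theta> i)" "0 < sin (\<theta> (Suc i) - x)" "0 < sin (x - \<theta> i)"
      using s inc[OF i] by (auto intro!: sin_gt_zero)
    then have cd: "0 < c" "0 < d" unfolding c_def d_def using s \<epsilon> \<omega>0[OF i] \<omega>0[OF n] by simp_all
    have "tangent a b y = of_real (\<epsilon> * s) * cis x" unfolding y_def tangent_point_simps(1)[OF fr] s(1) by simp
    also have "\<dots> = of_real c * ?\<omega> i + of_real d * ?\<omega> ?n" unfolding c_def d_def
      by (rule sector_coordinates[OF rep1[OF i] rep2[OF i] \<omega>0[OF i] \<omega>0[OF n] inc[OF i]])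
    finally obtain c' where y: "y = c' *\<^sub>R v + c *\<^sub>R ws ! i + d *\<^sub>R ws ! ?n" using tangent_eq_lift[OF fr v0] by blast
    obtain g1 g2 where "corner v (ms ! i) (ws ! i) (ws ! ?n) g1 g2" using fan_corner[OF fan i] .
    note cor = this[unfolded corner_def]
    \<comment> \<open>For facets at \<open>v\<close> the incidences decide; the others are excluded by the size of the cap.\<close>
    have "m \<bullet> y < ms ! i \<bullet> y" if m: "m \<in> N" "m \<noteq> ms ! i" for m
    proof (cases "m \<bullet> v = 1")
      case True
      have le: "m \<bullet> ws ! i \<le> 1" "m \<bullet> ws ! ?n \<le> 1" using le_one m cor by blast+
      have "m \<bullet> ws ! i \<noteq> 1 \<or> m \<bullet> ws ! ?n \<noteq> 1" using cor m True by (metis less_irrefl)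
      then have "m \<bullet> ws ! i < 1 \<or> m \<bullet> ws ! ?n < 1" using le by auto
      moreover have "c * (m \<bullet> ws ! i) \<le> c" "d * (m \<bullet> ws ! ?n) \<le> d" using le cd by (simp_all add: mult_left_le)
      moreover have "m \<bullet> ws ! i < 1 \<Longrightarrow> c * (m \<bullet> ws ! i) < c" "m \<bullet> ws ! ?n < 1 \<Longrightarrow> d * (m \<bullet> ws ! ?n) < d"
        using cd by simp_all
      ultimately have "c * (m \<bullet> ws ! i) + d * (m \<bullet> ws ! ?n) < c + d" by linarith
      then show ?thesis unfolding y using True cor by (simp add: inner_add_right)
    next
      case False
      have "norm (of_real \<epsilon> * z) < \<epsilon>" using z \<epsilon> by (simp add: norm_mult)
      then show ?thesis unfolding y_def using near m lt_one[OF v m(1) False] cor by blast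
    qed
    then have "y \<in> cell (ms ! i)" unfolding cell_def by blast
    then have "k z \<in> region (ms ! i)" using region_image cor unfolding k_def cap_point_def y_def by blast
    then show "z \<in> h ` (U \<inter> region (ms ! i))" using kU[OF z] by force
  qed
  have nth: "map (great_arc v) ws ! i = great_arc v (ws ! i)" "map region ms ! i = region (ms ! i)"
    if "i < ?r" for i using that F(2) by simp_all
  have ends: "\<theta> (length (map (great_arc v) ws)) = \<theta> 0 + 2 * pi" using full by simp
  have hom: "homeomorphism U (ball 0 1) h k" "openin (top_of_set S2) U" "?u \<in> U" "h ?u = 0"
    unfolding U_def h_def k_def
    using cap_homeomorphism[OF fr \<epsilon>] cap_open[OF fr \<epsilon>] cap_centre[OF fr \<epsilon>] by blast+
  have "\<exists>U h k \<theta>.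
        openin (top_of_set S2) U \<and> ?u \<in> U \<and>
        homeomorphism U (ball (0::complex) 1) h k \<and> h ?u = 0 \<and>
        (\<forall>i<length (map (great_arc v) ws). \<theta> i < \<theta> (Suc i)) \<and> \<theta> (length (map (great_arc v) ws)) = \<theta> 0 + 2 * pi \<and>
        (\<forall>i<length (map (great_arc v) ws). h ` (U \<inter> map (great_arc v) ws ! i) = radius_at (\<theta> i) \<and>
                       sector_between (\<theta> i) (\<theta> (Suc i)) \<subseteq> h ` (U \<inter> map region ms ! i))"
    by (rule exI[of _ U], rule exI[of _ h], rule exI[of _ k], rule exI[of _ \<theta>])
       (use hom ends inc edge sector nth in simp)
  moreover have "set (map region ms) \<subseteq> faces vset eset" unfolding faces_eq using F(4) by auto
  ultimately show ?thesis
    unfolding going_around_def using fan_edges[OF v fan] F(2) by simp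
qed

theorem degrees_around_vertex:
  assumes v: "v \<in> P" and fan: "corner_fan P N v ws ms"
  shows "degrees_around vset eset (sgn v) (map (\<lambda>m. card {u \<in> P. m \<bullet> u = 1}) ms)"
proof -
  have "map (face_degree eset) (map region ms) = map (\<lambda>m. card {u \<in> P. m \<bullet> u = 1}) ms"
    using face_degree_region fanD(4)[OF fan] by simp
  then show ?thesis unfolding degrees_around_def using going_around_vertex[OF assms] by metis
qed

end

theorem polytope_realises_symbol:
  assumes poly: "spherical_polytope P N"
    and sym: "\<And>v. v \<in> P \<Longrightarrow> \<exists>ws ms. corner_fan P N v ws ms \<and>
       same_cyclic ps (map (\<lambda>m. card {u \<in> P. m \<bullet> u = 1}) ms)"
  shows "\<exists>V E. archimedean V E \<and> vertex_symbol V E ps"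
proof -
  interpret spherical_polytope P N by (rule poly)
  have "vertex_symbol vset eset ps"
    unfolding vertex_symbol_def vset_def using sym degrees_around_vertex by (metis (no_types, lifting) imageE vset_def)
  then show ?thesis using polyhedral unfolding archimedean_def by blast
qed

section \<open>Rotational symmetry and integer certificates\<close>

text \<open>
  The condition on cross products excludes reflections, which would reverse the order of the facets
  around a vertex.
\<close>

definition rotational_symmetry :: "(real^3) set \<Rightarrow> (real^3) set \<Rightarrow> (real^3 \<Rightarrow> real^3) \<Rightarrow> bool" where
  "rotational_symmetry P N g \<longleftrightarrow> inj g \<and> (\<forall>x y. g x \<bullet> g y = x \<bullet> y) \<and>
     (\<forall>x y. cross3 (g x) (g y) = g (cross3 x y)) \<and> g ` P = P \<and> g ` N = N"

definition fan_with_symbol :: "(real^3) set \<Rightarrow> (real^3) set \<Rightarrow> nat list \<Rightarrow> real^3 \<Rightarrow> bool" where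
  "fan_with_symbol P N ps v \<longleftrightarrow> (\<exists>ws ms. corner_fan P N v ws ms \<and>
     same_cyclic ps (map (\<lambda>m. card {u \<in> P. m \<bullet> u = 1}) ms))"

lemma fan_with_symbol_rotate:
  assumes g: "rotational_symmetry P N g" and v: "fan_with_symbol P N ps v"
  shows "fan_with_symbol P N ps (g v)"
proof -
  have G: "inj g" "\<And>x y. g x \<bullet> g y = x \<bullet> y" "\<And>x y. cross3 (g x) (g y) = g (cross3 x y)"
    "g ` P = P" "g ` N = N" using g unfolding rotational_symmetry_def by auto
  obtain ws ms where fan: "corner_fan P N v ws ms"
    and ps: "same_cyclic ps (map (\<lambda>m. card {u \<in> P. m \<bullet> u = 1}) ms)"
    using v unfolding fan_with_symbol_def by blast
  have len: "3 \<le> length ws" "length ms = length ws" using fan unfolding corner_fan_def by auto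
  have "set (map g ms) = g ` {m \<in> N. m \<bullet> v = 1}" using fan unfolding corner_fan_def by simp
  also have "\<dots> = {m \<in> g ` N. m \<bullet> g v = 1}" using G(2) by auto
  finally have "set (map g ms) = {m \<in> N. m \<bullet> g v = 1}" unfolding G(5) .
  moreover have "set (map g ws) \<subseteq> P" using fan G(4) unfolding corner_fan_def by auto
  moreover have "Suc i mod length ws < length ws" if "i < length ws" for i using that by (cases "length ws") auto
  ultimately have fan': "corner_fan P N (g v) (map g ws) (map g ms)"
    using fan len unfolding corner_fan_def by (simp add: G(2,3))
  have card: "card {u \<in> P. g m \<bullet> u = 1} = card {u \<in> P. m \<bullet> u = 1}" for m
  proof -
    have "{u \<in> g ` P. g m \<bullet> u = 1} = g ` {u \<in> P. m \<bullet> u = 1}" using G(2) by auto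
    moreover have "inj_on g {u \<in> P. m \<bullet> u = 1}" using G(1) by (rule inj_on_subset) simp
    ultimately show ?thesis unfolding G(4) by (simp add: card_image)
  qed
  show ?thesis unfolding fan_with_symbol_def
    by (rule exI[of _ "map g ws"], rule exI[of _ "map g ms"]) (use fan' ps in \<open>simp add: card comp_def\<close>)
qed

theorem symbol_realised:
  assumes "finite P" "finite N" "P \<noteq> {}" "\<And>v m. v \<in> P \<Longrightarrow> m \<in> N \<Longrightarrow> m \<bullet> v \<le> 1"
    "\<And>m. m \<in> N \<Longrightarrow> \<exists>v\<in>P. m \<bullet> v = 1" "\<And>v. v \<in> P \<Longrightarrow> fan_with_symbol P N ps v"
  shows "\<exists>V E. archimedean V E \<and> vertex_symbol V E ps"
proof (rule polytope_realises_symbol)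
  show "spherical_polytope P N"
  proof
    fix v assume "v \<in> P"
    then show "\<exists>ws ms. corner_fan P N v ws ms" using assms(6) unfolding fan_with_symbol_def by meson
  qed (use assms(1-5) in auto)
  fix v assume "v \<in> P"
  then show "\<exists>ws ms. corner_fan P N v ws ms \<and> same_cyclic ps (map (\<lambda>m. card {u \<in> P. m \<bullet> u = 1}) ms)"
    using assms(6) unfolding fan_with_symbol_def by meson
qed

type_synonym ivec = "int \<times> int \<times> int"

fun idot :: "ivec \<Rightarrow> ivec \<Rightarrow> int" where
  "idot (a, b, c) (x, y, z) = a * x + b * y + c * z"

fun icross :: "ivec \<Rightarrow> ivec \<Rightarrow> ivec" where
  "icross (a, b, c) (x, y, z) = (b * z - c * y, c * x - a * z, a * y - b * x)"

fun iturn :: "ivec \<Rightarrow> ivec" where "iturn (x, y, z) = (y, z, x)"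

fun iflip :: "ivec \<Rightarrow> ivec" where "iflip (x, y, z) = (x, - y, - z)"

text \<open>
  The rotation group of the regular tetrahedron, of order 12, acts by the cyclic permutations of the
  coordinates and by even numbers of sign changes.
\<close>

fun orbit :: "ivec \<Rightarrow> ivec list" where
  "orbit (x, y, z) = 
    [(x, y, z), (x, -y, -z), (-x, y, -z), (-x, -y, z),
     (y, z, x), (y, -z, -x), (-y, z, -x), (-y, -z, x),
     (z, x, y), (z, -x, -y), (-z, x, -y), (-z, -x, y)]"

type_synonym iplane = "ivec \<times> int"

definition orbit_points :: "(ivec \<times> ivec list \<times> iplane list) list \<Rightarrow> ivec list" where
  "orbit_points vs = remdups (concat (map (\<lambda>(v, ws, ms). orbit v) vs))"

definition orbit_planes :: "iplane list \<Rightarrow> iplane list" where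
  "orbit_planes fs = remdups (concat (map (\<lambda>(n, c). map (\<lambda>m. (m, c)) (orbit n)) fs))"

definition on_plane :: "iplane \<Rightarrow> ivec \<Rightarrow> bool" where
  "on_plane f v \<longleftrightarrow> idot (fst f) v = snd f"

definition certified_vertex ::
  "nat list \<Rightarrow> ivec list \<Rightarrow> iplane list \<Rightarrow> ivec \<Rightarrow> ivec list \<Rightarrow> iplane list \<Rightarrow> bool" where
  "certified_vertex ps P N v ws ms \<longleftrightarrow>
     list_all (\<lambda>(n, c). idot n v \<le> c) N \<and>
     (let r = length ws; ds = map (\<lambda>f. length (filter (on_plane f) P)) ms; fs = filter (\<lambda>f. on_plane f v) N in
       3 \<le> r \<and> length ms = r \<and> list_all (\<lambda>w. w \<in> set P) ws \<and>
       list_all (\<lambda>m. m \<in> set fs) ms \<and> list_all (\<lambda>m. m \<in> set ms) fs \<and>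
       list_all (\<lambda>i. list_all (\<lambda>j. on_plane (ms ! i) (ws ! j) \<longleftrightarrow> j = i \<or> j = Suc i mod r) [0..<r]) [0..<r] \<and>
       list_all (\<lambda>i. 0 < idot v (icross (ws ! i) (ws ! (Suc i mod r)))) [0..<r] \<and>
       (ds = ps \<or> ds = rev ps))"

text \<open>
  A polytope that is invariant under the rotation group of the tetrahedron is given by one vertex in
  each orbit, with its neighbours and its facets in their cyclic order, and by one plane \<open>n
  \<bullet> x = c\<close> for each orbit of facets. All conditions are finitely many comparisons of
  integers.
\<close>

definition polytope_certificate ::
  "nat list \<Rightarrow> (ivec \<times> ivec list \<times> iplane list) list \<Rightarrow> iplane list \<Rightarrow> bool" where
  "polytope_certificate ps vs fs \<longleftrightarrow> vs \<noteq> [] \<and>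
     (let P = orbit_points vs; N = orbit_planes fs in
       list_all (\<lambda>f. 0 < snd f \<and> list_ex (on_plane f) P) fs \<and>
       list_all (\<lambda>(v, ws, ms). certified_vertex ps P N v ws ms) vs)"

lemma set_orbit_points: "set (orbit_points vs) = (\<Union>p\<in>set vs. set (orbit (fst p)))"
  unfolding orbit_points_def by auto

lemma set_orbit_planes: "set (orbit_planes fs) = (\<Union>f\<in>set fs. (\<lambda>m. (m, snd f)) ` set (orbit (fst f)))"
  unfolding orbit_planes_def by auto

lemma orbit_invariant: "iturn ` set (orbit v) = set (orbit v)" "iflip ` set (orbit v) = set (orbit v)"
  by (cases v; auto)+

text \<open>
  The tetrahedral rotations are generated by one rotation of order 3 and one half-turn.
\<close>

lemma orbit_induct:
  assumes "Q v" "\<And>u. Q u \<Longrightarrow> Q (iturn u)" "\<And>u. Q u \<Longrightarrow> Q (iflip u)" "w \<in> set (orbit v)"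
  shows "Q w"
proof -
  obtain x y z where v: "v = (x, y, z)" by (cases v) auto
  have turn: "Q (y, z, x)" if "Q (x, y, z)" for x y z using assms(2)[OF that] by simp
  have flip: "Q (x, -y, -z)" if "Q (x, y, z)" for x y z using assms(3)[OF that] by simp
  \<comment> \<open>The half-turns about the other two axes are conjugates of the given one by the rotation of order 3.\<close>
  have quad: "Q (x, y, z) \<and> Q (x, -y, -z) \<and> Q (-x, y, -z) \<and> Q (-x, -y, z)" if "Q (x, y, z)" for x y z
    using that flip turn[OF flip[OF turn[OF turn]]] turn[OF turn[OF flip[OF turn]]] by blast
  show ?thesis using assms(4) quad[of x y z] quad[of y z x] quad[of z x y] assms(1) turn
    unfolding v by auto
qed

fun rvec :: "ivec \<Rightarrow> real^3" where
  "rvec (x, y, z) = vector [of_int x, of_int y, of_int z]"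

definition rfacet :: "iplane \<Rightarrow> real^3" where
  "rfacet f = (1 / of_int (snd f)) *\<^sub>R rvec (fst f)"

definition turn :: "real^3 \<Rightarrow> real^3" where "turn x = vector [x $ 2, x $ 3, x $ 1]"

definition flip :: "real^3 \<Rightarrow> real^3" where "flip x = vector [x $ 1, - x $ 2, - x $ 3]"

lemma rvec_inner: "rvec u \<bullet> rvec v = of_int (idot u v)"
  by (cases u; cases v) (simp add: inner_vec_def sum_3 vector_3)

lemma rvec_cross: "cross3 (rvec u) (rvec v) = rvec (icross u v)"
  by (cases u; cases v) (simp add: cross3_def vector_3)

lemma inj_rvec: "inj rvec"
proof (rule injI)
  fix u v assume "rvec u = rvec v"
  then show "u = v" by (cases u; cases v) (simp add: vec_eq_iff forall_3 vector_3)
qed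

lemma turn_flip_rvec: "turn (rvec v) = rvec (iturn v)" "flip (rvec v) = rvec (iflip v)"
  by (cases v; simp add: turn_def flip_def vector_3)+

lemma turn_flip_rfacet:
  "turn (rfacet (n, c)) = rfacet (iturn n, c)" "flip (rfacet (n, c)) = rfacet (iflip n, c)"
  by (cases n; simp add: rfacet_def turn_def flip_def vec_eq_iff forall_3 vector_3)+

lemma rfacet_inner:
  assumes "0 < snd f"
  shows "rfacet f \<bullet> rvec v = 1 \<longleftrightarrow> on_plane f v" "rfacet f \<bullet> rvec v \<le> 1 \<longleftrightarrow> idot (fst f) v \<le> snd f"
proof -
  have e: "rfacet f \<bullet> rvec v = of_int (idot (fst f) v) / of_int (snd f)"
    unfolding rfacet_def by (simp add: rvec_inner)
  show "rfacet f \<bullet> rvec v = 1 \<longleftrightarrow> on_plane f v" unfolding e on_plane_def using assms by auto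
  show "rfacet f \<bullet> rvec v \<le> 1 \<longleftrightarrow> idot (fst f) v \<le> snd f" unfolding e using assms by simp
qed

lemma turn_flip_isometry:
  "inj turn" "turn x \<bullet> turn y = x \<bullet> y" "cross3 (turn x) (turn y) = turn (cross3 x y)"
  "inj flip" "flip x \<bullet> flip y = x \<bullet> y" "cross3 (flip x) (flip y) = flip (cross3 x y)"
  unfolding turn_def flip_def inj_def
  by (simp_all add: vec_eq_iff forall_3 vector_3 inner_vec_def sum_3 cross3_def)

lemma turn_flip_symmetry:
  assumes "P = rvec ` set (orbit_points vs)" "N = rfacet ` set (orbit_planes fs)"
  shows "rotational_symmetry P N turn" "rotational_symmetry P N flip"
proof -
  have "iturn ` set (orbit_points vs) = set (orbit_points vs)" "iflip ` set (orbit_points vs) = set (orbit_points vs)"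
    unfolding set_orbit_points image_UN orbit_invariant by (rule refl)+
  moreover have "turn ` rvec ` S = rvec ` iturn ` S" "flip ` rvec ` S = rvec ` iflip ` S" for S
    by (simp_all add: image_image turn_flip_rvec)
  ultimately have P: "turn ` P = P" "flip ` P = P" unfolding assms(1) by simp_all
  have im: "(\<lambda>p. (g (fst p), snd p)) ` (\<lambda>m. (m, c)) ` S = (\<lambda>m. (m, c)) ` g ` S"
    for g :: "ivec \<Rightarrow> ivec" and c :: int and S
    by (simp add: image_image)
  have "(\<lambda>p. (iturn (fst p), snd p)) ` set (orbit_planes fs) = set (orbit_planes fs)"
    "(\<lambda>p. (iflip (fst p), snd p)) ` set (orbit_planes fs) = set (orbit_planes fs)"
    unfolding set_orbit_planes image_UN im orbit_invariant by (rule refl)+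
  moreover have "turn ` rfacet ` S = rfacet ` (\<lambda>p. (iturn (fst p), snd p)) ` S"
    "flip ` rfacet ` S = rfacet ` (\<lambda>p. (iflip (fst p), snd p)) ` S" for S
    unfolding image_image by (rule image_cong[OF refl], metis turn_flip_rfacet prod.collapse)+
  ultimately have N: "turn ` N = N" "flip ` N = N" unfolding assms(2) by simp_all
  show "rotational_symmetry P N turn" "rotational_symmetry P N flip"
    unfolding rotational_symmetry_def using turn_flip_isometry P N by blast+
qed

declare rvec.simps [simp del] idot.simps [simp del] icross.simps [simp del]

lemma certified_vertex_fan:
  assumes cert: "certified_vertex ps Pl Nl v ws ms" and pos: "\<And>f. f \<in> set Nl \<Longrightarrow> 0 < snd f"
    and "distinct Pl"
  defines "P \<equiv> rvec ` set Pl" and "N \<equiv> rfacet ` set Nl"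
  shows "fan_with_symbol P N ps (rvec v)" "\<And>m. m \<in> N \<Longrightarrow> m \<bullet> rvec v \<le> 1"
proof -
  let ?r = "length ws"
  note C = cert[unfolded certified_vertex_def Let_def list_all_iff]
  note D = conjunct2[OF C]
  note D2 = conjunct2[OF D] note D3 = conjunct2[OF D2] note D4 = conjunct2[OF D3]
  note D5 = conjunct2[OF D4] note D6 = conjunct2[OF D5] note D7 = conjunct2[OF D6]
  have c1: "idot (fst f) v \<le> snd f" if "f \<in> set Nl" for f
    using conjunct1[OF C] that by (cases f) auto
  have "set ms \<subseteq> {f \<in> set Nl. on_plane f v}" using conjunct1[OF D4] by auto
  moreover have "{f \<in> set Nl. on_plane f v} \<subseteq> set ms" using conjunct1[OF D5] by auto
  ultimately have c4: "set ms = {f \<in> set Nl. on_plane f v}" by (rule equalityI)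
  have c: "3 \<le> ?r" "length ms = ?r" using conjunct1[OF D] conjunct1[OF D2] by simp_all
  have c3: "set ws \<subseteq> set Pl" using conjunct1[OF D3] by auto
  have c6: "on_plane (ms ! i) (ws ! j) \<longleftrightarrow> j = i \<or> j = Suc i mod ?r" if "i < ?r" "j < ?r" for i j
    using conjunct1[OF D6] that by simp
  have c7: "0 < idot v (icross (ws ! i) (ws ! (Suc i mod ?r)))" if "i < ?r" for i
    using conjunct1[OF D7] that by simp
  note c8 = conjunct2[OF D7]
  show "m \<bullet> rvec v \<le> 1" if m: "m \<in> N" for m
  proof -
    obtain f where "f \<in> set Nl" "m = rfacet f" using m unfolding N_def by blast
    then show ?thesis using c1 rfacet_inner(2)[OF pos] by simp
  qed
  have n: "Suc i mod ?r < ?r" if "i < ?r" for i using that by (cases ?r) auto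
  have mspos: "0 < snd f" if "f \<in> set ms" for f using that pos c4 by auto
  have fan: "corner_fan P N (rvec v) (map rvec ws) (map rfacet ms)"
    unfolding corner_fan_def
  proof (intro conjI allI impI)
    show "set (map rfacet ms) = {m \<in> N. m \<bullet> rvec v = 1}"
      unfolding N_def set_map c4 using rfacet_inner(1)[OF pos] by blast
    show "set (map rvec ws) \<subseteq> P" unfolding P_def using c3 by auto
  next
    fix i j assume ij: "i < length (map rvec ws)" "j < length (map rvec ws)"
    then show "map rfacet ms ! i \<bullet> map rvec ws ! j = 1 \<longleftrightarrow> j = i \<or> j = Suc i mod length (map rvec ws)"
      using c(2) c6 rfacet_inner(1)[OF mspos] by simp
  next
    fix i assume i: "i < length (map rvec ws)"
    have "(0::real) < of_int (idot v (icross (ws ! i) (ws ! (Suc i mod ?r))))" using c7 i by simp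
    then show "0 < rvec v \<bullet> cross3 (map rvec ws ! i) (map rvec ws ! (Suc i mod length (map rvec ws)))"
      using i n by (simp add: rvec_cross rvec_inner)
  qed (use c(1,2) in auto)
  have "card {u \<in> P. rfacet f \<bullet> u = 1} = length (filter (on_plane f) Pl)" if "f \<in> set ms" for f
  proof -
    have "{u \<in> P. rfacet f \<bullet> u = 1} = rvec ` set (filter (on_plane f) Pl)"
      unfolding P_def set_filter using rfacet_inner(1)[OF mspos[OF that]] by blast
    moreover have "inj_on rvec (set (filter (on_plane f) Pl))" using inj_rvec inj_on_subset by blast
    ultimately have "card {u \<in> P. rfacet f \<bullet> u = 1} = card (set (filter (on_plane f) Pl))" by (simp only: card_image)
    also have "\<dots> = length (filter (on_plane f) Pl)" using assms(3) by (intro distinct_card) simp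
    finally show ?thesis .
  qed
  then have ds: "map (\<lambda>m. card {u \<in> P. m \<bullet> u = 1}) (map rfacet ms) = map (\<lambda>f. length (filter (on_plane f) Pl)) ms"
    by simp
  have "same_cyclic ps (map (\<lambda>f. length (filter (on_plane f) Pl)) ms)"
  proof -
    have "\<dots> = rotate 0 ps \<or> \<dots> = rotate 0 (rev ps)" using c8 by simp
    then show ?thesis unfolding same_cyclic_def by metis
  qed
  then show "fan_with_symbol P N ps (rvec v)"
    unfolding fan_with_symbol_def ds[symmetric] using fan by blast
qed

text \<open>
  A certificate describes the fan at one vertex in each orbit; rotations carry it to all vertices.
\<close>

theorem certificate_realises:
  assumes cert: "polytope_certificate ps vs fs"
  shows "\<exists>V E. archimedean V E \<and> vertex_symbol V E ps"
proof -
  define Pl Nl where "Pl = orbit_points vs" and "Nl = orbit_planes fs"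
  define P N where "P = rvec ` set Pl" and "N = rfacet ` set Nl"
  note C = cert[unfolded polytope_certificate_def Let_def list_all_iff list_ex_iff,
      folded Pl_def Nl_def]
  have vs: "vs \<noteq> []" using conjunct1[OF C] .
  have cf: "0 < snd f" "\<exists>v\<in>set Pl. on_plane f v" if "f \<in> set fs" for f
    using conjunct1[OF conjunct2[OF C]] that by blast+
  have cv: "certified_vertex ps Pl Nl v ws ms" if "(v, ws, ms) \<in> set vs" for v ws ms
    using conjunct2[OF conjunct2[OF C]] that by fastforce
  have pos: "0 < snd f" if "f \<in> set Nl" for f
    using that cf(1) unfolding Nl_def set_orbit_planes by fastforce
  have sym: "rotational_symmetry P N turn" "rotational_symmetry P N flip"
    using turn_flip_symmetry[OF P_def[unfolded Pl_def] N_def[unfolded Nl_def]] .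
  have dist: "distinct Pl" unfolding Pl_def orbit_points_def by simp
  have G: "g m \<bullet> g u = m \<bullet> u" "g ` P = P" "g ` N = N" if "rotational_symmetry P N g" for g m u
    using that unfolding rotational_symmetry_def by blast+
  let ?Q = "\<lambda>u. fan_with_symbol P N ps (rvec u) \<and> (\<forall>m\<in>N. m \<bullet> rvec u \<le> 1)"
  have step: "fan_with_symbol P N ps (g x) \<and> (\<forall>m\<in>N. m \<bullet> g x \<le> 1)"
    if "rotational_symmetry P N g" "fan_with_symbol P N ps x \<and> (\<forall>m\<in>N. m \<bullet> x \<le> 1)" for g x
  proof -
    have "\<forall>m\<in>g ` N. m \<bullet> g x \<le> 1" using that G(1)[OF that(1)] by auto
    then show ?thesis using fan_with_symbol_rotate[OF that(1)] that(2) G(3)[OF that(1)] by simp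
  qed
  have vertices: "?Q u" if u: "u \<in> set Pl" for u
  proof -
    obtain v ws ms where v: "(v, ws, ms) \<in> set vs" "u \<in> set (orbit v)"
      using u unfolding Pl_def set_orbit_points by (metis UN_E prod.collapse)
    have "?Q v" using certified_vertex_fan[OF cv[OF v(1)] pos dist] unfolding P_def N_def by blast
    moreover have "?Q (iturn w)" if "?Q w" for w using step[OF sym(1) that] by (simp add: turn_flip_rvec)
    moreover have "?Q (iflip w)" if "?Q w" for w using step[OF sym(2) that] by (simp add: turn_flip_rvec)
    ultimately show ?thesis using orbit_induct[of ?Q v u] v(2) by blast
  qed
  have facets: "\<exists>v\<in>P. m \<bullet> v = 1" if m: "m \<in> N" for m
  proof -
    obtain n c' n' where n: "(n, c') \<in> set fs" "n' \<in> set (orbit n)" "m = rfacet (n', c')"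
      using m unfolding N_def Nl_def set_orbit_planes by fastforce
    let ?R = "\<lambda>n. \<exists>v\<in>P. rfacet (n, c') \<bullet> v = 1"
    have "?R n" using cf(2)[OF n(1)] rfacet_inner(1)[of "(n, c')"] cf(1)[OF n(1)] unfolding P_def by auto
    moreover have "\<exists>v\<in>P. g x \<bullet> v = 1" if "rotational_symmetry P N g" "\<exists>v\<in>P. x \<bullet> v = 1" for g x
      using G(1,2)[OF that(1)] that(2) by (metis imageI)
    then have "?R (iturn w)" "?R (iflip w)" if "?R w" for w
      using sym that turn_flip_rfacet by metis+
    ultimately show ?thesis using orbit_induct[of ?R n n'] n(2,3) by blast
  qed
  show ?thesis
  proof (rule symbol_realised)
    show "finite P" "finite N" unfolding P_def N_def by simp_all
    obtain p where "p \<in> set vs" using vs by (meson last_in_set)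
    moreover have "fst p \<in> set (orbit (fst p))" by (cases p) auto
    ultimately have "fst p \<in> set Pl" unfolding Pl_def set_orbit_points by blast
    then show "P \<noteq> {}" unfolding P_def by auto
    show "m \<bullet> v \<le> 1" if "v \<in> P" "m \<in> N" for v m
      using that vertices unfolding P_def by (metis imageE)
    show "fan_with_symbol P N ps v" if "v \<in> P" for v
      using that vertices unfolding P_def by (metis imageE)
  qed (rule facets)
qed

section \<open>The thirteen solids\<close>

text \<open>
  Only the combinatorial type of a solid matters, and it leaves much freedom for the coordinates.
  The octahedral and tetrahedral solids have realisations with small integers, in which irrational
  edge ratios are replaced by rational ones. The icosahedral rotation group contains the tetrahedral
  one, and for the icosahedral solids the golden ratio is replaced by rational approximations in
  such a way that the faces stay plane and only this smaller symmetry remains.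
\<close>

lemma cuboctahedron:
  "polytope_certificate [3, 4, 3, 4]
   [((1,1,0), [(1,0,1), (1,0,-1), (0,1,-1), (0,1,1)], [((1,0,0),1), ((1,1,-1),2), ((0,1,0),1), ((1,1,1),2)])]
   [((1,1,1),2), ((1,1,-1),2), ((1,0,0),1)]"
  by code_simp

lemma great_rhombicosidodecahedron:
  "polytope_certificate [4, 6, 10]
   [((3,1,9), [(3,-1,9), (4,3,8), (-3,1,9)], [((1,0,1),12), ((0,1,2),19), ((0,0,1),9)]),
    ((-3,-1,-9), [(-3,1,-9), (3,-1,-9), (-4,-3,-8)], [((0,0,-1),9), ((0,-1,-2),19), ((-1,0,-1),12)]),
    ((4,3,8), [(5,4,7), (3,5,7), (3,1,9)], [((1,2,3),34), ((0,1,2),19), ((1,0,1),12)]),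
    ((-4,-3,-8), [(-5,-4,-7), (-3,-1,-9), (-3,-5,-7)], [((-1,0,-1),12), ((0,-1,-2),19), ((-1,-2,-3),34)]),
    ((3,5,7), [(4,6,6), (-3,5,7), (4,3,8)], [((0,1,1),12), ((0,1,2),19), ((1,2,3),34)]),
    ((-3,-5,-7), [(-4,-6,-6), (-4,-3,-8), (3,-5,-7)], [((-1,-2,-3),34), ((0,-1,-2),19), ((0,-1,-1),12)]),
    ((5,4,7), [(4,3,8), (6,4,6), (4,6,6)], [((1,0,1),12), ((1,1,1),16), ((1,2,3),34)]),
    ((-5,-4,-7), [(-4,-3,-8), (-4,-6,-6), (-6,-4,-6)], [((-1,-2,-3),34), ((-1,-1,-1),16), ((-1,0,-1),12)]),
    ((4,6,6), [(3,5,7), (5,4,7), (4,7,5)], [((1,2,3),34), ((1,1,1),16), ((0,1,1),12)]),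
    ((-4,-6,-6), [(-3,-5,-7), (-4,-7,-5), (-5,-4,-7)], [((0,-1,-1),12), ((-1,-1,-1),16), ((-1,-2,-3),34)])]
   [((3,1,2),34), ((3,1,-2),34), ((1,0,0),9), ((2,0,1),19), ((1,1,1),16), ((1,1,-1),16), ((1,1,0),12)]"
  by code_simp

lemma great_rhombicuboctahedron:
  "polytope_certificate [4, 6, 8]
   [((1,2,3), [(-1,2,3), (2,1,3), (1,3,2)], [((0,0,1),3), ((1,1,1),6), ((0,1,1),5)]),
    ((-1,-2,-3), [(1,-2,-3), (-1,-3,-2), (-2,-1,-3)], [((0,-1,-1),5), ((-1,-1,-1),6), ((0,0,-1),3)]),
    ((2,1,3), [(2,-1,3), (3,1,2), (1,2,3)], [((1,0,1),5), ((1,1,1),6), ((0,0,1),3)]),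
    ((-2,-1,-3), [(-2,1,-3), (-1,-2,-3), (-3,-1,-2)], [((0,0,-1),3), ((-1,-1,-1),6), ((-1,0,-1),5)])]
   [((1,1,0),5), ((1,1,1),6), ((1,1,-1),6), ((1,0,0),3)]"
  by code_simp

lemma icosidodecahedron:
  "polytope_certificate [3, 5, 3, 5]
   [((0,7,0), [(4,6,2), (4,6,-2), (-4,6,-2), (-4,6,2)], [((1,4,0),28), ((0,2,-1),14), ((-1,4,0),28), ((0,2,1),14)]),
    ((2,4,6), [(0,0,7), (6,2,4), (4,6,2), (-2,4,6)], [((1,0,2),14), ((1,1,1),12), ((0,2,1),14), ((0,1,4),28)]),
    ((-2,-4,-6), [(0,0,-7), (2,-4,-6), (-4,-6,-2), (-6,-2,-4)], [((0,-1,-4),28), ((0,-2,-1),14), ((-1,-1,-1),12), ((-1,0,-2),14)])]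
   [((4,0,1),28), ((1,1,1),12), ((1,1,-1),12), ((2,1,0),14)]"
  by code_simp

lemma small_rhombicosidodecahedron:
  "polytope_certificate [3, 4, 5, 4]
   [((4,5,6), [(5,6,4), (0,7,5), (3,1,8), (6,4,5)], [((1,3,2),31), ((0,1,2),17), ((2,1,3),31), ((1,1,1),15)]),
    ((-4,-5,-6), [(-5,-6,-4), (-6,-4,-5), (-3,-1,-8), (0,-7,-5)], [((-1,-1,-1),15), ((-2,-1,-3),31), ((0,-1,-2),17), ((-1,-3,-2),31)]),
    ((1,8,3), [(-1,8,3), (0,7,5), (5,6,4), (1,8,-3)], [((0,2,1),19), ((1,3,2),31), ((1,2,0),17), ((0,1,0),8)]),
    ((-1,-8,-3), [(0,-7,-5), (1,-8,-3), (-1,-8,3), (-5,-6,-4)], [((0,-2,-1),19), ((0,-1,0),8), ((-1,-2,0),17), ((-1,-3,-2),31)]),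
    ((0,7,5), [(1,8,3), (-1,8,3), (-4,5,6), (4,5,6)], [((0,2,1),19), ((-1,3,2),31), ((0,1,2),17), ((1,3,2),31)])]
   [((2,1,0),19), ((1,1,1),15), ((1,1,-1),15), ((3,2,1),31), ((3,2,-1),31), ((1,0,0),8), ((2,0,1),17)]"
  by code_simp

lemma small_rhombicuboctahedron:
  "polytope_certificate [3, 4, 4, 4]
   [((1,1,2), [(1,2,1), (-1,1,2), (1,-1,2), (2,1,1)], [((0,1,1),3), ((0,0,1),2), ((1,0,1),3), ((1,1,1),4)]),
    ((-1,-1,-2), [(-1,-2,-1), (-2,-1,-1), (-1,1,-2), (1,-1,-2)], [((-1,-1,-1),4), ((-1,0,-1),3), ((0,0,-1),2), ((0,-1,-1),3)])]
   [((1,1,1),4), ((1,1,-1),4), ((1,1,0),3), ((1,0,0),2)]"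
  by code_simp

lemma snub_cube:
  "polytope_certificate [3, 3, 3, 3, 4]
   [((1,2,4), [(-2,1,4), (2,-1,4), (4,1,2), (2,4,1), (-1,4,2)], [((0,0,1),4), ((3,1,4),21), ((1,1,1),7), ((1,4,3),21), ((-1,3,4),21)]),
    ((2,1,-4), [(1,-2,-4), (-1,2,-4), (1,4,-2), (4,2,-1), (4,-1,-2)], [((0,0,-1),4), ((1,3,-4),21), ((1,1,-1),7), ((4,1,-3),21), ((3,-1,-4),21)])]
   [((4,3,1),21), ((4,1,-3),21), ((1,1,1),7), ((1,1,-1),7), ((1,0,0),4)]"
  by code_simp

lemma snub_dodecahedron:
  "polytope_certificate [3, 3, 3, 3, 5]
   [((3,5,6), [(1,7,5), (1,1,8), (5,1,7), (6,3,5), (5,6,3)], [((0,1,2),17), ((2,3,8),69), ((6,5,8),91), ((1,1,1),14), ((5,8,6),91)]),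
    ((1,7,5), [(3,5,6), (5,6,3), (1,8,1), (-3,7,2), (-2,5,6)], [((5,8,6),91), ((3,8,2),69), ((-3,16,4),129), ((-6,13,8),125), ((0,1,2),17)]),
    ((-2,5,6), [(1,7,5), (-3,7,2), (-5,6,2), (-6,2,5), (-2,3,7)], [((-6,13,8),125), ((-4,8,5),78), ((-1,1,1),13), ((-5,4,8),78), ((0,1,2),17)]),
    ((-2,3,7), [(1,1,8), (-2,5,6), (-6,2,5), (-5,-1,7), (-1,-1,8)], [((0,1,2),17), ((-5,4,8),78), ((-8,6,13),125), ((-4,3,16),129), ((-1,1,5),40)]),
    ((1,1,8), [(3,5,6), (-2,3,7), (-1,-1,8), (2,-3,7), (5,1,7)], [((0,1,2),17), ((-1,1,5),40), ((1,-1,5),40), ((4,-3,16),129), ((2,3,8),69)])]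
   [((16,4,-3),129), ((13,8,-6),125), ((8,6,5),91), ((8,5,-4),78), ((8,2,3),69), ((5,1,-1),40), ((1,1,1),14), ((1,1,-1),13), ((2,0,1),17)]"
  by code_simp

lemma truncated_cube:
  "polytope_certificate [3, 8, 8]
   [((2,2,1), [(2,1,2), (2,2,-1), (1,2,2)], [((1,0,0),2), ((0,1,0),2), ((1,1,1),5)]),
    ((-2,-2,-1), [(-2,-1,-2), (-1,-2,-2), (-2,-2,1)], [((-1,-1,-1),5), ((0,-1,0),2), ((-1,0,0),2)])]
   [((1,1,1),5), ((1,1,-1),5), ((1,0,0),2)]"
  by code_simp

lemma truncated_dodecahedron:
  "polytope_certificate [3, 10, 10]
   [((0,4,11), [(2,6,10), (-2,6,10), (0,-4,11)], [((0,1,2),26), ((-1,0,2),22), ((1,0,2),22)]),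
    ((2,6,10), [(0,4,11), (6,7,8), (-2,6,10)], [((1,0,2),22), ((0,2,1),22), ((0,1,2),26)]),
    ((-2,-6,-10), [(0,-4,-11), (2,-6,-10), (-6,-7,-8)], [((0,-1,-2),26), ((0,-2,-1),22), ((-1,0,-2),22)]),
    ((6,7,8), [(8,6,7), (7,8,6), (2,6,10)], [((1,1,1),21), ((0,2,1),22), ((1,0,2),22)]),
    ((-6,-7,-8), [(-7,-8,-6), (-8,-6,-7), (-2,-6,-10)], [((-1,-1,-1),21), ((-1,0,-2),22), ((0,-2,-1),22)])]
   [((2,0,1),26), ((1,1,1),21), ((1,1,-1),21), ((2,1,0),22)]"
  by code_simp

lemma truncated_icosahedron:
  "polytope_certificate [5, 6, 6]
   [((0,2,6), [(2,3,5), (-2,3,5), (0,-2,6)], [((0,1,1),8), ((-1,0,2),12), ((1,0,2),12)]),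
    ((2,4,4), [(-2,4,4), (2,3,5), (3,5,2)], [((0,1,1),8), ((1,1,1),10), ((0,2,1),12)]),
    ((-2,-4,-4), [(2,-4,-4), (-3,-5,-2), (-2,-3,-5)], [((0,-2,-1),12), ((-1,-1,-1),10), ((0,-1,-1),8)]),
    ((2,3,5), [(0,2,6), (4,2,4), (2,4,4)], [((1,0,2),12), ((1,1,1),10), ((0,1,1),8)]),
    ((-2,-3,-5), [(0,-2,-6), (-2,-4,-4), (-4,-2,-4)], [((0,-1,-1),8), ((-1,-1,-1),10), ((-1,0,-2),12)])]
   [((1,1,0),8), ((2,1,0),12), ((1,1,1),10), ((1,1,-1),10)]"
  by code_simp

lemma truncated_octahedron:
  "polytope_certificate [4, 6, 6]
   [((0,1,2), [(-1,0,2), (1,0,2), (0,2,1)], [((0,0,1),2), ((1,1,1),3), ((-1,1,1),3)]),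
    ((0,2,1), [(1,2,0), (-1,2,0), (0,1,2)], [((0,1,0),2), ((-1,1,1),3), ((1,1,1),3)])]
   [((1,0,0),2), ((1,1,1),3), ((1,1,-1),3)]"
  by code_simp

lemma truncated_tetrahedron:
  "polytope_certificate [3, 6, 6]
   [((3,1,1), [(1,3,1), (1,1,3), (3,-1,-1)], [((1,1,1),5), ((1,-1,1),3), ((1,1,-1),3)])]
   [((1,1,1),5), ((1,1,-1),3)]"
  by code_simp

section \<open>Prisms and antiprisms\<close>

lemma cos_odd_multiple:
  fixes m :: nat and d :: int
  assumes m: "3 \<le> m" and d: "odd d"
  defines "\<beta> \<equiv> pi / real m"
  shows "cos (of_int d * \<beta>) \<le> cos \<beta>"
proof -
  define r where "r = d mod (2 * int m)"
  have r: "0 \<le> r" "r < 2 * int m" unfolding r_def using m by auto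
  have "odd r" unfolding r_def using d by (simp add: dvd_mod_iff)
  then have r1: "1 \<le> r" "r \<le> 2 * int m - 1" using r by (auto intro: ccontr simp: order_le_less)
  have \<beta>: "0 < \<beta>" "real m * \<beta> = pi" unfolding \<beta>_def using m by auto
  have "d = r + (d div (2 * int m)) * (2 * int m)" unfolding r_def by (rule mod_div_mult_eq[symmetric])
  then have "of_int d * \<beta> = of_int r * \<beta> + of_int (d div (2 * int m)) * (2 * (real m * \<beta>))"
    by (metis (no_types, opaque_lifting) distrib_right mult.assoc mult.commute of_int_add of_int_mult of_int_numeral of_int_of_nat_eq)
  then have e: "cos (of_int d * \<beta>) = cos (of_int r * \<beta>)"
    unfolding \<beta>(2) using cos_int_2pin[of "d div (2 * int m)"] sin_int_2pin[of "d div (2 * int m)"]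
    by (simp add: cos_add mult.commute)
  show ?thesis
  proof (cases "r \<le> int m")
    case True
    have "\<beta> \<le> of_int r * \<beta>" using r1 \<beta> by simp
    moreover have "of_int r * \<beta> \<le> pi"
      using True \<beta> mult_right_mono[of "of_int r" "real m" \<beta>] by (simp flip: \<beta>(2))
    ultimately show ?thesis unfolding e using \<beta> by (intro cos_monotone_0_pi_le) auto
  next
    case False
    have e2: "cos (of_int r * \<beta>) = cos (2 * pi - of_int r * \<beta>)" by (simp add: cos_diff)
    have 2: "2 * pi - of_int r * \<beta> = of_int (2 * int m - r) * \<beta>" using \<beta>(2) by (simp add: algebra_simps)
    have "\<beta> \<le> of_int (2 * int m - r) * \<beta>" using r1 \<beta> mult_right_mono[of 1 "of_int (2 * int m - r)" \<beta>] by simp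
    moreover have "of_int (2 * int m - r) * \<beta> \<le> real m * \<beta>"
      using False \<beta> by (intro mult_right_mono) auto
    ultimately show ?thesis unfolding e e2 2 using \<beta> by (intro cos_monotone_0_pi_le) auto
  qed
qed

lemma cos_multiple_eq:
  fixes m :: nat and d k :: int
  assumes m: "3 \<le> m"
  defines "\<beta> \<equiv> pi / real m"
  shows "cos (of_int d * \<beta>) = cos (of_int k * \<beta>) \<longleftrightarrow> 2 * int m dvd d - k \<or> 2 * int m dvd d + k"
proof -
  have \<beta>: "\<beta> \<noteq> 0" "pi = real m * \<beta>" unfolding \<beta>_def using m by auto
  have a: "of_int d * \<beta> = of_int k * \<beta> + 2 * of_int n * pi \<longleftrightarrow> d - k = 2 * int m * n" for n
  proof -
    have "of_int d * \<beta> = of_int k * \<beta> + 2 * of_int n * pi \<longleftrightarrow> of_int (d - k) * \<beta> = of_int (2 * int m * n) * \<beta>"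
      unfolding \<beta>(2) by (simp add: algebra_simps)
    also have "\<dots> \<longleftrightarrow> (of_int (d - k) :: real) = of_int (2 * int m * n)" using \<beta>(1) by simp
    finally show ?thesis by (simp only: of_int_eq_iff)
  qed
  have b: "of_int d * \<beta> = - (of_int k * \<beta>) + 2 * of_int n * pi \<longleftrightarrow> d + k = 2 * int m * n" for n
  proof -
    have "of_int d * \<beta> = - (of_int k * \<beta>) + 2 * of_int n * pi \<longleftrightarrow> of_int (d + k) * \<beta> = of_int (2 * int m * n) * \<beta>"
      unfolding \<beta>(2) by (simp add: algebra_simps)
    also have "\<dots> \<longleftrightarrow> (of_int (d + k) :: real) = of_int (2 * int m * n)" using \<beta>(1) by simp
    finally show ?thesis by (simp only: of_int_eq_iff)
  qed
  have "cos (of_int d * \<beta>) = cos (of_int k * \<beta>) \<longleftrightarrow>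
    (\<exists>n::int. of_int d * \<beta> = of_int k * \<beta> + 2 * of_int n * pi \<or> of_int d * \<beta> = - (of_int k * \<beta>) + 2 * of_int n * pi)"
    unfolding cos_eq Ints_def by auto
  also have "\<dots> \<longleftrightarrow> 2 * int m dvd d - k \<or> 2 * int m dvd d + k"
    unfolding a b dvd_def by blast
  finally show ?thesis .
qed

text \<open>
  Vertices and facets of prisms and antiprisms are multiples of such points, and all inner products
  between them reduce to cosines of multiples of \<open>\<pi> / m\<close>.
\<close>

definition ring_point :: "real \<Rightarrow> real \<Rightarrow> real^3" where
  "ring_point a z = vector [cos a, sin a, z]"

definition spin :: "real \<Rightarrow> real^3 \<Rightarrow> real^3" where
  "spin c x = vector [cos c * x $ 1 - sin c * x $ 2, sin c * x $ 1 + cos c * x $ 2, x $ 3]"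

definition half_turn :: "real \<Rightarrow> real^3 \<Rightarrow> real^3" where
  "half_turn c x = vector [cos c * x $ 1 + sin c * x $ 2, sin c * x $ 1 - cos c * x $ 2, - x $ 3]"

lemma ring_point_inner: "ring_point a z \<bullet> ring_point b y = cos (a - b) + z * y"
  by (simp add: ring_point_def inner_vec_def sum_3 vector_3 cos_diff)

lemma spin_ring_point: "spin c (k *\<^sub>R ring_point a z) = k *\<^sub>R ring_point (a + c) z"
  by (simp add: spin_def ring_point_def vec_eq_iff forall_3 vector_3 cos_add sin_add algebra_simps)

lemma half_turn_ring_point: "half_turn c (k *\<^sub>R ring_point a z) = k *\<^sub>R ring_point (c - a) (- z)"
  by (simp add: half_turn_def ring_point_def vec_eq_iff forall_3 vector_3 cos_diff sin_diff algebra_simps)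

lemma spin_isometry: "spin c x \<bullet> spin c y = x \<bullet> y" "cross3 (spin c x) (spin c y) = spin c (cross3 x y)"
proof -
  have t: "cos c * cos c = 1 - sin c * sin c" using sin_cos_squared_add3[of c] by (simp add: algebra_simps)
  show "spin c x \<bullet> spin c y = x \<bullet> y"
    unfolding spin_def inner_vec_def sum_3 vector_3 using t by simp algebra
  show "cross3 (spin c x) (spin c y) = spin c (cross3 x y)"
    unfolding spin_def cross3_def vec_eq_iff forall_3 vector_3 by (intro conjI; (insert t, (simp add: algebra_simps; fail | algebra)))
qed

lemma half_turn_isometry:
  "half_turn c x \<bullet> half_turn c y = x \<bullet> y" "cross3 (half_turn c x) (half_turn c y) = half_turn c (cross3 x y)"
proof -
  have t: "cos c * cos c = 1 - sin c * sin c" using sin_cos_squared_add3[of c] by (simp add: algebra_simps)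
  show "half_turn c x \<bullet> half_turn c y = x \<bullet> y"
    unfolding half_turn_def inner_vec_def sum_3 vector_3 using t by simp algebra
  show "cross3 (half_turn c x) (half_turn c y) = half_turn c (cross3 x y)"
    unfolding half_turn_def cross3_def vec_eq_iff forall_3 vector_3 by (intro conjI; (insert t, (simp add: algebra_simps; fail | algebra)))
qed

lemma spin_inverse: "spin (- c) (spin c x) = x" "spin c (spin (- c) x) = x"
proof -
  have t: "cos c * cos c = 1 - sin c * sin c" using sin_cos_squared_add3[of c] by (simp add: algebra_simps)
  show "spin (- c) (spin c x) = x" "spin c (spin (- c) x) = x"
    unfolding spin_def vec_eq_iff forall_3 vector_3 cos_minus sin_minus by (intro conjI; (insert t, (simp add: algebra_simps; fail | algebra)))+
qed

lemma half_turn_inverse: "half_turn c (half_turn c x) = x"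
proof -
  have t: "cos c * cos c = 1 - sin c * sin c" using sin_cos_squared_add3[of c] by (simp add: algebra_simps)
  show ?thesis unfolding half_turn_def vec_eq_iff forall_3 vector_3 by (intro conjI; (insert t, (simp add: algebra_simps; fail | algebra)))
qed

lemma spin_symmetry:
  assumes "spin c ` P \<subseteq> P" "spin (- c) ` P \<subseteq> P" "spin c ` N \<subseteq> N" "spin (- c) ` N \<subseteq> N"
  shows "rotational_symmetry P N (spin c)"
proof -
  have i: "inj (spin c)" by (metis injI spin_inverse(1))
  have e: "spin c ` S = S" if S: "spin c ` S \<subseteq> S" "spin (- c) ` S \<subseteq> S" for S
  proof
    show "S \<subseteq> spin c ` S"
    proof
      fix x assume "x \<in> S"
      then have "spin (- c) x \<in> S" using S(2) by blast
      then show "x \<in> spin c ` S" using spin_inverse(2)[of c x] by (metis imageI)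
    qed
  qed (rule S(1))
  show ?thesis unfolding rotational_symmetry_def
    by (intro conjI allI i spin_isometry e assms)
qed

lemma half_turn_symmetry:
  assumes "half_turn c ` P \<subseteq> P" "half_turn c ` N \<subseteq> N"
  shows "rotational_symmetry P N (half_turn c)"
proof -
  have i: "inj (half_turn c)" by (metis injI half_turn_inverse)
  have e: "half_turn c ` S = S" if S: "half_turn c ` S \<subseteq> S" for S
  proof
    show "S \<subseteq> half_turn c ` S"
    proof
      fix x assume "x \<in> S"
      then have "half_turn c x \<in> S" using S by blast
      then show "x \<in> half_turn c ` S" using half_turn_inverse[of c x] by (metis imageI)
    qed
  qed (rule S)
  show ?thesis unfolding rotational_symmetry_def
    by (intro conjI allI i half_turn_isometry e assms)
qed

definition pole :: "real \<Rightarrow> real^3" where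
  "pole z = vector [0, 0, z]"

lemma pole_inner: "pole z \<bullet> ring_point a y = z * y"
  by (simp add: pole_def ring_point_def inner_vec_def sum_3 vector_3)

lemma spin_pole: "spin c (pole z) = pole z" "half_turn c (pole z) = pole (- z)"
  by (simp_all add: pole_def spin_def half_turn_def vec_eq_iff forall_3 vector_3)

lemma ring_point_triple:
  "ring_point 0 z \<bullet> cross3 (ring_point a x) (ring_point b y) = sin a * y - x * sin b + z * sin (b - a)"
  by (simp add: ring_point_def cross3_def inner_vec_def sum_3 vector_3 sin_diff algebra_simps)

lemma corner_fan_3:
  assumes "{w0, w1, w2} \<subseteq> P" "{f \<in> N. f \<bullet> v = 1} = {f0, f1, f2}"
    "f0 \<bullet> w0 = 1" "f0 \<bullet> w1 = 1" "f0 \<bullet> w2 \<noteq> 1" "f1 \<bullet> w0 \<noteq> 1" "f1 \<bullet> w1 = 1" "f1 \<bullet> w2 = 1"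
    "f2 \<bullet> w0 = 1" "f2 \<bullet> w1 \<noteq> 1" "f2 \<bullet> w2 = 1"
    "0 < v \<bullet> cross3 w0 w1" "0 < v \<bullet> cross3 w1 w2" "0 < v \<bullet> cross3 w2 w0"
  shows "corner_fan P N v [w0, w1, w2] [f0, f1, f2]"
  using assms by (auto simp: corner_fan_def All_less_Suc)

lemma corner_fan_4:
  assumes "{w0, w1, w2, w3} \<subseteq> P" "{f \<in> N. f \<bullet> v = 1} = {f0, f1, f2, f3}"
    "f0 \<bullet> w0 = 1" "f0 \<bullet> w1 = 1" "f0 \<bullet> w2 \<noteq> 1" "f0 \<bullet> w3 \<noteq> 1"
    "f1 \<bullet> w0 \<noteq> 1" "f1 \<bullet> w1 = 1" "f1 \<bullet> w2 = 1" "f1 \<bullet> w3 \<noteq> 1"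
    "f2 \<bullet> w0 \<noteq> 1" "f2 \<bullet> w1 \<noteq> 1" "f2 \<bullet> w2 = 1" "f2 \<bullet> w3 = 1"
    "f3 \<bullet> w0 = 1" "f3 \<bullet> w1 \<noteq> 1" "f3 \<bullet> w2 \<noteq> 1" "f3 \<bullet> w3 = 1"
    "0 < v \<bullet> cross3 w0 w1" "0 < v \<bullet> cross3 w1 w2" "0 < v \<bullet> cross3 w2 w3" "0 < v \<bullet> cross3 w3 w0"
  shows "corner_fan P N v [w0, w1, w2, w3] [f0, f1, f2, f3]"
  using assms by (auto simp: corner_fan_def All_less_Suc)

text \<open>
  Angles are measured in units of \<open>\<beta> = \<pi> / m\<close>, which is half of the angle
  between neighbouring vertices of a regular \<open>m\<close>-gon. Prisms use vertices at the even
  multiples and sides at the odd multiples of \<open>\<beta>\<close>. Antiprisms use all multiples,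
  alternately above and below the equator.
\<close>

locale ring_grid =
  fixes m :: nat and \<beta> :: real
  assumes m: "3 \<le> m" and \<beta>: "\<beta> = pi / real m"
begin

definition grid_point :: "int \<Rightarrow> real \<Rightarrow> real^3" where
  "grid_point j z = ring_point (of_int j * \<beta>) z"

lemma cos_grid_point: "cos (of_int d * \<beta>) = cos (of_int k * \<beta>) \<longleftrightarrow> 2 * int m dvd d - k \<or> 2 * int m dvd d + k"
  using cos_multiple_eq[OF m, of d k] \<beta> by simp

lemma cos_grid_point_odd: "odd d \<Longrightarrow> cos (of_int d * \<beta>) \<le> cos \<beta>"
  using cos_odd_multiple[OF m, of d] \<beta> by simp

lemma beta_bounds: "0 < \<beta>" "2 * \<beta> < pi" "0 < cos \<beta>" "cos \<beta> < 1" "0 < sin \<beta>" "0 < sin (2 * \<beta>)" "cos (2 * \<beta>) < 1"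
proof -
  show b: "0 < \<beta>" "2 * \<beta> < pi" unfolding \<beta> using m by (simp_all add: field_simps)
  show "0 < cos \<beta>" using b by (intro cos_gt_zero) auto
  show "0 < sin \<beta>" "0 < sin (2 * \<beta>)" using b by (auto intro!: sin_gt_zero)
  show "cos \<beta> < 1" "cos (2 * \<beta>) < 1" using b cos_monotone_0_pi[of 0 \<beta>] cos_monotone_0_pi[of 0 "2 * \<beta>"] by auto
qed

lemma small_not_dvd: "\<not> 2 * int m dvd 2" "\<not> 2 * int m dvd 4" "\<not> 2 * int m dvd 1" "\<not> 2 * int m dvd 3"
  using m zdvd_imp_le[of "2 * int m" 2] zdvd_imp_le[of "2 * int m" 4] zdvd_imp_le[of "2 * int m" 1] zdvd_imp_le[of "2 * int m" 3]
  by auto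

lemma grid_point_inner: "grid_point j z \<bullet> grid_point i y = cos (of_int (j - i) * \<beta>) + z * y"
  unfolding grid_point_def ring_point_inner by (simp add: left_diff_distrib)

lemma grid_point_eq_iff: "grid_point j z = grid_point i y \<longleftrightarrow> 2 * int m dvd j - i \<and> z = y"
proof
  assume e: "grid_point j z = grid_point i y"
  then have z: "z = y" unfolding grid_point_def ring_point_def by (simp add: vec_eq_iff forall_3 vector_3)
  have "grid_point j z \<bullet> grid_point i y = grid_point i y \<bullet> grid_point i y" using e by simp
  then have "cos (of_int (j - i) * \<beta>) = cos (of_int 0 * \<beta>)" using z unfolding grid_point_inner by simp
  then show "2 * int m dvd j - i \<and> z = y" using z unfolding cos_grid_point by simp
next
  assume a: "2 * int m dvd j - i \<and> z = y"
  then obtain n where "j - i = 2 * int m * n" by (auto elim: dvdE)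
  then have "j = i + 2 * int m * n" by simp
  then have "of_int j * \<beta> = of_int i * \<beta> + 2 * (real m * \<beta>) * of_int n" by (simp add: algebra_simps)
  also have "real m * \<beta> = pi" unfolding \<beta> using m by simp
  finally have "sin (of_int j * \<beta>) = sin (of_int i * \<beta>) \<and> cos (of_int j * \<beta>) = cos (of_int i * \<beta>)"
    unfolding sin_cos_eq_iff by blast
  then show "grid_point j z = grid_point i y" using a unfolding grid_point_def ring_point_def by simp
qed

lemma grid_point_mod: "grid_point (j mod (2 * int m)) z = grid_point j z"
  unfolding grid_point_eq_iff by (simp add: mod_eq_dvd_iff[symmetric])

lemma spin_grid_point: "spin (of_int k * \<beta>) (c *\<^sub>R grid_point j z) = c *\<^sub>R grid_point (j + k) z"
  unfolding grid_point_def spin_ring_point by (simp add: distrib_right)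

lemma half_turn_grid_point: "half_turn (of_int k * \<beta>) (c *\<^sub>R grid_point j z) = c *\<^sub>R grid_point (k - j) (- z)"
  unfolding grid_point_def half_turn_ring_point by (simp add: left_diff_distrib)

lemma spin_grid_point1: "spin (of_int k * \<beta>) (grid_point j z) = grid_point (j + k) z"
  using spin_grid_point[of k 1] by simp

lemma half_turn_grid_point1: "half_turn (of_int k * \<beta>) (grid_point j z) = grid_point (k - j) (- z)"
  using half_turn_grid_point[of k 1] by simp

lemma grid_point_triple:
  "grid_point 0 z \<bullet> cross3 (grid_point i x) (grid_point j y)
    = sin (of_int i * \<beta>) * y - x * sin (of_int j * \<beta>) + z * sin (of_int (j - i) * \<beta>)"
  unfolding grid_point_def using ring_point_triple by (simp add: left_diff_distrib)

lemma finite_ring: "finite {c *\<^sub>R grid_point j (z (j mod (2 * int m))) | j. True}"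
proof -
  have "{c *\<^sub>R grid_point j (z (j mod (2 * int m))) | j. True} \<subseteq> (\<lambda>j. c *\<^sub>R grid_point j (z j)) ` {0..<2 * int m}"
  proof
    fix x assume "x \<in> {c *\<^sub>R grid_point j (z (j mod (2 * int m))) | j. True}"
    then obtain j where "x = c *\<^sub>R grid_point j (z (j mod (2 * int m)))" by blast
    then have "x = c *\<^sub>R grid_point (j mod (2 * int m)) (z (j mod (2 * int m)))" unfolding grid_point_mod .
    moreover have "j mod (2 * int m) \<in> {0..<2 * int m}" using m by simp
    ultimately show "x \<in> (\<lambda>j. c *\<^sub>R grid_point j (z j)) ` {0..<2 * int m}" by blast
  qed
  then show ?thesis using finite_subset by blast
qed

lemma even_ring_card: "card {grid_point j 1 | j. even j} = m"
proof -
  have "{grid_point j 1 | j. even j} = (\<lambda>k. grid_point (2 * int k) 1) ` {0..<m}"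
  proof (intro set_eqI iffI)
    fix x assume "x \<in> {grid_point j 1 | j. even j}"
    then obtain j where j: "x = grid_point j 1" "even j" by blast
    define k where "k = nat ((j mod (2 * int m)) div 2)"
    have r: "0 \<le> j mod (2 * int m)" "j mod (2 * int m) < 2 * int m" "even (j mod (2 * int m))"
      using m j(2) by (auto simp: dvd_mod_iff)
    then have "2 * int k = j mod (2 * int m)" "k < m" unfolding k_def by auto
    then show "x \<in> (\<lambda>k. grid_point (2 * int k) 1) ` {0..<m}" using j(1) grid_point_mod[of j 1] by (metis atLeastLessThan_iff image_eqI zero_le)
  qed auto
  moreover have "inj_on (\<lambda>k. grid_point (2 * int k) 1) {0..<m}"
  proof (rule inj_onI)
    fix k l assume kl: "k \<in> {0..<m}" "l \<in> {0..<m}" "grid_point (2 * int k) 1 = grid_point (2 * int l) 1"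
    then have "2 * int m dvd 2 * (int k - int l)" unfolding grid_point_eq_iff by (simp add: right_diff_distrib)
    then have "int m dvd int k - int l" by (metis dvd_mult_cancel_left zero_neq_numeral)
    then show "k = l" using kl(1,2) zdvd_imp_le[of "int m" "int k - int l"] zdvd_imp_le[of "int m" "int l - int k"]
      by (cases k l rule: linorder_cases) (auto simp: dvd_diff_commute)
  qed
  ultimately show ?thesis by (simp add: card_image)
qed

lemma sign_set: "{z::real. z = 1 \<or> z = -1} = {1, -1}" by auto

definition prism_vertices :: "(real^3) set" where
  "prism_vertices = {grid_point j z | j z. even j \<and> (z = 1 \<or> z = - 1)}"

definition side :: "int \<Rightarrow> real^3" where
  "side j = (1 / cos \<beta>) *\<^sub>R grid_point j 0"

definition prism_facets :: "(real^3) set" where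
  "prism_facets = {side j | j. odd j} \<union> {pole z | z. z = 1 \<or> z = - 1}"

lemma pole_grid_point: "pole z \<bullet> grid_point j y = z * y"
  unfolding grid_point_def by (rule pole_inner)

lemma side_inner: "side j \<bullet> grid_point i z = cos (of_int (j - i) * \<beta>) / cos \<beta>"
  unfolding side_def by (simp add: grid_point_inner)

lemma side_grid_point: "side j \<bullet> grid_point i z = 1 \<longleftrightarrow> 2 * int m dvd j - i - 1 \<or> 2 * int m dvd j - i + 1"
proof -
  have "side j \<bullet> grid_point i z = cos (of_int (j - i) * \<beta>) / cos \<beta>" by (rule side_inner)
  also have "\<dots> = 1 \<longleftrightarrow> cos (of_int (j - i) * \<beta>) = cos \<beta>"
    using beta_bounds(3) by auto
  finally show ?thesis using cos_grid_point[of "j - i" 1] by simp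
qed

lemma side_eq: "2 * int m dvd j - i \<Longrightarrow> side j = side i"
  unfolding side_def using grid_point_eq_iff by metis

lemma prism_in: "even j \<Longrightarrow> z = 1 \<or> z = - 1 \<Longrightarrow> grid_point j z \<in> prism_vertices"
  "odd j \<Longrightarrow> side j \<in> prism_facets" "z = 1 \<or> z = - 1 \<Longrightarrow> pole z \<in> prism_facets"
  unfolding prism_vertices_def prism_facets_def by blast+

lemma prism_vertexE:
  assumes "x \<in> prism_vertices" obtains j z where "x = grid_point j z" "even j" "z = 1 \<or> z = - 1"
  using assms unfolding prism_vertices_def by blast

lemma prism_facetE:
  assumes "x \<in> prism_facets"
  obtains j where "x = side j" "odd j" | z where "x = pole z" "z = 1 \<or> z = - 1"
  using assms unfolding prism_facets_def by blast

lemma spin_side: "spin (of_int k * \<beta>) (side j) = side (j + k)" "half_turn (of_int k * \<beta>) (side j) = side (k - j)"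
  unfolding side_def by (simp_all add: spin_grid_point half_turn_grid_point)

lemma prism_spin:
  assumes "even k"
  shows "spin (of_int k * \<beta>) ` prism_vertices \<subseteq> prism_vertices"
    "spin (of_int k * \<beta>) ` prism_facets \<subseteq> prism_facets"
proof -
  show "spin (of_int k * \<beta>) ` prism_vertices \<subseteq> prism_vertices"
  proof (rule image_subsetI)
    fix x assume "x \<in> prism_vertices"
    then obtain j z where "x = grid_point j z" "even j" "z = 1 \<or> z = - 1" by (rule prism_vertexE)
    then show "spin (of_int k * \<beta>) x \<in> prism_vertices"
      using prism_in(1)[of "j + k" z] assms by (simp add: spin_grid_point1)
  qed
  show "spin (of_int k * \<beta>) ` prism_facets \<subseteq> prism_facets"
  proof (rule image_subsetI)
    fix x assume "x \<in> prism_facets"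
    then show "spin (of_int k * \<beta>) x \<in> prism_facets"
    proof (cases rule: prism_facetE)
      case (1 j)
      then show ?thesis using prism_in(2)[of "j + k"] assms by (simp add: spin_side)
    next
      case (2 z)
      then show ?thesis using prism_in(3)[of z] by (simp add: spin_pole)
    qed
  qed
qed

lemma prism_half_turn:
  "half_turn (of_int 0 * \<beta>) ` prism_vertices \<subseteq> prism_vertices"
  "half_turn (of_int 0 * \<beta>) ` prism_facets \<subseteq> prism_facets"
proof -
  show "half_turn (of_int 0 * \<beta>) ` prism_vertices \<subseteq> prism_vertices"
  proof (rule image_subsetI)
    fix x assume "x \<in> prism_vertices"
    then obtain j z where x: "x = grid_point j z" "even j" "z = 1 \<or> z = - 1" by (rule prism_vertexE)
    have "half_turn (of_int 0 * \<beta>) x = grid_point (0 - j) (- z)" unfolding x(1) by (rule half_turn_grid_point1)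
    then show "half_turn (of_int 0 * \<beta>) x \<in> prism_vertices"
      using prism_in(1)[of "0 - j" "- z"] x by auto
  qed
  show "half_turn (of_int 0 * \<beta>) ` prism_facets \<subseteq> prism_facets"
  proof (rule image_subsetI)
    fix x assume "x \<in> prism_facets"
    then show "half_turn (of_int 0 * \<beta>) x \<in> prism_facets"
    proof (cases rule: prism_facetE)
      case (1 j)
      have "half_turn (of_int 0 * \<beta>) x = side (0 - j)" unfolding 1(1) by (rule spin_side)
      then show ?thesis using prism_in(2)[of "0 - j"] 1 by simp
    next
      case (2 z)
      then show ?thesis using prism_in(3)[of "- z"] by (auto simp: spin_pole)
    qed
  qed
qed

lemma prism_symmetry:
  "even k \<Longrightarrow> rotational_symmetry prism_vertices prism_facets (spin (of_int k * \<beta>))"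
  "rotational_symmetry prism_vertices prism_facets (half_turn (of_int 0 * \<beta>))"
  using spin_symmetry[of "of_int k * \<beta>" prism_vertices prism_facets] prism_spin[of k] prism_spin[of "- k"]
    half_turn_symmetry[OF prism_half_turn] by simp_all

lemma prism_finite: "finite prism_vertices" "finite prism_facets"
proof -
  have "prism_vertices \<subseteq> {1 *\<^sub>R grid_point j 1 | j. True} \<union> {1 *\<^sub>R grid_point j (- 1) | j. True}"
    unfolding prism_vertices_def by auto
  then show "finite prism_vertices"
    using finite_ring[of 1 "\<lambda>_. 1"] finite_ring[of 1 "\<lambda>_. - 1"] finite_subset by blast
  have "prism_facets \<subseteq> {(1 / cos \<beta>) *\<^sub>R grid_point j 0 | j. True} \<union> {pole 1, pole (- 1)}"
    unfolding prism_facets_def side_def by auto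
  then show "finite prism_facets"
    using finite_ring[of "1 / cos \<beta>" "\<lambda>_. 0"] finite_subset by (metis (no_types, lifting) finite.simps finite_UnI)
qed

lemma prism_corner_fan:
  "corner_fan prism_vertices prism_facets (grid_point 0 1)
     [grid_point 0 (- 1), grid_point 2 1, grid_point (- 2) 1] [side 1, pole 1, side (- 1)]"
proof -
  have "{f \<in> prism_facets. f \<bullet> grid_point 0 1 = 1} = {side 1, pole 1, side (- 1)}"
  proof (intro set_eqI iffI)
    fix x assume "x \<in> {f \<in> prism_facets. f \<bullet> grid_point 0 1 = 1}"
    then have x: "x \<in> prism_facets" "x \<bullet> grid_point 0 1 = 1" by auto
    from x(1) show "x \<in> {side 1, pole 1, side (- 1)}"
    proof (cases rule: prism_facetE)
      case (1 j)
      then have "2 * int m dvd j - 1 \<or> 2 * int m dvd j - (- 1)" using x(2) by (simp add: side_grid_point)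
      then show ?thesis using side_eq[of j 1] side_eq[of j "- 1"] 1(1) by blast
    next
      case (2 z)
      then show ?thesis using x(2) by (simp add: pole_grid_point)
    qed
  next
    fix x assume "x \<in> {side 1, pole 1, side (- 1)}"
    then show "x \<in> {f \<in> prism_facets. f \<bullet> grid_point 0 1 = 1}"
      using prism_in by (auto simp: side_grid_point pole_grid_point)
  qed
  moreover have "0 < sin (2 * \<beta>) - sin (- (2 * \<beta>)) + sin (- (4 * \<beta>))"
  proof -
    have "sin (4 * \<beta>) = 2 * sin (2 * \<beta>) * cos (2 * \<beta>)" using sin_double[of "2 * \<beta>"] by simp
    then have "sin (2 * \<beta>) - sin (- (2 * \<beta>)) + sin (- (4 * \<beta>)) = 2 * sin (2 * \<beta>) * (1 - cos (2 * \<beta>))"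
      by (simp add: algebra_simps)
    then show ?thesis using beta_bounds by simp
  qed
  ultimately show ?thesis
    using prism_in(1) beta_bounds small_not_dvd
    by (intro corner_fan_3) (simp_all add: side_grid_point pole_grid_point grid_point_triple)
qed

lemma prism_degrees:
  "card {u \<in> prism_vertices. pole 1 \<bullet> u = 1} = m"
  "card {u \<in> prism_vertices. side 1 \<bullet> u = 1} = 4"
  "card {u \<in> prism_vertices. side (- 1) \<bullet> u = 1} = 4"
proof -
  have "{u \<in> prism_vertices. pole 1 \<bullet> u = 1} = {grid_point j 1 | j. even j}"
    unfolding prism_vertices_def by (auto simp: pole_grid_point)
  then show "card {u \<in> prism_vertices. pole 1 \<bullet> u = 1} = m" using even_ring_card by simp
  have "card {u \<in> prism_vertices. side k \<bullet> u = 1} = 4" if k: "odd k" for k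
  proof -
    have "{u \<in> prism_vertices. side k \<bullet> u = 1} = {grid_point (k - 1) 1, grid_point (k - 1) (- 1), grid_point (k + 1) 1, grid_point (k + 1) (- 1)}"
    proof (intro set_eqI iffI)
      fix x assume "x \<in> {u \<in> prism_vertices. side k \<bullet> u = 1}"
      then have xv: "x \<in> prism_vertices" "side k \<bullet> x = 1" by auto
      from xv(1) obtain j z where jz: "x = grid_point j z" "even j" "z = 1 \<or> z = - 1" by (rule prism_vertexE)
      then have x: "x = grid_point j z" "z = 1 \<or> z = - 1" "side k \<bullet> grid_point j z = 1" using xv(2) by simp_all
      have "2 * int m dvd j - (k - 1) \<or> 2 * int m dvd j - (k + 1)"
        using x(3) dvd_minus_iff[of "2 * int m" "k - j - 1"] dvd_minus_iff[of "2 * int m" "k - j + 1"]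
        unfolding side_grid_point by (simp add: algebra_simps)
      then show "x \<in> {grid_point (k - 1) 1, grid_point (k - 1) (- 1), grid_point (k + 1) 1, grid_point (k + 1) (- 1)}"
        using grid_point_eq_iff[of j z _ z] x by blast
    next
      fix x assume "x \<in> {grid_point (k - 1) 1, grid_point (k - 1) (- 1), grid_point (k + 1) 1, grid_point (k + 1) (- 1)}"
      then show "x \<in> {u \<in> prism_vertices. side k \<bullet> u = 1}"
        using prism_in(1) k by (auto simp: side_grid_point)
    qed
    then show ?thesis using small_not_dvd by (simp add: grid_point_eq_iff)
  qed
  then show "card {u \<in> prism_vertices. side 1 \<bullet> u = 1} = 4"
    "card {u \<in> prism_vertices. side (- 1) \<bullet> u = 1} = 4" by simp_all
qed

theorem prism_realised: "\<exists>V E. archimedean V E \<and> vertex_symbol V E [4, 4, m]"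
proof (rule symbol_realised[OF prism_finite])
  show "prism_vertices \<noteq> {}" using prism_in(1)[of 0 1] by auto
next
  fix v f assume v: "v \<in> prism_vertices" and f: "f \<in> prism_facets"
  obtain i z where i: "v = grid_point i z" "even i" "z = 1 \<or> z = - 1" using v by (rule prism_vertexE)
  from f show "f \<bullet> v \<le> 1"
  proof (cases rule: prism_facetE)
    case (1 j)
    then show ?thesis using cos_grid_point_odd[of "j - i"] i beta_bounds(3) by (simp add: side_inner)
  next
    case (2 y)
    then show ?thesis using i by (auto simp: pole_grid_point)
  qed
next
  fix f assume "f \<in> prism_facets"
  then show "\<exists>v\<in>prism_vertices. f \<bullet> v = 1"
  proof (cases rule: prism_facetE)
    case (1 j)
    then have "f \<bullet> grid_point (j - 1) 1 = 1" by (simp add: side_grid_point)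
    moreover have "grid_point (j - 1) 1 \<in> prism_vertices" using 1(2) by (intro prism_in) auto
    ultimately show ?thesis by (rule bexI)
  next
    case (2 y)
    then have "f \<bullet> grid_point 0 y = 1" by (auto simp: pole_grid_point)
    moreover have "grid_point 0 y \<in> prism_vertices" using 2(2) by (intro prism_in) auto
    ultimately show ?thesis by (rule bexI)
  qed
next
  fix v assume v: "v \<in> prism_vertices"
  let ?Q = "fan_with_symbol prism_vertices prism_facets [4, 4, m]"
  have "same_cyclic [4, 4, m] [4, m, 4]" unfolding same_cyclic_def by (rule exI[of _ 1]) simp
  then have "?Q (grid_point 0 1)" unfolding fan_with_symbol_def
    using prism_corner_fan prism_degrees by (intro exI conjI) (assumption, simp)
  then have top: "?Q (grid_point j 1)" if "even j" for j
    using fan_with_symbol_rotate[OF prism_symmetry(1)[OF that]] spin_grid_point1[of j 0 1] by fastforce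
  obtain i z where i: "v = grid_point i z" "even i" "z = 1 \<or> z = - 1" using v by (rule prism_vertexE)
  show "?Q v"
  proof (cases "z = 1")
    case False
    have "half_turn (of_int 0 * \<beta>) (grid_point (0 - i) 1) = grid_point (0 - (0 - i)) (- 1)" by (rule half_turn_grid_point1)
    then have "half_turn (of_int 0 * \<beta>) (grid_point (0 - i) 1) = v" using i False by simp
    then show ?thesis using fan_with_symbol_rotate[OF prism_symmetry(2) top[of "0 - i"]] i(2) by simp
  qed (use top i in simp)
qed

definition alt_sign :: "int \<Rightarrow> real" where "alt_sign j = (if even j then 1 else - 1)"

lemma alt_sign_simps: "alt_sign (j + k) = alt_sign j * alt_sign k" "alt_sign (j - k) = alt_sign j * alt_sign k" "alt_sign (- j) = alt_sign j"
  "alt_sign 0 = 1" "alt_sign 1 = - 1" "alt_sign 2 = 1"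
  by (auto simp: alt_sign_def)

lemma alt_sign_cong: "2 * int m dvd j - i \<Longrightarrow> alt_sign j = alt_sign i"
proof -
  assume "2 * int m dvd j - i"
  then have "even (j - i)" by (metis dvd_trans dvd_triv_left)
  then show "alt_sign j = alt_sign i" by (auto simp: alt_sign_def)
qed

text \<open>
  The vertices of the antiprism go around alternately above and below the equator.
\<close>

definition zigzag :: "int \<Rightarrow> real^3" where "zigzag j = grid_point j (alt_sign j)"

text \<open>
  The height is the one for which the form \<open>tri_facet j\<close> takes the same value at the
  vertex \<open>zigzag j\<close> and at its two neighbours on the other side of the equator; this
  value is \<open>(1 + cos \<beta>) / 2\<close> before scaling.
\<close>

definition tri_facet_height :: real where "tri_facet_height = - (1 - cos \<beta>) / 2"

definition tri_facet :: "int \<Rightarrow> real^3" where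
  "tri_facet j = (2 / (1 + cos \<beta>)) *\<^sub>R grid_point j (tri_facet_height * alt_sign j)"

definition antiprism_facets :: "(real^3) set" where
  "antiprism_facets = range tri_facet \<union> {pole z | z. z = 1 \<or> z = - 1}"

lemma zigzag_eq_iff: "zigzag j = zigzag i \<longleftrightarrow> 2 * int m dvd j - i"
  unfolding zigzag_def grid_point_eq_iff using alt_sign_cong by blast

lemma tri_facet_eq: "2 * int m dvd j - i \<Longrightarrow> tri_facet j = tri_facet i"
  unfolding tri_facet_def using alt_sign_cong grid_point_eq_iff by metis

lemma pole_zigzag: "pole z \<bullet> zigzag j = z * alt_sign j"
  unfolding zigzag_def by (rule pole_grid_point)

lemma tri_facet_zigzag:
  "tri_facet j \<bullet> zigzag i = 1 \<longleftrightarrow> 2 * int m dvd j - i \<or> 2 * int m dvd j - i - 1 \<or> 2 * int m dvd j - i + 1"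
  "tri_facet j \<bullet> zigzag i \<le> 1"
proof -
  let ?d = "j - i"
  have C: "0 < 1 + cos \<beta>" using beta_bounds by simp
  have "grid_point j (tri_facet_height * alt_sign j) \<bullet> zigzag i = cos (of_int ?d * \<beta>) + tri_facet_height * alt_sign ?d"
    unfolding zigzag_def grid_point_inner alt_sign_simps by simp
  then have e: "tri_facet j \<bullet> zigzag i = 2 * (cos (of_int ?d * \<beta>) + tri_facet_height * alt_sign ?d) / (1 + cos \<beta>)"
    unfolding tri_facet_def by simp
  have h: "2 * tri_facet_height = cos \<beta> - 1" by (simp add: tri_facet_height_def)
  have ev: "even k" if "2 * int m dvd k" for k using that by (metis dvd_trans dvd_triv_left)
  have "(tri_facet j \<bullet> zigzag i = 1 \<longleftrightarrow> 2 * int m dvd ?d \<or> 2 * int m dvd ?d - 1 \<or> 2 * int m dvd ?d + 1) \<and> tri_facet j \<bullet> zigzag i \<le> 1"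
  proof (cases "even ?d")
    case True
    have t: "tri_facet j \<bullet> zigzag i = (2 * cos (of_int ?d * \<beta>) - 1 + cos \<beta>) / (1 + cos \<beta>)"
      unfolding e using True by (simp add: alt_sign_def tri_facet_height_def)
    have "tri_facet j \<bullet> zigzag i = 1 \<longleftrightarrow> cos (of_int ?d * \<beta>) = 1" unfolding t using C by (auto simp: field_simps)
    also have "\<dots> \<longleftrightarrow> 2 * int m dvd ?d" using cos_grid_point[of ?d 0] by simp
    finally have 1: "tri_facet j \<bullet> zigzag i = 1 \<longleftrightarrow> 2 * int m dvd ?d" .
    have "tri_facet j \<bullet> zigzag i \<le> 1" unfolding t using C by (simp add: field_simps)
    moreover have "\<not> 2 * int m dvd ?d - 1" "\<not> 2 * int m dvd ?d + 1" using ev[of "?d - 1"] ev[of "?d + 1"] True by auto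
    ultimately show ?thesis using 1 by blast
  next
    case False
    have t: "tri_facet j \<bullet> zigzag i = (2 * cos (of_int ?d * \<beta>) + 1 - cos \<beta>) / (1 + cos \<beta>)"
      unfolding e using False h by (simp add: alt_sign_def right_diff_distrib)
    have "tri_facet j \<bullet> zigzag i = 1 \<longleftrightarrow> cos (of_int ?d * \<beta>) = cos \<beta>" unfolding t using C by (auto simp: field_simps)
    also have "\<dots> \<longleftrightarrow> 2 * int m dvd ?d - 1 \<or> 2 * int m dvd ?d + 1" using cos_grid_point[of ?d 1] by simp
    finally have 1: "tri_facet j \<bullet> zigzag i = 1 \<longleftrightarrow> 2 * int m dvd ?d - 1 \<or> 2 * int m dvd ?d + 1" .
    have "tri_facet j \<bullet> zigzag i \<le> 1" unfolding t using C cos_grid_point_odd[OF False] by (simp add: field_simps)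
    moreover have "\<not> 2 * int m dvd ?d" using ev[of ?d] False by blast
    ultimately show ?thesis using 1 by blast
  qed
  then show "tri_facet j \<bullet> zigzag i = 1 \<longleftrightarrow> 2 * int m dvd j - i \<or> 2 * int m dvd j - i - 1 \<or> 2 * int m dvd j - i + 1"
    "tri_facet j \<bullet> zigzag i \<le> 1" by blast+
qed

lemma antiprism_facetE:
  assumes "x \<in> antiprism_facets"
  obtains j where "x = tri_facet j" | z where "x = pole z" "z = 1 \<or> z = - 1"
  using assms unfolding antiprism_facets_def by blast

lemma antiprism_in: "tri_facet j \<in> antiprism_facets" "z = 1 \<or> z = - 1 \<Longrightarrow> pole z \<in> antiprism_facets"
  unfolding antiprism_facets_def by blast+

lemma antiprism_spin:
  assumes "even k"
  shows "spin (of_int k * \<beta>) (zigzag j) = zigzag (j + k)" "spin (of_int k * \<beta>) (tri_facet j) = tri_facet (j + k)"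
  using assms unfolding zigzag_def tri_facet_def spin_grid_point spin_grid_point1 alt_sign_simps by (simp_all add: alt_sign_def)

lemma antiprism_half_turn:
  "half_turn (of_int 1 * \<beta>) (zigzag j) = zigzag (1 - j)" "half_turn (of_int 1 * \<beta>) (tri_facet j) = tri_facet (1 - j)"
  unfolding zigzag_def tri_facet_def half_turn_grid_point half_turn_grid_point1 alt_sign_simps by simp_all

lemma antiprism_symmetry:
  "even k \<Longrightarrow> rotational_symmetry (range zigzag) antiprism_facets (spin (of_int k * \<beta>))"
  "rotational_symmetry (range zigzag) antiprism_facets (half_turn (of_int 1 * \<beta>))"
proof -
  have s: "spin (of_int k * \<beta>) ` range zigzag \<subseteq> range zigzag"
    "spin (of_int k * \<beta>) ` antiprism_facets \<subseteq> antiprism_facets" if "even k" for k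
  proof -
    show "spin (of_int k * \<beta>) ` range zigzag \<subseteq> range zigzag" using antiprism_spin(1)[OF that] by auto
    show "spin (of_int k * \<beta>) ` antiprism_facets \<subseteq> antiprism_facets"
    proof (rule image_subsetI)
      fix x assume "x \<in> antiprism_facets"
      then show "spin (of_int k * \<beta>) x \<in> antiprism_facets"
        by (cases rule: antiprism_facetE) (use antiprism_in in \<open>simp_all add: antiprism_spin(2)[OF that] spin_pole\<close>)
    qed
  qed
  show "even k \<Longrightarrow> rotational_symmetry (range zigzag) antiprism_facets (spin (of_int k * \<beta>))"
    using spin_symmetry[of "of_int k * \<beta>" "range zigzag" antiprism_facets] s[of k] s[of "- k"] by simp
  show "rotational_symmetry (range zigzag) antiprism_facets (half_turn (of_int 1 * \<beta>))"
  proof (rule half_turn_symmetry)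
    show "half_turn (of_int 1 * \<beta>) ` range zigzag \<subseteq> range zigzag" using antiprism_half_turn(1) by auto
    show "half_turn (of_int 1 * \<beta>) ` antiprism_facets \<subseteq> antiprism_facets"
    proof (rule image_subsetI)
      fix x assume "x \<in> antiprism_facets"
      then show "half_turn (of_int 1 * \<beta>) x \<in> antiprism_facets"
      proof (cases rule: antiprism_facetE)
        case (1 j)
        then show ?thesis using antiprism_in(1) antiprism_half_turn(2) by simp
      next
        case (2 z)
        then show ?thesis using antiprism_in(2)[of "- z"] by (auto simp: spin_pole)
      qed
    qed
  qed
qed

lemma antiprism_finite: "finite (range zigzag)" "finite antiprism_facets"
proof -
  have sgm: "alt_sign (j mod (2 * int m)) = alt_sign j" for j by (simp add: alt_sign_def dvd_mod_iff)
  have "range zigzag = {1 *\<^sub>R grid_point j (alt_sign (j mod (2 * int m))) | j. True}" unfolding sgm zigzag_def by auto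
  then show "finite (range zigzag)" using finite_ring[of 1 alt_sign] by simp
  have "range tri_facet = {(2 / (1 + cos \<beta>)) *\<^sub>R grid_point j ((\<lambda>j. tri_facet_height * alt_sign j) (j mod (2 * int m))) | j. True}"
    unfolding sgm tri_facet_def by auto
  then have "finite (range tri_facet)" using finite_ring[of "2 / (1 + cos \<beta>)" "\<lambda>j. tri_facet_height * alt_sign j"] by simp
  then show "finite antiprism_facets" unfolding antiprism_facets_def sign_set by (simp add: Collect_disj_eq setcompr_eq_image)
qed

lemma zigzag_triple:
  "zigzag 0 \<bullet> cross3 (zigzag i) (zigzag j)
    = sin (of_int i * \<beta>) * alt_sign j - alt_sign i * sin (of_int j * \<beta>) + sin (of_int (j - i) * \<beta>)"
  unfolding zigzag_def grid_point_triple alt_sign_simps by simp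

lemma antiprism_corner_fan:
  "corner_fan (range zigzag) antiprism_facets (zigzag 0) [zigzag 1, zigzag 2, zigzag (- 2), zigzag (- 1)] [tri_facet 1, pole 1, tri_facet (- 1), tri_facet 0]"
proof -
  have "{f \<in> antiprism_facets. f \<bullet> zigzag 0 = 1} = {tri_facet 1, pole 1, tri_facet (- 1), tri_facet 0}"
  proof (intro set_eqI iffI)
    fix x assume "x \<in> {f \<in> antiprism_facets. f \<bullet> zigzag 0 = 1}"
    then have x: "x \<in> antiprism_facets" "x \<bullet> zigzag 0 = 1" by auto
    from x(1) show "x \<in> {tri_facet 1, pole 1, tri_facet (- 1), tri_facet 0}"
    proof (cases rule: antiprism_facetE)
      case (1 j)
      then have "2 * int m dvd j - 0 \<or> 2 * int m dvd j - 1 \<or> 2 * int m dvd j - (- 1)" using x(2) by (simp add: tri_facet_zigzag)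
      then show ?thesis using tri_facet_eq[of j 0] tri_facet_eq[of j 1] tri_facet_eq[of j "- 1"] 1 by blast
    next
      case (2 z)
      then show ?thesis using x(2) by (simp add: pole_zigzag alt_sign_simps)
    qed
  next
    fix x assume "x \<in> {tri_facet 1, pole 1, tri_facet (- 1), tri_facet 0}"
    then show "x \<in> {f \<in> antiprism_facets. f \<bullet> zigzag 0 = 1}"
      using antiprism_in by (auto simp: tri_facet_zigzag pole_zigzag alt_sign_simps)
  qed
  moreover have "0 < sin (2 * \<beta>) - sin (- (2 * \<beta>)) + sin (- (4 * \<beta>))"
  proof -
    have "sin (4 * \<beta>) = 2 * sin (2 * \<beta>) * cos (2 * \<beta>)" using sin_double[of "2 * \<beta>"] by simp
    then have "sin (2 * \<beta>) - sin (- (2 * \<beta>)) + sin (- (4 * \<beta>)) = 2 * sin (2 * \<beta>) * (1 - cos (2 * \<beta>))"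
      by (simp add: algebra_simps)
    then show ?thesis using beta_bounds by simp
  qed
  moreover have "alt_sign (- 1) = - 1" "alt_sign (- 2) = 1" by (simp_all add: alt_sign_def)
  ultimately show ?thesis
    using beta_bounds small_not_dvd
    by (intro corner_fan_4) (simp_all add: tri_facet_zigzag pole_zigzag alt_sign_simps zigzag_triple)
qed

lemma antiprism_degrees:
  "card {u \<in> range zigzag. pole 1 \<bullet> u = 1} = m" "card {u \<in> range zigzag. tri_facet j \<bullet> u = 1} = 3"
proof -
  have "{u \<in> range zigzag. pole 1 \<bullet> u = 1} = {grid_point j 1 | j. even j}"
    unfolding zigzag_def by (auto simp: pole_grid_point alt_sign_def split: if_splits)
  then show "card {u \<in> range zigzag. pole 1 \<bullet> u = 1} = m" using even_ring_card by simp
  have "{u \<in> range zigzag. tri_facet j \<bullet> u = 1} = {zigzag j, zigzag (j - 1), zigzag (j + 1)}"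
  proof (intro set_eqI iffI)
    fix x assume "x \<in> {u \<in> range zigzag. tri_facet j \<bullet> u = 1}"
    then obtain i where i: "x = zigzag i" "tri_facet j \<bullet> zigzag i = 1" by auto
    have "2 * int m dvd i - j \<or> 2 * int m dvd i - (j - 1) \<or> 2 * int m dvd i - (j + 1)"
      using i(2) dvd_minus_iff[of "2 * int m" "j - i"] dvd_minus_iff[of "2 * int m" "j - i - 1"]
        dvd_minus_iff[of "2 * int m" "j - i + 1"]
      unfolding tri_facet_zigzag by (simp add: algebra_simps)
    then show "x \<in> {zigzag j, zigzag (j - 1), zigzag (j + 1)}" using i(1) zigzag_eq_iff by blast
  qed (auto simp: tri_facet_zigzag)
  then show "card {u \<in> range zigzag. tri_facet j \<bullet> u = 1} = 3" using small_not_dvd by (simp add: zigzag_eq_iff)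
qed

theorem antiprism_realised: "\<exists>V E. archimedean V E \<and> vertex_symbol V E [3, 3, 3, m]"
proof (rule symbol_realised[OF antiprism_finite])
  show "range zigzag \<noteq> {}" by auto
next
  fix v f assume v: "v \<in> range zigzag" and f: "f \<in> antiprism_facets"
  obtain i where i: "v = zigzag i" using v by auto
  from f show "f \<bullet> v \<le> 1"
  proof (cases rule: antiprism_facetE)
    case (1 j)
    then show ?thesis using tri_facet_zigzag(2) i by simp
  next
    case (2 y)
    then show ?thesis using i by (auto simp: pole_zigzag alt_sign_def)
  qed
next
  fix f assume "f \<in> antiprism_facets"
  then show "\<exists>v\<in>range zigzag. f \<bullet> v = 1"
  proof (cases rule: antiprism_facetE)
    case (1 j)
    then have "f \<bullet> zigzag j = 1" by (simp add: tri_facet_zigzag)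
    then show ?thesis by blast
  next
    case (2 y)
    then have "f \<bullet> zigzag (if y = 1 then 0 else 1) = 1" by (auto simp: pole_zigzag alt_sign_simps)
    then show ?thesis by blast
  qed
next
  fix v assume v: "v \<in> range zigzag"
  let ?Q = "fan_with_symbol (range zigzag) antiprism_facets [3, 3, 3, m]"
  have "same_cyclic [3, 3, 3, m] [3, m, 3, 3]" unfolding same_cyclic_def
    by (rule exI[of _ 2]) (simp add: numeral_2_eq_2)
  then have "?Q (zigzag 0)" unfolding fan_with_symbol_def
    using antiprism_corner_fan antiprism_degrees by (intro exI conjI) (assumption, simp)
  then have ev: "?Q (zigzag j)" if "even j" for j
    using fan_with_symbol_rotate[OF antiprism_symmetry(1)[OF that]] antiprism_spin(1)[OF that, of 0] by fastforce
  obtain i where i: "v = zigzag i" using v by auto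
  show "?Q v"
  proof (cases "even i")
    case False
    then have "?Q (zigzag (1 - i))" using ev by simp
    from fan_with_symbol_rotate[OF antiprism_symmetry(2) this] show ?thesis
      unfolding antiprism_half_turn i by simp
  qed (use ev i in simp)
qed

end

section \<open>Counting faces\<close>

text \<open>
  Stereographic projection from a point off the curve carries the Jordan curve theorem from the
  plane to the sphere. It is enough to separate the complement into two open parts that both come
  close to the given point of the curve: the image \<open>A\<close> of the inside is closed off by
  the curve, as the inside has compact closure.
\<close>

lemma sphere_jordan:
  fixes c :: "real \<Rightarrow> real^3"
  assumes c: "simple_path c" "pathfinish c = pathstart c" "path_image c \<subseteq> S2"
    and p: "p \<in> S2" "p \<notin> path_image c" and x: "x \<in> path_image c"
  obtains A B where "openin (top_of_set (S2 - path_image c)) A" "openin (top_of_set (S2 - path_image c)) B"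
    "A \<union> B = S2 - path_image c" "A \<inter> B = {}" "x \<in> closure A" "x \<in> closure B"
proof -
  have "(S2 - {p}) homeomorphic (UNIV :: complex set)"
    by (rule homeomorphic_punctured_sphere_affine) (use p in auto)
  then obtain f g where fg: "homeomorphism (S2 - {p}) (UNIV :: complex set) f g"
    unfolding homeomorphic_def by blast
  let ?C = "path_image c"
  have Cp: "?C \<subseteq> S2 - {p}" using c(3) p(2) by blast
  have contf: "continuous_on (S2 - {p}) f" and contg: "continuous_on UNIV g"
    and gf: "\<And>y. y \<in> S2 - {p} \<Longrightarrow> g (f y) = y" and fg': "\<And>z. f (g z) = z"
    and gim: "range g = S2 - {p}"
    using fg unfolding homeomorphism_def by auto
  have injf: "inj_on f ?C" using gf Cp by (metis inj_on_inverseI subsetD)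
  have sp: "simple_path (f \<circ> c)"
    using c(1) continuous_on_subset[OF contf Cp] injf by (rule simple_path_continuous_image)
  have lp: "pathfinish (f \<circ> c) = pathstart (f \<circ> c)" using c(2) by (simp add: pathfinish_def pathstart_def)
  define C' where "C' = path_image (f \<circ> c)"
  have C': "C' = f ` ?C" unfolding C'_def by (simp add: path_image_compose)
  have gC': "g ` C' = ?C" unfolding C' image_image using gf Cp by (force simp: image_iff)
  have J: "open (inside C')" "open (outside C')" "bounded (inside C')"
    "inside C' \<inter> outside C' = {}" "inside C' \<union> outside C' = - C'"
    "frontier (inside C') = C'" "frontier (outside C') = C'"
    using Jordan_inside_outside[OF sp lp] unfolding C'_def by auto
  define A where "A = g ` inside C'"
  have injg: "inj g" using fg' by (metis injI)
  have clI: "closure (inside C') = inside C' \<union> C'"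
    using J(6) closure_Un_frontier[of "inside C'"] by simp
  have "compact (closure (inside C'))" using J(3) by simp
  then have "compact (g ` closure (inside C'))"
    using compact_continuous_image continuous_on_subset[OF contg] by blast
  then have clo: "closed (A \<union> ?C)" unfolding clI image_Un gC' A_def by (rule compact_imp_closed)
  have AC: "A \<inter> ?C = {}"
  proof -
    have "inside C' \<inter> C' = {}" using J(5) by blast
    then show ?thesis unfolding A_def gC'[symmetric] using injg by (simp add: image_Int[symmetric])
  qed
  have AS: "A \<subseteq> S2 - {p}" unfolding A_def using gim by blast
  have "openin (top_of_set (S2 - {p})) A"
  proof -
    have "A = (S2 - {p}) \<inter> f -` inside C'" 
    proof (intro set_eqI iffI)
      fix y assume "y \<in> A" then show "y \<in> (S2 - {p}) \<inter> f -` inside C'" using AS fg' unfolding A_def by auto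
    next
      fix y assume "y \<in> (S2 - {p}) \<inter> f -` inside C'"
      then show "y \<in> A" unfolding A_def using gf[of y] by (metis IntD1 IntD2 imageI vimageD)
    qed
    then show ?thesis using continuous_openin_preimage_gen[OF contf J(1)] by simp
  qed
  moreover have "openin (top_of_set S2) (S2 - {p})"
    by (metis closed_singleton closedin_closed_Int openin_diff openin_subtopology_self Int_insert_right inf_bot_right p(1))
  ultimately have opS: "openin (top_of_set S2) A" using openin_trans by blast
  have A1: "openin (top_of_set (S2 - ?C)) A"
    by (rule openin_subset_trans[OF opS]) (use AS AC in auto)
  have A2: "openin (top_of_set (S2 - ?C)) ((S2 - ?C) - A)"
  proof -
    have "(S2 - ?C) - A = (S2 - ?C) \<inter> - (A \<union> ?C)" by blast
    then show ?thesis using clo by (metis open_Compl openin_open_Int)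
  qed
  have inC': "f x \<in> C'" using x C' by blast
  have gfx: "g (f x) = x" using gf x Cp by blast
  have "f x \<in> closure (inside C')" using inC' clI by blast
  then have xA: "x \<in> closure A"
    using image_closure_subset[OF continuous_on_subset[OF contg] closed_closure closure_subset, of "inside C'"] gfx
    unfolding A_def by (metis image_subset_iff subset_UNIV)
  have "f x \<in> closure (outside C')" using inC' J(7) closure_Un_frontier by blast
  then have "x \<in> closure (g ` outside C')"
    using image_closure_subset[OF continuous_on_subset[OF contg] closed_closure closure_subset, of "outside C'"] gfx
    by (metis image_subset_iff subset_UNIV)
  moreover have "g ` outside C' \<subseteq> (S2 - ?C) - A"
  proof -
    have "outside C' \<inter> (inside C' \<union> C') = {}" using J(4,5) by blast
    then have "g ` outside C' \<inter> (A \<union> ?C) = {}"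
      unfolding A_def gC'[symmetric] image_Un[symmetric] image_Int[OF injg, symmetric] by simp
    then show ?thesis using gim by blast
  qed
  ultimately have xB: "x \<in> closure ((S2 - ?C) - A)" using closure_mono by blast
  show ?thesis
    by (rule that[OF A1 A2 _ _ xA xB]) (use AS AC in auto)
qed

text \<open>
  Together with an arc in \<open>K\<close>, the new edge \<open>g\<close> forms a simple closed
  curve, and the two parts of its complement both come close to the midpoint of \<open>g\<close>.
  There they belong to the same face of \<open>H\<close>, which is therefore split. The map that
  sends each new face to the old face around it is onto, and identifies two new faces.
\<close>

lemma edge_splits_face:
  fixes H :: "(real^3) set"
  assumes H: "closed H" and g: "arc g" "path_image g \<subseteq> S2" "path_image g \<inter> H = {pathstart g, pathfinish g}"
    and K: "path_connected K" "K \<subseteq> H" "K \<subseteq> S2" "pathstart g \<in> K" "pathfinish g \<in> K"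
    and ne: "S2 - (H \<union> path_image g) \<noteq> {}"
    and fin: "finite (components (S2 - (H \<union> path_image g)))"
  shows "finite (components (S2 - H)) \<and>
    card (components (S2 - H)) + 1 \<le> card (components (S2 - (H \<union> path_image g)))"
proof -
  let ?e = "path_image g" and ?u = "pathstart g" and ?v = "pathfinish g"
  let ?W = "S2 - (H \<union> path_image g)"
  have uv: "?u \<noteq> ?v" using arc_distinct_ends[OF g(1)] by simp
  obtain d where d: "arc d" "path_image d \<subseteq> K" "pathstart d = ?v" "pathfinish d = ?u"
    using K(1)[unfolded path_connected_arcwise] K(4,5) uv by metis
  define c where "c = g +++ d"
  have "path_image g \<inter> path_image d \<subseteq> {?u, ?v}" using g(3) d(2) K(2) by blast
  then have sc: "simple_path c" unfolding c_def
    using simple_path_join_loop[OF g(1) d(1)] d by simp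
  have lc: "pathfinish c = pathstart c" unfolding c_def using d by simp
  have Cim: "path_image c = ?e \<union> path_image d" unfolding c_def using d by (simp add: path_image_join)
  have CS: "path_image c \<subseteq> S2" using Cim g(2) d(2) K(3) by blast
  have CH: "path_image c \<subseteq> H \<union> ?e" using Cim d(2) K(2) by blast
  obtain p where p: "p \<in> S2" "p \<notin> path_image c" using ne CH by blast
  let ?o = "g ` {0<..<1}"
  have inj: "inj_on g {0..1}" using g(1) unfolding arc_def by blast
  have oe: "?o = ?e - {?u, ?v}"
  proof (intro set_eqI iffI)
    fix y assume "y \<in> ?o"
    then obtain t where t: "y = g t" "0 < t" "t < 1" by auto
    have "g t \<noteq> g 0" "g t \<noteq> g 1" using inj_onD[OF inj, of t 0] inj_onD[OF inj, of t 1] t by auto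
    then show "y \<in> ?e - {?u, ?v}" using t unfolding path_image_def pathstart_def pathfinish_def by auto
  next
    fix y assume "y \<in> ?e - {?u, ?v}"
    then obtain t where t: "y = g t" "0 \<le> t" "t \<le> 1" "y \<noteq> g 0" "y \<noteq> g 1"
      unfolding path_image_def pathstart_def pathfinish_def by auto
    then have "t \<noteq> 0" "t \<noteq> 1" by auto
    then show "y \<in> ?o" using t by auto
  qed
  have oH: "?o \<subseteq> S2 - H" using oe g(2,3) by blast
  have "connected ?o"
    using connected_continuous_image[of "{0<..<1}" g] continuous_on_subset[of "{0..1}" g "{0<..<1}"] g(1)
    unfolding arc_def path_def by fastforce
  define x where "x = g (1 / 2)"
  have xo: "x \<in> ?o" unfolding x_def by auto
  have xc: "x \<in> path_image c" using xo oe Cim by blast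
  obtain A B where AB: "openin (top_of_set (S2 - path_image c)) A" "openin (top_of_set (S2 - path_image c)) B"
    "A \<union> B = S2 - path_image c" "A \<inter> B = {}" "x \<in> closure A" "x \<in> closure B"
    using sphere_jordan[OF sc lc CS p xc] .
  let ?L = "connected_component_set (S2 - H) x"
  have xL: "x \<in> ?L" using xo oH by auto
  have Lcomp: "?L \<in> components (S2 - H)" using xo oH by (auto simp: components_def)
  have "openin (top_of_set S2) (S2 - H)" using openin_open_Int[of "- H" S2] H by (simp add: Diff_eq open_Compl)
  moreover have "locally connected (S2 - H)"
    using locally_open_subset[OF locally_connected_sphere] calculation by blast
  then have "openin (top_of_set (S2 - H)) ?L"
    using openin_components_locally_connected Lcomp by blast
  ultimately have "openin (top_of_set S2) ?L" using openin_trans by blast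
  then obtain U where U: "open U" "?L = S2 \<inter> U" by (metis openin_open)
  have "x \<in> U" using xL U by blast
  then have "U \<inter> A \<noteq> {}" "U \<inter> B \<noteq> {}"
    using AB(5,6) open_Int_closure_eq_empty[OF U(1), of A] open_Int_closure_eq_empty[OF U(1), of B] by blast+
  then obtain y z where yz: "y \<in> A" "y \<in> U" "z \<in> B" "z \<in> U" by blast
  have eC: "?e \<subseteq> path_image c" using Cim by blast
  have yW: "y \<in> ?L" "y \<in> ?W" and zW: "z \<in> ?L" "z \<in> ?W"
  proof -
    have "y \<in> S2 - path_image c" "z \<in> S2 - path_image c" using yz AB(3) by blast+
    then show "y \<in> ?L" "z \<in> ?L" using yz U by blast+
    then have "y \<in> S2 - H" "z \<in> S2 - H" using connected_component_subset by blast+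
    then show "y \<in> ?W" "z \<in> ?W" using \<open>y \<in> S2 - path_image c\<close> \<open>z \<in> S2 - path_image c\<close> eC by blast+
  qed
  let ?Y = "connected_component_set ?W y" and ?Z = "connected_component_set ?W z"
  have YZ: "?Y \<in> components ?W" "?Z \<in> components ?W" using yW zW by (auto simp: components_def)
  have "?Y \<noteq> ?Z"
  proof
    assume "?Y = ?Z"
    then have "z \<in> ?Y" using zW by auto
    have sub: "?Y \<subseteq> S2 - path_image c" using connected_component_subset[of ?W y] CH by blast
    obtain U1 where U1: "open U1" "A = (S2 - path_image c) \<inter> U1" using AB(1) by (metis openin_open)
    obtain U2 where U2: "open U2" "B = (S2 - path_image c) \<inter> U2" using AB(2) by (metis openin_open)
    have "connected ?Y" by simp
    moreover have "?Y \<subseteq> U1 \<union> U2" using sub AB(3) U1 U2 by blast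
    moreover have "U1 \<inter> U2 \<inter> ?Y = {}" using sub AB(4) U1 U2 by blast
    moreover have "U1 \<inter> ?Y \<noteq> {}" using yz(1) U1 yW by auto
    moreover have "U2 \<inter> ?Y \<noteq> {}" using yz(3) U2 \<open>z \<in> ?Y\<close> by blast
    ultimately show False using U1(1) U2(1) unfolding connected_def by blast
  qed
  have sub: "?W \<subseteq> S2 - H" by blast
  \<comment> \<open>The old face around the new face \<open>M\<close>, found from an arbitrary point of \<open>M\<close>.\<close>
  define \<phi> where "\<phi> M = connected_component_set (S2 - H) (SOME q. q \<in> M)" for M
  have \<phi>: "\<phi> (connected_component_set ?W q) = connected_component_set (S2 - H) q" if q: "q \<in> ?W" for q
  proof -
    let ?s = "SOME r. r \<in> connected_component_set ?W q"
    have "q \<in> connected_component_set ?W q" using q by auto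
    then have "?s \<in> connected_component_set ?W q" by (rule someI)
    then have "?s \<in> connected_component_set (S2 - H) q" using connected_component_mono[OF sub] by blast
    then show ?thesis unfolding \<phi>_def by (metis connected_component_eq)
  qed
  have surj: "\<exists>q\<in>?W. M = connected_component_set (S2 - H) q" if M: "M \<in> components (S2 - H)" for M
  proof (cases "M \<inter> ?e = {}")
    case True
    obtain q where q: "q \<in> S2 - H" "M = connected_component_set (S2 - H) q" using M by (auto simp: components_def)
    then have "q \<in> M" by auto
    then show ?thesis using True q by blast
  next
    case False
    then obtain w where w: "w \<in> M" "w \<in> ?e" by blast
    have "w \<in> S2 - H" using w(1) M in_components_subset by blast
    then have "w \<in> ?o" using w(2) oe g(3) by blast
    then have "connected_component (S2 - H) x w"
      using \<open>connected ?o\<close> oH xo unfolding connected_component_def by blast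
    then have "w \<in> ?L" by simp
    then have "M = ?L" using components_eq[OF M Lcomp] w(1) by blast
    then show ?thesis using connected_component_eq[OF yW(1)] yW(2) by blast
  qed
  have "\<phi> ?Y = \<phi> ?Z" using \<phi>[OF yW(2)] \<phi>[OF zW(2)] connected_component_eq yW(1) zW(1) by metis
  have img: "components (S2 - H) \<subseteq> \<phi> ` (components ?W - {?Z})"
  proof
    fix M assume "M \<in> components (S2 - H)"
    then obtain q where q: "q \<in> ?W" "M = connected_component_set (S2 - H) q" using surj by blast
    have comp: "connected_component_set ?W q \<in> components ?W" using q by (auto simp: components_def)
    show "M \<in> \<phi> ` (components ?W - {?Z})"
    proof (cases "connected_component_set ?W q = ?Z")
      case True
      then have "M = \<phi> ?Y" using \<phi>[OF q(1)] q(2) \<open>\<phi> ?Y = \<phi> ?Z\<close> by simp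
      then show ?thesis using YZ \<open>?Y \<noteq> ?Z\<close> by blast
    next
      case False
      then show ?thesis using \<phi>[OF q(1)] q(2) comp by blast
    qed
  qed
  have finD: "finite (components ?W - {?Z})" using fin by simp
  have "finite (components (S2 - H))" using img finD by (meson finite_imageI finite_subset)
  moreover have "card (components (S2 - H)) \<le> card (components ?W - {?Z})"
    using card_mono[OF finite_imageI[OF finD] img] card_image_le[OF finD, of \<phi>] by linarith
  moreover have "card (components ?W - {?Z}) + 1 = card (components ?W)"
    using YZ(2) fin by (metis Suc_eq_plus1 card_Suc_Diff1)
  ultimately show ?thesis by linarith
qed

lemma embedded_graphD:
  assumes "embedded_graph V E"
  shows "finite V" "V \<noteq> {}" "V \<subseteq> S2" "finite E" "\<And>e. e \<in> E \<Longrightarrow> e \<subseteq> S2"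
    "\<And>e. e \<in> E \<Longrightarrow> \<exists>g. arc g \<and> path_image g = e \<and> e \<inter> V = {pathstart g, pathfinish g}"
    "\<And>e e'. e \<in> E \<Longrightarrow> e' \<in> E \<Longrightarrow> e \<noteq> e' \<Longrightarrow> e \<inter> e' \<subseteq> V"
  using assms unfolding embedded_graph_def by simp_all

lemma edges_disjoint_from_graph:
  assumes emb: "embedded_graph V E" and F: "F \<subseteq> E" and e: "e \<in> E" "e \<notin> F"
    and g: "path_image g = e" "e \<inter> V = {pathstart g, pathfinish g}"
  shows "path_image g \<inter> graph_points V F = {pathstart g, pathfinish g}"
proof -
  have "e \<inter> e' \<subseteq> V" if "e' \<in> F" for e'
    using embedded_graphD(7)[OF emb e(1), of e'] F e(2) that by blast
  then have "e \<inter> graph_points V F = e \<inter> V" unfolding graph_points_def by blast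
  then show ?thesis using g by simp
qed

lemma closed_graph_points:
  assumes emb: "embedded_graph V E" and F: "F \<subseteq> E"
  shows "closed (graph_points V F)"
proof -
  have "closed e" if "e \<in> E" for e
    using embedded_graphD(6)[OF emb that] by (metis arc_imp_path closed_path_image)
  moreover have "finite F" "finite V" using embedded_graphD(1,4)[OF emb] F finite_subset by blast+
  ultimately show ?thesis unfolding graph_points_def using F by (intro closed_Un closed_Union finite_imp_closed) auto
qed

text \<open>
  A tree grows one vertex at a time: as long as vertices are missing, some edge leads from the tree
  to a missing vertex, since otherwise the graph would be the union of two disjoint closed sets.
\<close>

lemma subtree_exists:
  assumes emb: "embedded_graph V E" and con: "connected (graph_points V E)"
    and n: "1 \<le> n" "n \<le> card V"
  shows "\<exists>W T. W \<subseteq> V \<and> T \<subseteq> E \<and> card W = n \<and> card T + 1 = n \<and>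
    path_connected (graph_points W T) \<and> (\<forall>e\<in>T. e \<inter> V \<subseteq> W)"
  using n
proof (induction n rule: dec_induct)
  case base
  obtain v where "v \<in> V" using embedded_graphD(2)[OF emb] by blast
  then show ?case by (intro exI[of _ "{v}"] exI[of _ "{}"]) (simp add: graph_points_def)
next
  case (step n)
  then obtain W T where WT: "W \<subseteq> V" "T \<subseteq> E" "card W = n" "card T + 1 = n" "path_connected (graph_points W T)"
    "\<forall>e\<in>T. e \<inter> V \<subseteq> W" by auto
  note finV = embedded_graphD(1,4)[OF emb]
  have "W \<noteq> {}" using WT(3) step.hyps by auto
  have "V - W \<noteq> {}" using WT(1,3) step.prems by auto
  note ends = embedded_graphD(6)[OF emb]
  have "\<exists>e\<in>E. e \<inter> W \<noteq> {} \<and> e \<inter> (V - W) \<noteq> {}"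
  proof (rule ccontr)
    assume no: "\<not> ?thesis"
    let ?E1 = "{e \<in> E. e \<inter> W \<noteq> {}}" and ?E2 = "{e \<in> E. e \<inter> (V - W) \<noteq> {}}"
    have cov: "e \<in> ?E1 \<or> e \<in> ?E2" if e: "e \<in> E" for e
    proof -
      obtain g where "e \<inter> V = {pathstart g, pathfinish g}" using ends[OF e] by blast
      then have "e \<inter> V \<noteq> {}" by simp
      then show ?thesis using e by blast
    qed
    let ?A = "graph_points W ?E1" and ?B = "graph_points (V - W) ?E2"
    have cl: "closed (graph_points X F)" if "X \<subseteq> V" "F \<subseteq> E" for X F
    proof -
      have "closed e" if "e \<in> E" for e using ends[OF that] by (metis arc_imp_path closed_path_image)
      moreover have "finite F" "finite X" using finV that finite_subset by blast+
      ultimately show ?thesis unfolding graph_points_def using that(2)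
        by (intro closed_Un closed_Union finite_imp_closed) auto
    qed
    have "closed ?A" "closed ?B" using WT(1) by (auto intro!: cl)
    moreover have "graph_points V E \<subseteq> ?A \<union> ?B"
    proof
      fix x assume "x \<in> graph_points V E"
      then consider "x \<in> V" | e where "e \<in> E" "x \<in> e" unfolding graph_points_def by blast
      then show "x \<in> ?A \<union> ?B"
      proof cases
        case 1
        then show ?thesis unfolding graph_points_def by blast
      next
        case (2 e)
        then show ?thesis using cov[OF 2(1)] unfolding graph_points_def by blast
      qed
    qed
    moreover have "?A \<inter> ?B \<inter> graph_points V E = {}"
    proof -
      have E12: "e \<inter> e' \<subseteq> V" if "e \<in> ?E1" "e' \<in> ?E2" for e e'
      proof -
        have "e \<noteq> e'" using that no by blast
        then show ?thesis using embedded_graphD(7)[OF emb, of e e'] that by blast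
      qed
      have False if x: "x \<in> ?A" "x \<in> ?B" for x
      proof -
        have "x \<in> W \<or> (\<exists>e\<in>?E1. x \<in> e)" "x \<in> V - W \<or> (\<exists>e\<in>?E2. x \<in> e)"
          using x unfolding graph_points_def by blast+
        then have "x \<in> V" using WT(1) E12 by blast
        then show False using \<open>x \<in> W \<or> _\<close> \<open>x \<in> V - W \<or> _\<close> no by blast
      qed
      then show ?thesis by blast
    qed
    moreover have "?A \<inter> graph_points V E \<noteq> {}" "?B \<inter> graph_points V E \<noteq> {}"
      using \<open>W \<noteq> {}\<close> \<open>V - W \<noteq> {}\<close> WT(1) unfolding graph_points_def by blast+
    ultimately show False using con unfolding connected_closed by blast
  qed
  then obtain e a b where e: "e \<in> E" "a \<in> e" "a \<in> W" "b \<in> e" "b \<in> V" "b \<notin> W" by blast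
  obtain g where g: "arc g" "path_image g = e" "e \<inter> V = {pathstart g, pathfinish g}" using ends[OF e(1)] by blast
  have "a \<in> e \<inter> V" "b \<in> e \<inter> V" "a \<noteq> b" using e WT(1) by auto
  then have ab: "e \<inter> V = {a, b}" unfolding g(3) by auto
  have "e \<notin> T" using WT(6) e by blast
  have "path_connected e" using g by (metis arc_imp_path path_connected_path_image)
  then have "path_connected (graph_points W T \<union> e)"
    using WT(5) e by (intro path_connected_Un) (auto simp: graph_points_def)
  moreover have "graph_points W T \<union> e = graph_points (insert b W) (insert e T)"
    using e(4) unfolding graph_points_def by blast
  moreover have "finite W" "finite T" using finV WT(1,2) finite_subset by blast+
  ultimately show ?case
    using WT e ab \<open>e \<notin> T\<close> by (intro exI[of _ "insert b W"] exI[of _ "insert e T"]) auto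
qed

text \<open>
  The half of Euler's formula that bounds the number of faces from below, up to 1. A spanning tree
  has one edge less than vertices, and each further edge closes a circuit and so creates a face.
\<close>

theorem euler_inequality:
  assumes emb: "embedded_graph V E" and con: "connected (graph_points V E)"
    and fin: "finite (faces V E)" and ne: "faces V E \<noteq> {}"
  shows "card E + 1 \<le> card V + card (faces V E)"
proof -
  have finV: "finite V" "finite E" "V \<noteq> {}" "V \<subseteq> S2" "\<And>e. e \<in> E \<Longrightarrow> e \<subseteq> S2"
    using embedded_graphD[OF emb] by simp_all
  have "1 \<le> card V" using finV by (simp add: Suc_leI card_gt_0_iff)
  then obtain W T where WT: "W \<subseteq> V" "T \<subseteq> E" "card W = card V" "card T + 1 = card V"
     "path_connected (graph_points W T)"
    using subtree_exists[OF emb con, of "card V"] by auto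
  have "W = V" using WT(1,3) finV(1) card_subset_eq by blast
  then have pc: "path_connected (graph_points V T)" using WT(5) by simp
  have "S2 - graph_points V E \<noteq> {}" using ne unfolding faces_def by auto
  have "finite (faces V (T \<union> F)) \<longrightarrow> card F \<le> card (faces V (T \<union> F))" if "finite F" "F \<subseteq> E - T" for F
    using that
  proof (induction F rule: finite_induct)
    case empty
    then show ?case by simp
  next
    case (insert e F)
    have e: "e \<in> E" "e \<notin> T \<union> F" using insert by auto
    have TF: "T \<union> F \<subseteq> E" using insert WT(2) by blast
    obtain g where g: "arc g" "path_image g = e" "e \<inter> V = {pathstart g, pathfinish g}"
      using embedded_graphD(6)[OF emb e(1)] by blast
    let ?H = "graph_points V (T \<union> F)"
    have un: "?H \<union> path_image g = graph_points V (T \<union> insert e F)" unfolding graph_points_def g(2) by blast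
    have K: "graph_points V T \<subseteq> ?H" unfolding graph_points_def by blast
    have KS: "graph_points V T \<subseteq> S2" unfolding graph_points_def using finV(4,5) WT(2) by blast
    have ends: "pathstart g \<in> graph_points V T" "pathfinish g \<in> graph_points V T"
      using g(3) unfolding graph_points_def by blast+
    have "graph_points V (T \<union> insert e F) \<subseteq> graph_points V E" unfolding graph_points_def using TF e by blast
    then have ne': "S2 - (?H \<union> path_image g) \<noteq> {}" unfolding un using \<open>S2 - graph_points V E \<noteq> {}\<close> by blast
    have "path_image g \<subseteq> S2" using g(2) finV(5) e(1) by simp
    note split = edge_splits_face[OF closed_graph_points[OF emb TF] g(1) this
      edges_disjoint_from_graph[OF emb TF e g(2,3)] pc K KS ends ne', unfolded un, folded faces_def]
    show ?case
    proof
      assume "finite (faces V (T \<union> insert e F))"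
      then have "finite (faces V (T \<union> F))" "card (faces V (T \<union> F)) + 1 \<le> card (faces V (T \<union> insert e F))"
        using split by blast+
      moreover have "card F \<le> card (faces V (T \<union> F))" using insert calculation by blast
      ultimately show "card (insert e F) \<le> card (faces V (T \<union> insert e F))" using insert.hyps by simp
    qed
  qed
  from this[of "E - T"] have "card (E - T) \<le> card (faces V E)"
    using fin finV(2) WT(2) by (simp add: Un_absorb1)
  moreover have "card (E - T) = card E - card T" using WT(2) finV(2) by (meson card_Diff_subset finite_subset)
  ultimately show ?thesis using WT(4) by linarith
qed

section \<open>Corners of faces\<close>

lemma near_radius:
  assumes "a < \<theta>" "\<theta> < b"
  obtains W where "open W" "of_real (1/2) * cis \<theta> \<in> W"
    "\<And>z. z \<in> W \<Longrightarrow> \<exists>s x. z = of_real s * cis x \<and> 0 < s \<and> s < 1 \<and> a < x \<and> x < b"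
proof -
  define \<delta> where "\<delta> = min (\<theta> - a) (b - \<theta>)"
  have \<delta>: "0 < \<delta>" using assms unfolding \<delta>_def by simp
  have "isCont Arg (1/2)" by (intro continuous_at_Arg) (auto simp: complex_nonpos_Reals_iff)
  then have "(Arg \<longlongrightarrow> Arg (1/2)) (nhds (1/2))" by (simp add: continuous_at tendsto_nhds_iff)
  then have 1: "eventually (\<lambda>w. dist (Arg w) (Arg (1/2)) < \<delta>) (nhds (1/2))" using \<delta> by (rule tendstoD)
  have 2: "eventually (\<lambda>w::complex. norm w < 1) (nhds (1/2))" "eventually (\<lambda>w::complex. 0 < norm w) (nhds (1/2))"
    using eventually_nhds_in_open[of "{w::complex. norm w < 1}" "1/2"]
      eventually_nhds_in_open[of "- {0::complex}" "1/2"]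
    by (simp_all add: open_Collect_less continuous_on_norm open_Compl)
  obtain D where D: "open D" "1/2 \<in> D" "\<And>w. w \<in> D \<Longrightarrow> dist (Arg w) (Arg (1/2)) < \<delta> \<and> norm w < 1 \<and> 0 < norm w"
    using eventually_conj[OF 1 eventually_conj[OF 2]] unfolding eventually_nhds by blast
  define W where "W = (\<lambda>z. z / cis \<theta>) -` D"
  have "open W" unfolding W_def by (intro open_vimage D continuous_intros) auto
  moreover have "of_real (1/2) * cis \<theta> \<in> W" using D(2) unfolding W_def by simp
  moreover have "\<exists>s x. z = of_real s * cis x \<and> 0 < s \<and> s < 1 \<and> a < x \<and> x < b" if "z \<in> W" for z
  proof -
    let ?w = "z / cis \<theta>"
    have "Arg (1/2) = 0" using Arg_of_real[of "1/2"] by simp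
    then have w: "\<bar>Arg ?w\<bar> < \<delta>" "norm ?w < 1" "0 < norm ?w" using D(3)[of ?w] that unfolding W_def by (auto simp: dist_real_def)
    have "?w = of_real (norm ?w) * cis (Arg ?w)" using rcis_cmod_Arg[of ?w] unfolding rcis_def by simp
    then have "cis \<theta> * ?w = of_real (norm ?w) * (cis \<theta> * cis (Arg ?w))" by (metis mult.left_commute)
    then have "z = of_real (norm ?w) * cis (\<theta> + Arg ?w)" by (simp add: cis_mult)
    moreover have "a < \<theta> + Arg ?w" "\<theta> + Arg ?w < b" using w(1) unfolding \<delta>_def by auto
    ultimately show ?thesis using w(2,3) by blast
  qed
  ultimately show ?thesis by (rule that)
qed

lemma polyhedral_mapD:
  assumes "polyhedral_map V E"
  shows "embedded_graph V E" "connected (graph_points V E)"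
    "\<And>e. e \<in> E \<Longrightarrow> card {f \<in> faces V E. e \<in> face_sides E f} = 2"
    "\<And>v. v \<in> V \<Longrightarrow> vertex_degree E v \<ge> 3" "\<And>f. f \<in> faces V E \<Longrightarrow> face_degree E f \<ge> 3"
  using assms unfolding polyhedral_map_def by simp_all

lemma faces_meet: "f \<in> faces V E \<Longrightarrow> g \<in> faces V E \<Longrightarrow> x \<in> f \<Longrightarrow> x \<in> g \<Longrightarrow> f = g"
  unfolding faces_def using components_eq by blast

text \<open>
  A point of the edge close to the vertex has a neighbourhood that consists of points of the edge
  and of the two adjacent sectors. A face with this edge in its closure meets that neighbourhood, so
  it is one of the faces of these sectors. As the edge has two faces, the two are different.
\<close>

lemma faces_at_edge:
  assumes poly: "polyhedral_map V E" and ga: "going_around V E v es fs" and p: "p < length es"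
  defines "i \<equiv> Suc p mod length es"
  shows "{f \<in> faces V E. es ! i \<in> face_sides E f} = {fs ! p, fs ! i}" "fs ! p \<noteq> fs ! i"
proof -
  let ?r = "length es" and ?e = "es ! i"
  have ga': "distinct es" "set es = {e \<in> E. v \<in> e}" "length fs = ?r" "set fs \<subseteq> faces V E"
    using ga unfolding going_around_def by simp_all
  obtain U h k \<theta> where C: "openin (top_of_set S2) U \<and> v \<in> U \<and>
        homeomorphism U (ball (0::complex) 1) h k \<and> h v = 0 \<and>
        (\<forall>i<?r. \<theta> i < \<theta> (Suc i)) \<and> \<theta> ?r = \<theta> 0 + 2 * pi \<and>
        (\<forall>i<?r. h ` (U \<inter> es ! i) = radius_at (\<theta> i) \<and>
                       sector_between (\<theta> i) (\<theta> (Suc i)) \<subseteq> h ` (U \<inter> fs ! i))"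
    using ga unfolding going_around_def by (elim conjE exE) (rule that, (intro conjI; assumption))
  have U: "openin (top_of_set S2) U" "homeomorphism U (ball (0::complex) 1) h k"
    and inc: "\<And>i. i < ?r \<Longrightarrow> \<theta> i < \<theta> (Suc i)" and full: "\<theta> ?r = \<theta> 0 + 2 * pi"
    and rad: "\<And>i. i < ?r \<Longrightarrow> h ` (U \<inter> es ! i) = radius_at (\<theta> i)"
    and sec: "\<And>i. i < ?r \<Longrightarrow> sector_between (\<theta> i) (\<theta> (Suc i)) \<subseteq> h ` (U \<inter> fs ! i)"
    using C by simp_all
  have i: "i < ?r" unfolding i_def using p by (cases ?r) auto
  have eE: "?e \<in> E" using nth_mem[OF i] ga'(2) by blast
  have fsf: "fs ! p \<in> faces V E" "fs ! i \<in> faces V E" using nth_mem[of _ fs] ga'(3,4) p i by auto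
  \<comment> \<open>The sector before the edge with index 0 is the last one, turned back by a full turn.\<close>
  define a where "a = (if i = 0 then \<theta> p - 2 * pi else \<theta> p)"
  have cases: "(Suc p = i \<and> i \<noteq> 0) \<or> (Suc p = ?r \<and> i = 0)"
    unfolding i_def using p by (cases "Suc p = ?r") auto
  have sp: "sector_between a (\<theta> i) \<subseteq> h ` (U \<inter> fs ! p)" and ai: "a < \<theta> i"
  proof -
    have "sector_between a (\<theta> i) \<subseteq> sector_between (\<theta> p) (\<theta> (Suc p)) \<and> a < \<theta> i"
    proof (cases "i = 0")
      case True
      then have e: "a = \<theta> p - 2 * pi" "\<theta> (Suc p) = \<theta> i + 2 * pi" using cases full unfolding a_def by auto
      have "z \<in> sector_between (\<theta> p) (\<theta> (Suc p))" if z: "z \<in> sector_between a (\<theta> i)" for z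
      proof -
        obtain s x where "z = of_real s * cis x" "0 < s" "s < 1" "a < x" "x < \<theta> i"
          using z unfolding sector_between_def by blast
        then have "z = of_real s * cis (x + 2 * pi)" "\<theta> p < x + 2 * pi" "x + 2 * pi < \<theta> (Suc p)"
          using e by (simp_all flip: cis_mult)
        then show ?thesis using \<open>0 < s\<close> \<open>s < 1\<close> unfolding sector_between_def by blast
      qed
      then show ?thesis using e inc[OF p] by auto
    next
      case False
      then show ?thesis using cases inc[OF p] unfolding a_def by auto
    qed
    then show "sector_between a (\<theta> i) \<subseteq> h ` (U \<inter> fs ! p)" "a < \<theta> i" using sec[OF p] by blast+
  qed
  obtain W where W: "open W" "of_real (1/2) * cis (\<theta> i) \<in> W"
    "\<And>z. z \<in> W \<Longrightarrow> \<exists>s x. z = of_real s * cis x \<and> 0 < s \<and> s < 1 \<and> a < x \<and> x < \<theta> (Suc i)"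
    using near_radius[OF ai inc[OF i]] by blast
  have "of_real (1/2) * cis (\<theta> i) \<in> radius_at (\<theta> i)" unfolding radius_at_def by (rule CollectI) (rule exI[of _ "1/2"], simp)
  then have "of_real (1/2) * cis (\<theta> i) \<in> h ` (U \<inter> ?e)" unfolding rad[OF i] .
  then obtain q where q: "q \<in> U" "q \<in> ?e" "h q = of_real (1/2) * cis (\<theta> i)" by auto
  have conth: "continuous_on U h" and kh: "\<And>y. y \<in> U \<Longrightarrow> k (h y) = y"
    using U(2) unfolding homeomorphism_def by auto
  have "openin (top_of_set U) (U \<inter> h -` W)" using conth W(1) by (rule continuous_openin_preimage_gen)
  then have "openin (top_of_set S2) (U \<inter> h -` W)" using U(1) openin_trans by blast
  then obtain O' where O': "open O'" "U \<inter> h -` W = S2 \<inter> O'" by (metis openin_open)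
  have "h q \<in> W" using q(3) W(2) by metis
  then have "q \<in> U \<inter> h -` W" using q(1) by simp
  then have qO: "q \<in> O'" using O'(2) by blast
  have same: "y = y'" if "y \<in> U" "y' \<in> U" "h y = h y'" for y y' using kh that by metis
  have sub: "f = fs ! p \<or> f = fs ! i" if f: "f \<in> faces V E" "?e \<in> face_sides E f" for f
  proof -
    have "q \<in> closure f" using f(2) q(2) unfolding face_sides_def by blast
    then have "O' \<inter> f \<noteq> {}" using open_Int_closure_eq_empty[OF O'(1), of f] qO by blast
    then obtain y where y: "y \<in> O'" "y \<in> f" by blast
    have fS: "f \<subseteq> S2 - graph_points V E" using f(1) in_components_subset unfolding faces_def by blast
    then have "y \<in> U \<inter> h -` W" using y O'(2) by blast
    then have yU: "y \<in> U" "h y \<in> W" by auto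
    obtain s x where sx: "h y = of_real s * cis x" "0 < s" "s < 1" "a < x" "x < \<theta> (Suc i)"
      using W(3)[OF yU(2)] by blast
    consider "x < \<theta> i" | "x = \<theta> i" | "\<theta> i < x" by linarith
    then show ?thesis
    proof cases
      case 1
      then have "h y \<in> sector_between a (\<theta> i)" unfolding sector_between_def using sx by blast
      then obtain y' where "y' \<in> U" "y' \<in> fs ! p" "h y = h y'" using sp by blast
      then have "y \<in> fs ! p" using same[OF yU(1)] by metis
      then show ?thesis using faces_meet[OF f(1) fsf(1) y(2)] by blast
    next
      case 2
      then have "h y \<in> radius_at (\<theta> i)" unfolding radius_at_def using sx by (metis (mono_tags, lifting) CollectI less_imp_le)
      then obtain y' where "y' \<in> U" "y' \<in> ?e" "h y = h y'" unfolding rad[OF i, symmetric] by blast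
      then have "y \<in> ?e" using same[OF yU(1)] by metis
      then have False using y(2) fS eE unfolding graph_points_def by blast
      then show ?thesis ..
    next
      case 3
      then have "h y \<in> sector_between (\<theta> i) (\<theta> (Suc i))" unfolding sector_between_def using sx by blast
      then obtain y' where "y' \<in> U" "y' \<in> fs ! i" "h y = h y'" using sec[OF i] by blast
      then have "y \<in> fs ! i" using same[OF yU(1)] by metis
      then show ?thesis using faces_meet[OF f(1) fsf(2) y(2)] by blast
    qed
  qed
  let ?F = "{f \<in> faces V E. ?e \<in> face_sides E f}"
  have F: "?F \<subseteq> {fs ! p, fs ! i}" using sub by blast
  have c2: "card ?F = 2" using polyhedral_mapD(3)[OF poly eE] .
  have "card {fs ! p, fs ! i} \<le> 2" by (simp add: card_insert_if)
  then show "?F = {fs ! p, fs ! i}" using F c2 by (intro card_seteq) auto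
  then show "fs ! p \<noteq> fs ! i" using c2 by auto
qed

lemma vertices_of_edge:
  assumes "embedded_graph V E" "e \<in> E" shows "card {v \<in> V. v \<in> e} = 2"
proof -
  obtain g where g: "arc g" "e \<inter> V = {pathstart g, pathfinish g}"
    using embedded_graphD(6)[OF assms] by blast
  have "{v \<in> V. v \<in> e} = {pathstart g, pathfinish g}" using g(2) by blast
  then show ?thesis using arc_distinct_ends[OF g(1)] by simp
qed

lemma Suc_mod_bij: "bij_betw (\<lambda>i. Suc i mod r) {..<r} {..<r}"
proof (cases "r = 0")
  case False
  have "inj_on (\<lambda>i. Suc i mod r) {..<r}"
    by (rule inj_onI) (auto simp: mod_Suc split: if_splits)
  moreover have "(\<lambda>i. Suc i mod r) ` {..<r} \<subseteq> {..<r}" using False by auto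
  ultimately show ?thesis unfolding bij_betw_def by (metis endo_inj_surj finite_lessThan)
qed (simp add: bij_betw_def)

lemma sum_of_bool_shift:
  "(\<Sum>i<r. of_bool (R (Suc i mod r)) :: nat) = (\<Sum>i<r. of_bool (R i))"
  using sum.reindex_bij_betw[OF Suc_mod_bij, of "\<lambda>i. of_bool (R i)"] .

lemma card_less_eq_sum:
  fixes r :: nat
  shows "card {i. i < r \<and> R i} = (\<Sum>i<r. of_bool (R i))"
proof -
  have "card {i. i < r \<and> R i} = sum (\<lambda>_. 1) {i \<in> {..<r}. R i}" by simp
  also have "\<dots> = (\<Sum>i<r. if R i then 1 else 0)" by (rule sum.inter_filter) simp
  finally show ?thesis unfolding of_bool_def .
qed

definition sides_next_to :: "(real^3) set \<Rightarrow> (real^3) set set \<Rightarrow> ((real^3) set \<Rightarrow> bool) \<Rightarrow> (real^3) set \<Rightarrow> (real^3) set set" where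
  "sides_next_to V E Q f = {e \<in> face_sides E f. \<exists>g\<in>faces V E. g \<noteq> f \<and> e \<in> face_sides E g \<and> Q g}"

text \<open>
  The edge between the corners \<open>i\<close> and \<open>i + 1\<close> is counted once, when one
  of them belongs to \<open>f\<close> and the other one to a face with the property
  \<open>Q\<close>. In the result both sums run over the corners of \<open>f\<close>, with the face
  after and the face before the corner.
\<close>

lemma sides_at_vertex:
  assumes poly: "polyhedral_map V E" and ga: "going_around V E v es fs" and f: "f \<in> faces V E"
  defines "r \<equiv> length es"
  shows "card {e \<in> sides_next_to V E Q f. v \<in> e} =
    (\<Sum>i<r. of_bool (fs ! (Suc i mod r) = f \<and> Q (fs ! (Suc (Suc i mod r) mod r))))
    + (\<Sum>i<r. of_bool (fs ! (Suc i mod r) = f \<and> Q (fs ! i)))"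
proof -
  have ga': "distinct es" "set es = {e \<in> E. v \<in> e}" "length fs = r" "set fs \<subseteq> faces V E"
    using ga unfolding going_around_def r_def by simp_all
  let ?n = "\<lambda>i. Suc i mod r"
  have n: "?n i < r" if "i < r" for i using that by (cases r) auto
  have fa: "{g \<in> faces V E. es ! ?n i \<in> face_sides E g} = {fs ! i, fs ! ?n i}" "fs ! i \<noteq> fs ! ?n i"
    if "i < r" for i using faces_at_edge[OF poly ga, of i] that unfolding r_def by simp_all
  have fsf: "fs ! i \<in> faces V E" if "i < r" for i using nth_mem[of i fs] ga'(3,4) that by auto
  let ?R = "\<lambda>i. (fs ! i = f \<and> Q (fs ! ?n i)) \<or> (fs ! ?n i = f \<and> Q (fs ! i))"
  have iff: "es ! ?n i \<in> sides_next_to V E Q f \<longleftrightarrow> ?R i" if i: "i < r" for i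
  proof -
    have a: "es ! ?n i \<in> face_sides E g \<longleftrightarrow> g = fs ! i \<or> g = fs ! ?n i" if "g \<in> faces V E" for g
      using fa(1)[OF i] that by blast
    have "es ! ?n i \<in> sides_next_to V E Q f \<longleftrightarrow>
      (f = fs ! i \<or> f = fs ! ?n i) \<and> (\<exists>g\<in>faces V E. g \<noteq> f \<and> (g = fs ! i \<or> g = fs ! ?n i) \<and> Q g)"
      unfolding sides_next_to_def using a f by auto
    also have "\<dots> \<longleftrightarrow> ?R i" using fa(2)[OF i] fsf[OF i] fsf[OF n[OF i]] by metis
    finally show ?thesis .
  qed
  have "{e \<in> sides_next_to V E Q f. v \<in> e} = (\<lambda>i. es ! ?n i) ` {i. i < r \<and> ?R i}"
  proof (intro set_eqI iffI)
    fix e assume "e \<in> {e \<in> sides_next_to V E Q f. v \<in> e}"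
    then have e: "e \<in> sides_next_to V E Q f" "v \<in> e" by auto
    then have "e \<in> set es" using ga'(2) unfolding sides_next_to_def face_sides_def by blast
    then obtain j where j: "j < r" "e = es ! j" unfolding r_def by (metis in_set_conv_nth)
    then obtain i where i: "i < r" "j = ?n i" using Suc_mod_bij[of r] unfolding bij_betw_def by blast
    then show "e \<in> (\<lambda>i. es ! ?n i) ` {i. i < r \<and> ?R i}" using iff[OF i(1)] e(1) j by blast
  next
    fix e assume "e \<in> (\<lambda>i. es ! ?n i) ` {i. i < r \<and> ?R i}"
    then obtain i where i: "i < r" "?R i" "e = es ! ?n i" by blast
    then have "e \<in> set es" using n[OF i(1)] unfolding r_def by simp
    then show "e \<in> {e \<in> sides_next_to V E Q f. v \<in> e}" using iff[OF i(1)] i ga'(2) by simp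
  qed
  moreover have "inj_on (\<lambda>i. es ! ?n i) {i. i < r \<and> ?R i}"
  proof (rule inj_onI)
    fix i j assume ij: "i \<in> {i. i < r \<and> ?R i}" "j \<in> {i. i < r \<and> ?R i}" "es ! ?n i = es ! ?n j"
    then have "?n i = ?n j" using ga'(1) n unfolding r_def by (simp add: nth_eq_iff_index_eq)
    then show "i = j" using Suc_mod_bij[of r] ij(1,2) unfolding bij_betw_def by (auto dest: inj_onD)
  qed
  ultimately have "card {e \<in> sides_next_to V E Q f. v \<in> e} = card {i. i < r \<and> ?R i}" by (simp only: card_image)
  also have "\<dots> = (\<Sum>i<r. of_bool (?R i))" by (rule card_less_eq_sum)
  also have "\<dots> = (\<Sum>i<r. of_bool (fs ! i = f \<and> Q (fs ! ?n i)) + of_bool (fs ! ?n i = f \<and> Q (fs ! i)))"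
    by (rule sum.cong) (use fa(2) in auto)
  also have "\<dots> = (\<Sum>i<r. of_bool (fs ! i = f \<and> Q (fs ! ?n i))) + (\<Sum>i<r. of_bool (fs ! ?n i = f \<and> Q (fs ! i)))"
    by (rule sum.distrib)
  also have "(\<Sum>i<r. of_bool (fs ! i = f \<and> Q (fs ! ?n i)) :: nat) = (\<Sum>i<r. of_bool (fs ! ?n i = f \<and> Q (fs ! ?n (?n i))))"
    by (rule sum_of_bool_shift[of "\<lambda>i. fs ! i = f \<and> Q (fs ! ?n i)", symmetric])
  finally show ?thesis .
qed

text \<open>
  Every edge has two ends.
\<close>

lemma count_sides:
  assumes poly: "polyhedral_map V E" and f: "f \<in> faces V E"
  shows "(\<Sum>v\<in>V. card {e \<in> sides_next_to V E Q f. v \<in> e}) = 2 * card (sides_next_to V E Q f)"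
proof -
  note emb = polyhedral_mapD(1)[OF poly]
  have sub: "sides_next_to V E Q f \<subseteq> E" unfolding sides_next_to_def face_sides_def by blast
  have fin: "finite V" "finite (sides_next_to V E Q f)"
    using embedded_graphD(1,4)[OF emb] sub finite_subset by blast+
  have "\<forall>e\<in>sides_next_to V E Q f. card {v \<in> V. v \<in> e} = 2" using vertices_of_edge[OF emb] sub by blast
  from sum_multicount[OF fin this] show ?thesis .
qed

lemma all_sides_next_to:
  assumes poly: "polyhedral_map V E" and f: "f \<in> faces V E"
  shows "sides_next_to V E (\<lambda>_. True) f = face_sides E f"
proof -
  have "\<exists>g\<in>faces V E. g \<noteq> f \<and> e \<in> face_sides E g" if e: "e \<in> face_sides E f" for e
  proof (rule ccontr)
    assume no: "\<not> ?thesis"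
    have "e \<in> E" using e unfolding face_sides_def by blast
    then have "card {g \<in> faces V E. e \<in> face_sides E g} = 2" using polyhedral_mapD(3)[OF poly] by blast
    moreover have "{g \<in> faces V E. e \<in> face_sides E g} \<subseteq> {f}" using no by blast
    ultimately show False using card_mono[of "{f}" "{g \<in> faces V E. e \<in> face_sides E g}"] by simp
  qed
  then show ?thesis unfolding sides_next_to_def by blast
qed

context
  fixes V E es fs
  assumes poly: "polyhedral_map V E" and ga: "\<And>v. v \<in> V \<Longrightarrow> going_around V E v (es v) (fs v)"
begin

text \<open>
  A face has as many corners as sides: each corner is at two sides and each side has two ends.
\<close>

lemma face_degree_corners:
  assumes f: "f \<in> faces V E"
  shows "face_degree E f = (\<Sum>v\<in>V. \<Sum>i<length (es v). of_bool (fs v ! i = f))"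
proof -
  have "2 * face_degree E f = (\<Sum>v\<in>V. card {e \<in> sides_next_to V E (\<lambda>_. True) f. v \<in> e})"
    using count_sides[OF poly f, of "\<lambda>_. True"]
    unfolding all_sides_next_to[OF poly f] face_degree_def by simp
  also have "\<dots> = (\<Sum>v\<in>V. 2 * (\<Sum>i<length (es v). of_bool (fs v ! i = f)))"
  proof (rule sum.cong[OF refl])
    fix v assume v: "v \<in> V"
    show "card {e \<in> sides_next_to V E (\<lambda>_. True) f. v \<in> e} = 2 * (\<Sum>i<length (es v). of_bool (fs v ! i = f))"
      unfolding sides_at_vertex[OF poly ga[OF v] f] simp_thms
      using sum_of_bool_shift[of "\<lambda>i. fs v ! i = f" "length (es v)"] by linarith
  qed
  also have "\<dots> = 2 * (\<Sum>v\<in>V. \<Sum>i<length (es v). of_bool (fs v ! i = f))"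
    by (rule sum_distrib_left[symmetric])
  finally show ?thesis by simp
qed

text \<open>
  If at each corner of a face exactly one of the two adjacent faces has the property
  \<open>Q\<close>, then these faces alternate along the boundary. In numbers: each corner
  contributes one end of a side next to such a face, and each of these sides has two ends.
\<close>

lemma alternating_neighbours_even:
  fixes Q :: "(real^3) set \<Rightarrow> bool"
  assumes f: "f \<in> faces V E"
    and alt: "\<And>v i. v \<in> V \<Longrightarrow> i < length (es v) \<Longrightarrow> fs v ! (Suc i mod length (es v)) = f \<Longrightarrow>
      Q (fs v ! i) \<noteq> Q (fs v ! (Suc (Suc i mod length (es v)) mod length (es v)))"
  shows "even (face_degree E f)"
proof -
  have "2 * card (sides_next_to V E Q f) = (\<Sum>v\<in>V. card {e \<in> sides_next_to V E Q f. v \<in> e})"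
    by (rule count_sides[OF poly f, symmetric])
  also have "\<dots> = (\<Sum>v\<in>V. \<Sum>i<length (es v). of_bool (fs v ! i = f))"
  proof (rule sum.cong[OF refl])
    fix v assume v: "v \<in> V"
    let ?r = "length (es v)"
    have "card {e \<in> sides_next_to V E Q f. v \<in> e} = (\<Sum>i<?r. of_bool (fs v ! (Suc i mod ?r) = f))"
      unfolding sides_at_vertex[OF poly ga[OF v] f] sum.distrib[symmetric]
      by (rule sum.cong) (use alt[OF v] in auto)
    then show "card {e \<in> sides_next_to V E Q f. v \<in> e} = (\<Sum>i<?r. of_bool (fs v ! i = f))"
      using sum_of_bool_shift[of "\<lambda>i. fs v ! i = f" ?r] by simp
  qed
  also have "\<dots> = face_degree E f" by (rule face_degree_corners[OF f, symmetric])
  finally show ?thesis by (metis dvd_triv_left)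
qed

lemma edge_count: "2 * card E = (\<Sum>v\<in>V. length (es v))"
proof -
  note emb = polyhedral_mapD(1)[OF poly]
  have "(\<Sum>v\<in>V. card {e \<in> E. v \<in> e}) = 2 * card E"
    using sum_multicount[OF embedded_graphD(1,4)[OF emb], of "(\<in>)" 2] vertices_of_edge[OF emb] by blast
  moreover have "card {e \<in> E. v \<in> e} = length (es v)" if "v \<in> V" for v
    using ga[OF that] distinct_card[of "es v"] unfolding going_around_def by metis
  ultimately show ?thesis by simp
qed

lemma finite_faces: "finite (faces V E)"
proof -
  note emb = polyhedral_mapD(1)[OF poly]
  have "faces V E \<subseteq> (\<Union>e\<in>E. {f \<in> faces V E. e \<in> face_sides E f})"
  proof
    fix f assume f: "f \<in> faces V E"
    have "face_sides E f \<noteq> {}" using polyhedral_mapD(5)[OF poly f] unfolding face_degree_def by force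
    then show "f \<in> (\<Union>e\<in>E. {f \<in> faces V E. e \<in> face_sides E f})" using f unfolding face_sides_def by blast
  qed
  moreover have "finite {f \<in> faces V E. e \<in> face_sides E f}" if "e \<in> E" for e
    using polyhedral_mapD(3)[OF poly that] by (metis card.infinite zero_neq_numeral)
  ultimately show ?thesis using embedded_graphD(4)[OF emb] by (meson finite_UN_I finite_subset)
qed

text \<open>
  Each face is distributed over its corners in equal shares.
\<close>

lemma face_count: "real (card (faces V E)) = (\<Sum>v\<in>V. \<Sum>i<length (es v). 1 / real (face_degree E (fs v ! i)))"
proof -
  have "real (card (faces V E)) = (\<Sum>f\<in>faces V E. 1)" by simp
  also have "\<dots> = (\<Sum>f\<in>faces V E. \<Sum>v\<in>V. \<Sum>i<length (es v). of_bool (fs v ! i = f) / real (face_degree E f))"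
  proof (rule sum.cong[OF refl])
    fix f assume f: "f \<in> faces V E"
    have "real (face_degree E f) = (\<Sum>v\<in>V. \<Sum>i<length (es v). of_bool (fs v ! i = f))"
      unfolding face_degree_corners[OF f] by (simp only: of_nat_sum of_nat_of_bool)
    moreover have "face_degree E f > 0" using polyhedral_mapD(5)[OF poly f] by simp
    ultimately have "1 = (\<Sum>v\<in>V. \<Sum>i<length (es v). of_bool (fs v ! i = f)) / real (face_degree E f)" by simp
    then show "1 = (\<Sum>v\<in>V. \<Sum>i<length (es v). of_bool (fs v ! i = f) / real (face_degree E f))"
      by (simp only: sum_divide_distrib)
  qed
  also have "\<dots> = (\<Sum>v\<in>V. \<Sum>f\<in>faces V E. \<Sum>i<length (es v). of_bool (fs v ! i = f) / real (face_degree E f))"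
    by (rule sum.swap)
  also have "\<dots> = (\<Sum>v\<in>V. \<Sum>i<length (es v). \<Sum>f\<in>faces V E. of_bool (fs v ! i = f) / real (face_degree E f))"
    by (rule sum.cong[OF refl]) (rule sum.swap)
  also have "\<dots> = (\<Sum>v\<in>V. \<Sum>i<length (es v). 1 / real (face_degree E (fs v ! i)))"
  proof (intro sum.cong refl)
    fix v i assume v: "v \<in> V" "i \<in> {..<length (es v)}"
    have "fs v ! i \<in> faces V E" using ga[OF v(1)] v(2) nth_mem[of i "fs v"] unfolding going_around_def by auto
    then show "(\<Sum>f\<in>faces V E. of_bool (fs v ! i = f) / real (face_degree E f)) = 1 / real (face_degree E (fs v ! i))"
      by (simp add: of_bool_def if_distrib[of "\<lambda>x. x / _"] sum.delta'[OF finite_faces] cong: if_cong)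
  qed
  finally show ?thesis .
qed

end

section \<open>Arithmetic of vertex symbols\<close>

text \<open>
  At each entry \<open>p\<close> of the cyclic sequence exactly one of the two neighbours lies in
  \<open>A\<close>. The index \<open>i\<close> is the place before that entry, so that only
  successors modulo the length are used.
\<close>

definition alternates :: "nat list \<Rightarrow> nat \<Rightarrow> nat set \<Rightarrow> bool" where
  "alternates ps p A \<longleftrightarrow> (\<forall>i<length ps. ps ! (Suc i mod length ps) = p \<longrightarrow>
     (ps ! i \<in> A) \<noteq> (ps ! (Suc (Suc i mod length ps) mod length ps) \<in> A))"

lemma alternates_rotate: "alternates ps p A \<Longrightarrow> alternates (rotate n ps) p A"
proof -
  assume alt: "alternates ps p A"
  let ?r = "length ps"
  have nth: "rotate n ps ! i = ps ! ((n + i) mod ?r)" if "i < ?r" for i using that by (simp add: nth_rotate)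
  show ?thesis unfolding alternates_def length_rotate
  proof (intro allI impI)
    fix i assume i: "i < ?r" and p: "rotate n ps ! (Suc i mod ?r) = p"
    have lt: "Suc j mod ?r < ?r" "(n + j) mod ?r < ?r" for j using i by (cases ?r; simp)+
    have s: "(n + Suc j mod ?r) mod ?r = Suc ((n + j) mod ?r) mod ?r" for j
      by (simp add: mod_simps)
    show "(rotate n ps ! i \<in> A) \<noteq> (rotate n ps ! (Suc (Suc i mod ?r) mod ?r) \<in> A)"
      using alt p lt i unfolding alternates_def by (simp add: nth s)
  qed
qed

lemma alternates_rev: "alternates ps p A \<Longrightarrow> alternates (rev ps) p A"
proof -
  assume alt: "alternates ps p A"
  let ?r = "length ps"
  show ?thesis unfolding alternates_def length_rev
  proof (intro allI impI)
    fix i assume i: "i < ?r" and p: "rev ps ! (Suc i mod ?r) = p"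
    define j where "j = ?r - Suc (Suc (Suc i mod ?r) mod ?r)"
    have lt: "Suc i mod ?r < ?r" "Suc (Suc i mod ?r) mod ?r < ?r" "j < ?r" using i unfolding j_def by (cases ?r; simp)+
    have 1: "Suc j mod ?r = ?r - Suc (Suc i mod ?r)"
      using i unfolding j_def by (cases "Suc i = ?r"; cases "Suc (Suc i) = ?r"; cases "?r = 1"; auto simp: mod_Suc Suc_diff_Suc)
    have 2: "Suc (Suc j mod ?r) mod ?r = ?r - Suc i"
      using i unfolding 1 by (cases "Suc i = ?r"; auto simp: mod_Suc Suc_diff_Suc)
    have "rev ps ! k = ps ! (?r - Suc k)" if "k < ?r" for k using that by (rule rev_nth)
    then show "(rev ps ! i \<in> A) \<noteq> (rev ps ! (Suc (Suc i mod ?r) mod ?r) \<in> A)"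
      using alt lt i p unfolding alternates_def j_def[symmetric] 
      by (metis 1 2 j_def)
  qed
qed

lemma same_cyclic_alternates: "same_cyclic ps qs \<Longrightarrow> alternates ps p A \<Longrightarrow> alternates qs p A"
  unfolding same_cyclic_def using alternates_rotate alternates_rev by blast

lemma same_cyclic_mset: "same_cyclic ps qs \<Longrightarrow> mset ps = mset qs"
proof -
  have "mset (rotate n xs) = mset xs" for n and xs :: "'a list"
    unfolding rotate_drop_take by (metis append_take_drop_id mset_append union_commute)
  then show "same_cyclic ps qs \<Longrightarrow> mset ps = mset qs" unfolding same_cyclic_def by (metis mset_rev)
qed

lemma same_cyclic_length: "same_cyclic ps qs \<Longrightarrow> length ps = length qs"
  using same_cyclic_mset by (metis size_mset)

lemma same_cyclic_set: "same_cyclic ps qs \<Longrightarrow> set ps = set qs"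
  using same_cyclic_mset by (metis set_mset_mset)

definition inverse_sum :: "nat list \<Rightarrow> real" where
  "inverse_sum ps = (\<Sum>p\<leftarrow>ps. 1 / real p)"

lemma same_cyclic_inverse_sum: "same_cyclic ps qs \<Longrightarrow> inverse_sum ps = inverse_sum qs"
proof -
  assume "same_cyclic ps qs"
  then have "mset (map (\<lambda>p. 1 / real p) ps) = mset (map (\<lambda>p. 1 / real p) qs)"
    using same_cyclic_mset[of ps qs] by simp
  then show ?thesis unfolding inverse_sum_def by (metis sum_mset_sum_list)
qed

text \<open>
  The inequality is the lower bound for the number of faces per vertex; the last condition forbids
  neighbours that alternate around a face of odd degree.
\<close>

definition admissible :: "nat list \<Rightarrow> bool" where
  "admissible ps \<longleftrightarrow> (\<forall>p\<in>set ps. 3 \<le> p) \<and> real (length ps) / 2 - 1 < inverse_sum ps \<and>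
     (\<forall>p A. odd p \<longrightarrow> p \<in> set ps \<longrightarrow> \<not> alternates ps p A)"

text \<open>
  With \<open>r\<close> edges at each of the \<open>V\<close> vertices there are \<open>r V /
  2\<close> edges, and the faces, distributed over their corners, are \<open>V\<close> times the sum
  of the inverse degrees. Inserting this into \<open>E + 1 \<le> V + F\<close> gives the inequality.
\<close>

theorem symbol_admissible:
  assumes poly: "polyhedral_map V E" and sym: "vertex_symbol V E ps" and ge: "\<forall>p\<in>set ps. 3 \<le> p"
  shows "admissible ps"
proof -
  note emb = polyhedral_mapD(1)[OF poly]
  have "\<forall>v\<in>V. \<exists>es fs. going_around V E v es fs \<and> same_cyclic ps (map (face_degree E) fs)"
    using sym unfolding vertex_symbol_def degrees_around_def by blast
  then obtain es fs where ef: "\<And>v. v \<in> V \<Longrightarrow> going_around V E v (es v) (fs v)"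
    "\<And>v. v \<in> V \<Longrightarrow> same_cyclic ps (map (face_degree E) (fs v))" by metis
  have len: "length (fs v) = length ps" "length (es v) = length ps" if "v \<in> V" for v
  proof -
    show "length (fs v) = length ps" using same_cyclic_length[OF ef(2)[OF that]] by simp
    then show "length (es v) = length ps" using ef(1)[OF that] unfolding going_around_def by simp
  qed
  have fsf: "fs v ! i \<in> faces V E" if "v \<in> V" "i < length ps" for v i
    using ef(1)[OF that(1)] nth_mem[of i "fs v"] len[OF that(1)] that(2) unfolding going_around_def by auto
  obtain v where v: "v \<in> V" using embedded_graphD(2)[OF emb] by blast
  have cV: "0 < card V" using embedded_graphD(1,2)[OF emb] by (simp add: card_gt_0_iff)
  have "2 * card E = card V * length ps" using edge_count[OF poly ef(1)] len(2) by simp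
  then have e: "2 * real (card E) = real (card V) * real (length ps)" by (metis of_nat_mult of_nat_numeral)
  have "(\<Sum>i<length (es v). 1 / real (face_degree E (fs v ! i))) = inverse_sum ps" if v: "v \<in> V" for v
  proof -
    have "inverse_sum ps = inverse_sum (map (face_degree E) (fs v))" by (rule same_cyclic_inverse_sum[OF ef(2)[OF v]])
    also have "\<dots> = (\<Sum>i<length (fs v). 1 / real (face_degree E (fs v ! i)))"
      unfolding inverse_sum_def by (simp add: sum_list_sum_nth atLeast0LessThan)
    finally show ?thesis using len[OF v] by simp
  qed
  then have f: "real (card (faces V E)) = real (card V) * inverse_sum ps"
    using face_count[OF poly ef(1)] by simp
  have "faces V E \<noteq> {}"
  proof -
    have "length ps \<noteq> 0"
    proof
      assume "length ps = 0"
      then have "card {e \<in> E. v \<in> e} = 0" using ef(1)[OF v] len[OF v] unfolding going_around_def by auto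
      then show False using polyhedral_mapD(4)[OF poly v] unfolding vertex_degree_def by simp
    qed
    then show ?thesis using fsf[OF v, of 0] by auto
  qed
  then have "card E + 1 \<le> card V + card (faces V E)"
    using euler_inequality[OF emb polyhedral_mapD(2)[OF poly] finite_faces[OF poly ef(1)]] by blast
  then have "real (card E) + 1 \<le> real (card V) + real (card (faces V E))" by linarith
  then have "0 < real (card V) * (1 + inverse_sum ps - real (length ps) / 2)"
    using e f by (simp add: algebra_simps)
  then have ineq: "real (length ps) / 2 - 1 < inverse_sum ps" using cV by (simp add: zero_less_mult_iff)
  have "\<not> alternates ps p A" if p: "odd p" "p \<in> set ps" for p A
  proof
    assume alt: "alternates ps p A"
    have "p \<in> set (map (face_degree E) (fs v))" using p(2) same_cyclic_set[OF ef(2)[OF v]] by blast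
    then obtain f where f: "f \<in> set (fs v)" "face_degree E f = p" by auto
    then have ff: "f \<in> faces V E" using ef(1)[OF v] unfolding going_around_def by blast
    have "even (face_degree E f)"
    proof (rule alternating_neighbours_even[OF poly ef(1) ff, where Q = "\<lambda>g. face_degree E g \<in> A"])
      fix u i assume u: "u \<in> V" and i: "i < length (es u)" and fi: "fs u ! (Suc i mod length (es u)) = f"
      have r: "length (es u) = length ps" "length (fs u) = length ps" using len[OF u] by auto
      have n: "Suc j mod length ps < length ps" for j using i r by (cases "length ps") auto
      have "alternates (map (face_degree E) (fs u)) p A" by (rule same_cyclic_alternates[OF ef(2)[OF u] alt])
      then show "(face_degree E (fs u ! i) \<in> A) \<noteq>
          (face_degree E (fs u ! (Suc (Suc i mod length (es u)) mod length (es u))) \<in> A)"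
        using i fi f(2) n r unfolding alternates_def by simp
    qed
    then show False using f(2) p(1) by simp
  qed
  then show ?thesis unfolding admissible_def using ge ineq by blast
qed

lemma same_cyclic_refl: "same_cyclic ps ps"
  unfolding same_cyclic_def by (rule exI[of _ 0]) simp

lemma rev_rotate_exists: "\<exists>m. rev (rotate n xs) = rotate m (rev xs)"
proof (cases "xs = []")
  case False
  show ?thesis using rotate_rev[of "length xs - n mod length xs" xs] False
    by (metis rev_rev_ident rotate_rev)
qed simp

lemma same_cyclic_trans: "same_cyclic ps qs \<Longrightarrow> same_cyclic qs rs \<Longrightarrow> same_cyclic ps rs"
  unfolding same_cyclic_def using rev_rotate_exists by (metis rev_rev_ident rotate_rotate)

lemma same_cyclic_sym: "same_cyclic ps qs \<Longrightarrow> same_cyclic qs ps"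
proof -
  have inv: "\<exists>m. rotate m (rotate n xs) = xs" for n and xs :: "'a list"
  proof (cases "xs = []")
    case False
    have "(length xs - n mod length xs + n) mod length xs = 0"
      using False by (metis add.commute length_greater_0_conv less_imp_le mod_add_right_eq mod_less_divisor mod_self ordered_cancel_comm_monoid_diff_class.add_diff_inverse mod_mod_trivial)
    then have "rotate (length xs - n mod length xs) (rotate n xs) = xs"
      unfolding rotate_rotate by (metis rotate_conv_mod rotate0 id_apply)
    then show ?thesis by blast
  qed simp
  assume "same_cyclic ps qs"
  then obtain n where "qs = rotate n ps \<or> qs = rotate n (rev ps)" unfolding same_cyclic_def by blast
  then show ?thesis
  proof
    assume "qs = rotate n ps"
    then obtain m where "ps = rotate m qs" using inv by metis
    then show ?thesis unfolding same_cyclic_def by blast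
  next
    assume "qs = rotate n (rev ps)"
    then obtain m where "rev ps = rotate m qs" using inv by metis
    then have "ps = rev (rotate m qs)" by (metis rev_rev_ident)
    then obtain k where "ps = rotate k (rev qs)" using rev_rotate_exists by metis
    then show ?thesis unfolding same_cyclic_def by blast
  qed
qed

lemma admissible_same_cyclic:
  assumes "same_cyclic ps qs" "admissible ps" shows "admissible qs"
  using assms same_cyclic_alternates[OF same_cyclic_sym[OF assms(1)]] same_cyclic_set[OF assms(1)]
    same_cyclic_inverse_sum[OF assms(1)] same_cyclic_length[OF assms(1)]
  unfolding admissible_def by metis

lemma inverse_bound: "0 < k \<Longrightarrow> k \<le> p \<Longrightarrow> 1 / real p \<le> 1 / real k"
  by (simp add: frac_le)

lemmas alternates_list = alternates_def All_less_Suc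

lemma admissibleD:
  assumes "admissible ps"
  shows "\<And>p. p \<in> set ps \<Longrightarrow> 3 \<le> p" "real (length ps) / 2 - 1 < (\<Sum>p\<leftarrow>ps. 1 / real p)"
    "\<And>p A. odd p \<Longrightarrow> p \<in> set ps \<Longrightarrow> \<not> alternates ps p A"
  using assms unfolding admissible_def inverse_sum_def by blast+

text \<open>
  At a vertex with three faces, if one degree is odd then the other two agree: otherwise one of
  these two, chosen different from the odd one if that occurs twice, alternates around the odd face.
\<close>

lemma admissible_3D:
  assumes "admissible [a, b, c]"
  shows "3 \<le> a" "3 \<le> b" "3 \<le> c" "1/2 < 1 / real a + 1 / real b + 1 / real c"
    "odd a \<Longrightarrow> b = c" "odd b \<Longrightarrow> a = c" "odd c \<Longrightarrow> a = b"
proof -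
  have alt: "\<not> alternates [a, b, c] p A" if "odd p" "p \<in> {a, b, c}" for p A
    using admissibleD(3)[OF assms that(1)] that(2) by simp
  show "3 \<le> a" "3 \<le> b" "3 \<le> c" "1/2 < 1 / real a + 1 / real b + 1 / real c"
    using admissibleD(1,2)[OF assms] by simp_all
  show "odd a \<Longrightarrow> b = c" 
  proof (rule ccontr)
    assume "odd a" "b \<noteq> c"
    then show False using alt[of a "if b = a then {c} else {b}"] by (auto simp: alternates_list split: if_splits)
  qed
  show "odd b \<Longrightarrow> a = c" 
  proof (rule ccontr)
    assume "odd b" "a \<noteq> c"
    then show False using alt[of b "if a = b then {c} else {a}"] by (auto simp: alternates_list split: if_splits)
  qed
  show "odd c \<Longrightarrow> a = b" 
  proof (rule ccontr)
    assume "odd c" "a \<noteq> b"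
    then show False using alt[of c "if a = c then {b} else {a}"] by (auto simp: alternates_list split: if_splits)
  qed
qed

lemma same_cyclic_3:
  "same_cyclic [a, b, c] [a, b, c]" "same_cyclic [a, b, c] [a, c, b]" "same_cyclic [a, b, c] [b, a, c]"
  "same_cyclic [a, b, c] [b, c, a]" "same_cyclic [a, b, c] [c, a, b]" "same_cyclic [a, b, c] [c, b, a]"
proof -
  have r: "rotate 0 xs = xs" "rotate 1 [x, y, z] = [y, z, x]" "rotate 2 [x, y, z] = [z, x, y]" for xs and x y z :: 'a
    by (simp_all add: numeral_2_eq_2)
  show "same_cyclic [a, b, c] [a, b, c]" "same_cyclic [a, b, c] [a, c, b]" "same_cyclic [a, b, c] [b, a, c]"
    "same_cyclic [a, b, c] [b, c, a]" "same_cyclic [a, b, c] [c, a, b]" "same_cyclic [a, b, c] [c, b, a]"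
    unfolding same_cyclic_def
    by (rule exI[of _ 0], simp; fail) (rule exI[of _ 2], simp add: r; fail | rule exI[of _ 1], simp add: r; fail | rule exI[of _ 0], simp; fail)+
qed

text \<open>
  Since the inverses add up to more than 1/2, the smallest degree is at most 5. If it is odd, the
  other two agree and are even; if it is 4, the middle one is 4 or 6, since 5 and 7 are excluded by
  parity.
\<close>

lemma sorted_triples:
  assumes adm: "admissible [x, y, z]" and le: "x \<le> y" "y \<le> z" and ne: "x < z"
  shows "[x, y, z] \<in> {[4,6,10], [4,6,8], [3,8,8], [3,10,10], [5,6,6], [4,6,6], [3,6,6]} \<or>
    [x, y, z] = [3,4,4] \<or> (x = 4 \<and> y = 4 \<and> 4 < z)"
proof -
  note D = admissible_3D[OF adm]
  have b: "1 / real z \<le> 1 / real y" "1 / real y \<le> 1 / real x" using D le by (auto intro!: inverse_bound)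
  have "x < 6"
  proof (rule ccontr)
    assume "\<not> x < 6"
    then have "1 / real x \<le> 1 / 6" using inverse_bound[of 6 x] by simp
    then show False using b D(4) by linarith
  qed
  then consider "x = 3" | "x = 4" | "x = 5" using D(1) by linarith
  then show ?thesis
  proof cases
    case 1
    then have yz: "y = z" using D(5) by simp
    have "even y" using D(6) yz ne 1 by auto
    have "y < 12"
    proof (rule ccontr)
      assume "\<not> y < 12"
      then have "1 / real y \<le> 1 / 12" using inverse_bound[of 12 y] by simp
      then show False using b D(4) 1 by simp
    qed
    then have "y \<in> {4, 5, 6, 7, 8, 9, 10, 11}" using ne yz 1 by auto
    then show ?thesis using \<open>even y\<close> yz 1 by auto
  next
    case 2
    have "y < 8"
    proof (rule ccontr)
      assume "\<not> y < 8"
      then have "1 / real y \<le> 1 / 8" using inverse_bound[of 8 y] by simp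
      then show False using b D(4) 2 by simp
    qed
    then have "y \<in> {4, 5, 6, 7}" using le 2 by auto
    moreover have "even y" using D(6) le 2 ne by auto
    ultimately consider "y = 4" | "y = 6" by auto
    then show ?thesis
    proof cases
      case 1
      then show ?thesis using 2 ne by simp
    next
      case y6: 2
      have "z < 12"
      proof (rule ccontr)
        assume "\<not> z < 12"
        then have "1 / real z \<le> 1 / 12" using inverse_bound[of 12 z] by simp
        then show False using D(4) 2 y6 by simp
      qed
      then have "z \<in> {6, 7, 8, 9, 10, 11}" using le y6 by auto
      moreover have "even z" using D(7) 2 y6 by auto
      ultimately show ?thesis using 2 y6 by auto
    qed
  next
    case 3
    then have yz: "y = z" using D(5) by simp
    have "even y" using D(6) yz ne 3 by auto
    have "y < 7"
    proof (rule ccontr)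
      assume "\<not> y < 7"
      then have "1 / real y \<le> 1 / 7" using inverse_bound[of 7 y] by simp
      then show False using b D(4) 3 by simp
    qed
    then have "y \<in> {5, 6}" using le 3 by auto
    then show ?thesis using \<open>even y\<close> yz 3 by auto
  qed
qed

abbreviation listed_symbols :: "nat list set" where
  "listed_symbols \<equiv> thirteen_symbols \<union> prism_symbols \<union> antiprism_symbols"

lemma prism_listed: "3 \<le> m \<Longrightarrow> m \<noteq> 4 \<Longrightarrow> [4, 4, m] \<in> listed_symbols"
  unfolding prism_symbols_def by blast

lemma antiprism_listed: "4 \<le> m \<Longrightarrow> [3, 3, 3, m] \<in> listed_symbols"
  unfolding antiprism_symbols_def by blast

lemma classify_3:
  assumes adm: "admissible [a, b, c]" and ne: "\<not> (a = b \<and> b = c)"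
  shows "\<exists>qs\<in>listed_symbols. same_cyclic [a, b, c] qs"
proof -
  have sorted: "\<exists>qs\<in>listed_symbols. same_cyclic [x, y, z] qs"
    if xyz: "admissible [x, y, z]" "x \<le> y" "y \<le> z" "x < z" for x y z
  proof -
    from sorted_triples[OF xyz] show ?thesis
    proof (elim disjE conjE)
      assume "[x, y, z] \<in> {[4,6,10], [4,6,8], [3,8,8], [3,10,10], [5,6,6], [4,6,6], [3,6,6]}"
      then have "[x, y, z] \<in> thirteen_symbols" unfolding thirteen_symbols_def by auto
      then show ?thesis using same_cyclic_refl[of "[x, y, z]"] by blast
    next
      assume "[x, y, z] = [3, 4, 4]"
      then have "same_cyclic [x, y, z] [4, 4, 3]" using same_cyclic_3(6)[of 3 4 4] by simp
      then show ?thesis using prism_listed[of 3] by auto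
    next
      assume "x = 4" "y = 4" "4 < z"
      then show ?thesis using prism_listed[of z] same_cyclic_refl[of "[x, y, z]"] by auto
    qed
  qed
  have perm: "\<exists>qs\<in>listed_symbols. same_cyclic [a, b, c] qs"
    if "same_cyclic [a, b, c] [x, y, z]" "x \<le> y" "y \<le> z" "x < z" for x y z
    using sorted[OF admissible_same_cyclic[OF that(1) adm] that(2-4)] same_cyclic_trans[OF that(1)] by blast
  consider "a \<le> b" "b \<le> c" | "a \<le> c" "c \<le> b" | "b \<le> a" "a \<le> c" | "b \<le> c" "c \<le> a" | "c \<le> a" "a \<le> b" | "c \<le> b" "b \<le> a"
    by linarith
  then show ?thesis
  proof cases
    case 1
    then have "a < c" using ne by linarith
    then show ?thesis using perm[OF same_cyclic_3(1)] 1 by simp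
  next
    case 2
    then have "a < b" using ne by linarith
    then show ?thesis using perm[OF same_cyclic_3(2)] 2 by simp
  next
    case 3
    then have "b < c" using ne by linarith
    then show ?thesis using perm[OF same_cyclic_3(3)] 3 by simp
  next
    case 4
    then have "b < a" using ne by linarith
    then show ?thesis using perm[OF same_cyclic_3(4)] 4 by simp
  next
    case 5
    then have "c < b" using ne by linarith
    then show ?thesis using perm[OF same_cyclic_3(5)] 5 by simp
  next
    case 6
    then have "c < a" using ne by linarith
    then show ?thesis using perm[OF same_cyclic_3(6)] 6 by simp
  qed
qed

lemma inverse_bounds:
  assumes "3 \<le> p" shows "p = 3 \<or> 1 / real p \<le> 1 / 4" "1 / real p \<le> 1 / 3"
  using assms inverse_bound[of 4 p] inverse_bound[of 3 p] by auto

text \<open>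
  The triangle decides: if a single neighbour of it is also a triangle, then triangles alternate
  around it unless the opposite face is a triangle too; if no neighbour is a triangle, the two
  neighbours must agree.
\<close>

lemma classify_4_aux:
  assumes adm: "admissible [3, b, c, d]" and ne: "\<not> (b = 3 \<and> c = 3 \<and> d = 3)"
  shows "\<exists>qs\<in>listed_symbols. same_cyclic [3, b, c, d] qs"
proof -
  have alt: "\<not> alternates [3, b, c, d] 3 A" for A by (rule admissibleD(3)[OF adm]) simp_all
  have ge: "3 \<le> b" "3 \<le> c" "3 \<le> d" and ineq: "2/3 < 1 / real b + 1 / real c + 1 / real d"
    using admissibleD(1,2)[OF adm] by simp_all
  have rot: "same_cyclic [3, b, c, d] [b, c, d, 3]" "same_cyclic [3, b, c, d] [c, d, 3, b]" "same_cyclic [3, b, c, d] [d, 3, b, c]"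
    unfolding same_cyclic_def
    by (rule exI[of _ 1], simp) (rule exI[of _ 2], simp add: numeral_2_eq_2, rule exI[of _ 3], simp add: numeral_3_eq_3)
  consider "b = 3" "d \<noteq> 3" | "b \<noteq> 3" "d = 3" | "b = 3" "d = 3" | "b \<noteq> 3" "d \<noteq> 3" by blast
  then show ?thesis
  proof cases
    case 1
    have "c = 3" using alt[of "{3}"] 1 by (auto simp: alternates_list)
    then show ?thesis using antiprism_listed[of d] 1 ge same_cyclic_refl[of "[3, b, c, d]"] by fastforce
  next
    case 2
    have "c = 3" using alt[of "{3}"] 2 by (auto simp: alternates_list)
    then show ?thesis using antiprism_listed[of b] 2 ge rot(2) by fastforce
  next
    case 3
    then show ?thesis using antiprism_listed[of c] ne ge rot(3) by fastforce
  next
    case 4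
    have "b = d"
    proof (rule ccontr)
      assume "b \<noteq> d"
      then show False using alt[of "{b}"] 4 by (auto simp: alternates_list)
    qed
    have b4: "4 \<le> b" using 4 ge by simp
    have "b < 6"
    proof (rule ccontr)
      assume "\<not> b < 6"
      then have "1 / real b \<le> 1 / 6" using inverse_bound[of 6 b] by simp
      moreover have "1 / real b = 1 / real d" using \<open>b = d\<close> by simp
      ultimately show False using ineq inverse_bounds(2)[OF ge(2)] by linarith
    qed
    then consider "b = 4" | "b = 5" using b4 by linarith
    then show ?thesis
    proof cases
      case 1
      have "c < 6"
      proof (rule ccontr)
        assume "\<not> c < 6"
        then have "1 / real c \<le> 1 / 6" using inverse_bound[of 6 c] by simp
        then show False using ineq 1 \<open>b = d\<close> by simp
      qed
      then have "c \<in> {3, 4, 5}" using ge by auto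
      then have "[3, b, c, d] \<in> listed_symbols" using 1 \<open>b = d\<close> unfolding thirteen_symbols_def by auto
      then show ?thesis using same_cyclic_refl by blast
    next
      case 2
      have "c < 4"
      proof (rule ccontr)
        assume "\<not> c < 4"
        then have "1 / real c \<le> 1 / 4" using inverse_bound[of 4 c] by simp
        then show False using ineq 2 \<open>b = d\<close> by simp
      qed
      then have "c = 3" using ge by auto
      then have "[3, b, c, d] \<in> listed_symbols" using 2 \<open>b = d\<close> unfolding thirteen_symbols_def by auto
      then show ?thesis using same_cyclic_refl by blast
    qed
  qed
qed

text \<open>
  Four degrees that are at least 4 have inverses adding up to at most 1, so there is a triangle.
\<close>

lemma classify_4:
  assumes adm: "admissible [a, b, c, d]" and ne: "\<not> (a = b \<and> b = c \<and> c = d)"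
  shows "\<exists>qs\<in>listed_symbols. same_cyclic [a, b, c, d] qs"
proof -
  have ge: "3 \<le> a" "3 \<le> b" "3 \<le> c" "3 \<le> d" and ineq: "1 < 1 / real a + 1 / real b + 1 / real c + 1 / real d"
    using admissibleD(1,2)[OF adm] by simp_all
  have rot: "same_cyclic [a, b, c, d] [b, c, d, a]" "same_cyclic [a, b, c, d] [c, d, a, b]" "same_cyclic [a, b, c, d] [d, a, b, c]"
    unfolding same_cyclic_def
    by (rule exI[of _ 1], simp) (rule exI[of _ 2], simp add: numeral_2_eq_2, rule exI[of _ 3], simp add: numeral_3_eq_3)
  have go: "\<exists>qs\<in>listed_symbols. same_cyclic [a, b, c, d] qs"
    if r: "same_cyclic [a, b, c, d] [3, x, y, z]" and n: "\<not> (x = 3 \<and> y = 3 \<and> z = 3)" for x y z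
    using classify_4_aux[OF admissible_same_cyclic[OF r adm] n] same_cyclic_trans[OF r] by blast
  consider "a = 3" | "b = 3" | "c = 3" | "d = 3" | "a \<noteq> 3" "b \<noteq> 3" "c \<noteq> 3" "d \<noteq> 3" by blast
  then show ?thesis
  proof cases
    case 1 then show ?thesis using go[of b c d] ne same_cyclic_refl by metis
  next
    case 2 then show ?thesis using go[of c d a] ne rot(1) by metis
  next
    case 3 then show ?thesis using go[of d a b] ne rot(2) by metis
  next
    case 4 then show ?thesis using go[of a b c] ne rot(3) by metis
  next
    case 5
    then have "1 / real a \<le> 1 / 4" "1 / real b \<le> 1 / 4" "1 / real c \<le> 1 / 4" "1 / real d \<le> 1 / 4"
      using inverse_bounds(1) ge by blast+
    then show ?thesis using ineq by linarith
  qed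
qed

text \<open>
  Two degrees that are at least 4 would leave at most \<open>1/4 + 1/4 + 3 \<cdot> 1/3 = 3/2\<close>
  for the sum of the inverses.
\<close>

lemma classify_5:
  assumes adm: "admissible [a, b, c, d, e]" and ne: "\<not> (a = b \<and> b = c \<and> c = d \<and> d = e)"
  shows "\<exists>qs\<in>listed_symbols. same_cyclic [a, b, c, d, e] qs"
proof -
  have ge: "3 \<le> a" "3 \<le> b" "3 \<le> c" "3 \<le> d" "3 \<le> e"
    and ineq: "3/2 < 1 / real a + 1 / real b + 1 / real c + 1 / real d + 1 / real e"
    using admissibleD(1,2)[OF adm] by simp_all
  have rot: "same_cyclic [a, b, c, d, e] [b, c, d, e, a]" "same_cyclic [a, b, c, d, e] [c, d, e, a, b]"
    "same_cyclic [a, b, c, d, e] [d, e, a, b, c]" "same_cyclic [a, b, c, d, e] [e, a, b, c, d]"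
    unfolding same_cyclic_def
    by (rule exI[of _ 1], simp) (rule exI[of _ 2], simp add: numeral_eq_Suc, rule exI[of _ 3], simp add: numeral_eq_Suc,
      rule exI[of _ 4], simp add: numeral_eq_Suc)
  have go: "\<exists>qs\<in>listed_symbols. same_cyclic [a, b, c, d, e] qs"
    if r: "same_cyclic [a, b, c, d, e] [3, 3, 3, 3, m]" and m: "3 \<le> m" "m \<noteq> 3" "3/2 < 4/3 + 1 / real m" for m
  proof -
    have "m < 6"
    proof (rule ccontr)
      assume "\<not> m < 6"
      then have "1 / real m \<le> 1 / 6" using inverse_bound[of 6 m] by simp
      then show False using m(3) by linarith
    qed
    then have "m \<in> {4, 5}" using m by auto
    then have "[3, 3, 3, 3, m] \<in> listed_symbols" unfolding thirteen_symbols_def by auto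
    then show ?thesis using r by blast
  qed
  note U = inverse_bounds(2)[OF ge(1)] inverse_bounds(2)[OF ge(2)] inverse_bounds(2)[OF ge(3)]
    inverse_bounds(2)[OF ge(4)] inverse_bounds(2)[OF ge(5)]
  \<comment> \<open>Any three inverses add up to at most 1, so any two add up to more than 1/2.\<close>
  have pair: "x = 3 \<or> y = 3" if "3 \<le> x" "3 \<le> y" "1/2 < 1 / real x + 1 / real y" for x y
    using inverse_bounds(1)[OF that(1)] inverse_bounds(1)[OF that(2)] that(3) by linarith
  have pab: "a = 3 \<or> b = 3" by (rule pair[OF ge(1) ge(2)]) (use ineq U in linarith)
  have pac: "a = 3 \<or> c = 3" by (rule pair[OF ge(1) ge(3)]) (use ineq U in linarith)
  have pad: "a = 3 \<or> d = 3" by (rule pair[OF ge(1) ge(4)]) (use ineq U in linarith)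
  have pae: "a = 3 \<or> e = 3" by (rule pair[OF ge(1) ge(5)]) (use ineq U in linarith)
  have pbc: "b = 3 \<or> c = 3" by (rule pair[OF ge(2) ge(3)]) (use ineq U in linarith)
  have pbd: "b = 3 \<or> d = 3" by (rule pair[OF ge(2) ge(4)]) (use ineq U in linarith)
  have pbe: "b = 3 \<or> e = 3" by (rule pair[OF ge(2) ge(5)]) (use ineq U in linarith)
  have pcd: "c = 3 \<or> d = 3" by (rule pair[OF ge(3) ge(4)]) (use ineq U in linarith)
  have pce: "c = 3 \<or> e = 3" by (rule pair[OF ge(3) ge(5)]) (use ineq U in linarith)
  have pde: "d = 3 \<or> e = 3" by (rule pair[OF ge(4) ge(5)]) (use ineq U in linarith)
  consider "a \<noteq> 3" | "b \<noteq> 3" | "c \<noteq> 3" | "d \<noteq> 3" | "e \<noteq> 3" using ne by metis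
  then show ?thesis
  proof cases
    case 1
    then have "b = 3" "c = 3" "d = 3" "e = 3" using pab pac pad pae by simp_all
    then show ?thesis using go[of a] 1 ge ineq rot(1) by simp
  next
    case 2
    then have "a = 3" "c = 3" "d = 3" "e = 3" using pab pbc pbd pbe by simp_all
    then show ?thesis using go[of b] 2 ge ineq rot(2) by simp
  next
    case 3
    then have "a = 3" "b = 3" "d = 3" "e = 3" using pac pbc pcd pce by simp_all
    then show ?thesis using go[of c] 3 ge ineq rot(3) by simp
  next
    case 4
    then have "a = 3" "b = 3" "c = 3" "e = 3" using pad pbd pcd pde by simp_all
    then show ?thesis using go[of d] 4 ge ineq rot(4) by simp
  next
    case 5
    then have "a = 3" "b = 3" "c = 3" "d = 3" using pae pbe pce pde by simp_all
    then show ?thesis using go[of e] 5 ge ineq same_cyclic_refl[of "[a, b, c, d, e]"] by simp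
  qed
qed

text \<open>
  All inverses are at most 1/3, so \<open>r / 2 - 1 < r / 3\<close>, and a symbol has at most five
  entries.
\<close>

theorem admissible_listed:
  assumes adm: "admissible ps" and len: "3 \<le> length ps" and ne: "\<not> (\<exists>p. set ps = {p})"
  shows "\<exists>qs\<in>listed_symbols. same_cyclic ps qs"
proof -
  have "inverse_sum ps \<le> real (length ps) / 3"
  proof -
    have "inverse_sum ps \<le> (\<Sum>p\<leftarrow>ps. 1/3)" unfolding inverse_sum_def
      using adm inverse_bounds(2) unfolding admissible_def by (intro sum_list_mono) auto
    then show ?thesis by (simp add: sum_list_triv)
  qed
  then have "length ps < 6" using adm unfolding admissible_def by linarith
  then consider "length ps = 3" | "length ps = 4" | "length ps = 5" using len by linarith
  then show ?thesis
  proof cases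
    case 1
    then obtain a b c where "ps = [a, b, c]" by (auto simp: numeral_eq_Suc length_Suc_conv)
    then show ?thesis using classify_3[of a b c] adm ne by auto
  next
    case 2
    then obtain a b c d where "ps = [a, b, c, d]" by (auto simp: numeral_eq_Suc length_Suc_conv)
    then show ?thesis using classify_4[of a b c d] adm ne by auto
  next
    case 3
    then obtain a b c d e where "ps = [a, b, c, d, e]" by (auto simp: numeral_eq_Suc length_Suc_conv)
    then show ?thesis using classify_5[of a b c d e] adm ne by auto
  qed
qed

section \<open>The classification\<close>

lemma listed_symbol_realised:
  assumes "qs \<in> listed_symbols"
  shows "\<exists>V E. archimedean V E \<and> vertex_symbol V E qs"
proof -
  consider "qs \<in> thirteen_symbols" | m where "qs = [4, 4, m]" "3 \<le> m" | m where "qs = [3, 3, 3, m]" "3 \<le> m"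
    using assms unfolding prism_symbols_def antiprism_symbols_def by fastforce
  then show ?thesis
  proof cases
    case 1
    then show ?thesis unfolding thirteen_symbols_def
      by (elim insertE emptyE) (simp_all only:
        certificate_realises[OF cuboctahedron]
        certificate_realises[OF great_rhombicosidodecahedron]
        certificate_realises[OF great_rhombicuboctahedron]
        certificate_realises[OF icosidodecahedron]
        certificate_realises[OF small_rhombicosidodecahedron]
        certificate_realises[OF small_rhombicuboctahedron]
        certificate_realises[OF snub_cube]
        certificate_realises[OF snub_dodecahedron]
        certificate_realises[OF truncated_cube]
        certificate_realises[OF truncated_dodecahedron]
        certificate_realises[OF truncated_icosahedron]
        certificate_realises[OF truncated_octahedron]
        certificate_realises[OF truncated_tetrahedron])
  next
    case (2 m)
    then show ?thesis using ring_grid.prism_realised[of m "pi / real m"] by (simp add: ring_grid_def)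
  next
    case (3 m)
    then show ?thesis using ring_grid.antiprism_realised[of m "pi / real m"] by (simp add: ring_grid_def)
  qed
qed

theorem theorem1:
  fixes ps :: "nat list"
  assumes "length ps \<ge> 3"
    and "\<forall>p\<in>set ps. p \<ge> 3"
    and "\<not> (\<exists>p. set ps = {p})"
  shows "(\<exists>V E. archimedean V E \<and> vertex_symbol V E ps) \<longleftrightarrow>
         (\<exists>qs \<in> thirteen_symbols \<union> prism_symbols \<union> antiprism_symbols. same_cyclic ps qs)"
proof
  assume "\<exists>V E. archimedean V E \<and> vertex_symbol V E ps"
  then obtain V E where "polyhedral_map V E" "vertex_symbol V E ps" unfolding archimedean_def by blast
  then have "admissible ps" using symbol_admissible assms(2) by blast
  then show "\<exists>qs \<in> thirteen_symbols \<union> prism_symbols \<union> antiprism_symbols. same_cyclic ps qs"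
    using admissible_listed assms(1,3) by blast
next
  assume "\<exists>qs \<in> thirteen_symbols \<union> prism_symbols \<union> antiprism_symbols. same_cyclic ps qs"
  then obtain qs where qs: "qs \<in> listed_symbols" "same_cyclic ps qs" by blast
  obtain V E where VE: "archimedean V E" "vertex_symbol V E qs" using listed_symbol_realised[OF qs(1)] by blast
  have "vertex_symbol V E ps"
    using VE(2) same_cyclic_trans[OF qs(2)] unfolding vertex_symbol_def by blast
  then show "\<exists>V E. archimedean V E \<and> vertex_symbol V E ps" using VE(1) by blast
qed

end
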